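(* Let $n\ge2$, let $\mathbf r=(r_1,\dots,r_n)\in\mathbb{Z}_{>0}^n$, and suppose $N=r_1+\cdots+r_n$ is even. Then the fractional parts of the numbers $$\frac{d_{N,n}\,q^{N-n}}{r_1!\cdots r_n!}\,s_{\mathbf r}(q;p_1,\dots,p_{n-1}),\qquad (q;p_1,\dots,p_{n-1})\in I_n,$$ are equidistributed in $[0,1)$; that is, for every nonzero integer $k$, $$\lim_{x\to\infty}\frac1{|I_n(x)|}\sum_{(q;p_1,\dots,p_{n-1})\in I_n(x)}\exp\!\left(2\pi i k\,\frac{d_{N,n}\,q^{N-n}}{r_1!\cdots r_n!}\,s_{\mathbf r}(q;p_1,\dots,p_{n-1})\right)=0 .$$
   Context: $I_n$ is the set of $(q;p_1,\dots,p_{n-1})\in\mathbb{Z}_{>0}^n$ such that $p_1,\dots,p_{n-1}<q$ and each $p_i$ is relatively prime to $q$; for real $x>0$, $I_n(x)$ is the (finite) set of those elements with $q<x$. A family of real numbers indexed by $I_n$ is called equidistributed when it satisfies the Weyl-type criterion displayed in the claim. Bernoulli polynomials $B_k(x)$ are defined by $\frac{ze^{xz}}{e^z-1}=\sum_{k\ge0}\frac{B_k(x)}{k!}z^k$, and $B_k=B_k(0)$. The periodic Bernoulli function $\tilde B_k:\mathbb{R}\to\mathbb{R}$ has period $1$, with $\tilde B_k(t)=B_k(t)$ for $t\in(0,1)$, $\tilde B_k(0)=B_k$ for $k\neq1$, and $\tilde B_1(0)=0$. The generalized Dedekind sum is $$s_{\mathbf r}(q;p_1,\dots,p_{n-1})=\sum_{k_1,\dots,k_{n-1}\in\mathbb{Z}/q\mathbb{Z}}\tilde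 B_{r_1}\!\left(\tfrac{k_1}{q}\right)\cdots\tilde B_{r_{n-1}}\!\left(\tfrac{k_{n-1}}{q}\right)\tilde B_{r_n}\!\left(\tfrac{\sum_{i=1}^{n-1}p_ik_i}{q}\right).$$ $d_{N,n}$ is the least common multiple of the denominators of the coefficients of the polynomial $$\mathrm{Todd}^N(x_1,\dots,x_n)=(-1)^N\sum_{m_1+\cdots+m_n=N,\ m_i\ge0}\ \prod_{i=1}^n\frac{B_{m_i}}{m_i!}x_i^{m_i}.$$ *)

theory Defs
  imports
    "HOL-Analysis.Analysis"
    "HOL-Computational_Algebra.Formal_Power_Series"
    "HOL-Library.Poly_Mapping"
    "HOL-Library.FuncSet"
begin

text \<open>
  An \<open>n\<close>-tuple \<open>(a\<^sub>1, \<dots>, a\<^sub>n)\<close> is represented by a function on \<open>nat\<close> of which only the values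
  on \<open>{1..n}\<close> matter; where tuples are counted or summed over, they range over extensional
  function spaces, so that each tuple occurs exactly once.
\<close>

subsection \<open>Bernoulli polynomials\<close>

text \<open>
  The field is left generic: the Bernoulli numbers are needed as rationals (for their
  denominators) and the Bernoulli polynomials as functions on the reals.
\<close>

definition bernpoly :: "nat \<Rightarrow> 'a::field_char_0 \<Rightarrow> 'a" where
  "bernpoly k x = fact k * fps_nth ((fps_X * fps_exp x) / (fps_exp 1 - 1)) k"

definition bernoulli :: "nat \<Rightarrow> 'a::field_char_0" where
  "bernoulli k = bernpoly k 0"

text \<open>
  Division of power series is not always exact, even over a field; here it is.
\<close>

lemma bernpoly_generating_function:
  "(fps_exp 1 - 1) * Abs_fps (\<lambda>k. bernpoly k (x::'a::field_char_0) / fact k) = fps_X * fps_exp x"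
proof -
  have ne: "fps_exp 1 - 1 \<noteq> (0::'a fps)"
    by (auto simp: fps_eq_iff intro!: exI[of _ 1])
  have "subdegree (fps_exp 1 - 1 :: 'a fps) = 1"
    by (rule subdegreeI) auto
  moreover have "subdegree (fps_X * fps_exp x) \<ge> 1"
    by (rule subdegree_geI) (auto simp: fps_eq_iff intro!: exI[of _ 1])
  ultimately have "(fps_exp 1 - 1) dvd (fps_X * fps_exp x)"
    using ne by (simp add: fps_dvd_iff)
  moreover have "Abs_fps (\<lambda>k. bernpoly k x / fact k) = (fps_X * fps_exp x) / (fps_exp 1 - 1)"
    by (simp add: bernpoly_def fps_eq_iff)
  ultimately show ?thesis by simp
qed

definition periodic_bernoulli :: "nat \<Rightarrow> real \<Rightarrow> real" where
  "periodic_bernoulli k t =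
     (if t \<in> \<int> then (if k = 1 then 0 else bernoulli k) else bernpoly k (frac t))"

subsection \<open>Generalized Dedekind sums\<close>

text \<open>
  The residue classes modulo \<open>q\<close> are represented by \<open>0, \<dots>, q - 1\<close>; the summand only depends
  on the classes, by periodicity.
\<close>

definition dedekind_sum :: "nat \<Rightarrow> (nat \<Rightarrow> nat) \<Rightarrow> nat \<Rightarrow> (nat \<Rightarrow> nat) \<Rightarrow> real" where
  "dedekind_sum n r q p =
     (\<Sum>k \<in> {1..n-1} \<rightarrow>\<^sub>E {0..<q}.
        (\<Prod>i\<in>{1..n-1}. periodic_bernoulli (r i) (real (k i) / real q)) *
        periodic_bernoulli (r n) (real (\<Sum>i\<in>{1..n-1}. p i * k i) / real q))"

definition I_set :: "nat \<Rightarrow> (nat \<times> (nat \<Rightarrow> nat)) set" where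
  "I_set n = {(q, p). q > 0 \<and> p \<in> {1..n-1} \<rightarrow>\<^sub>E {0<..<q} \<and> (\<forall>i\<in>{1..n-1}. coprime (p i) q)}"

definition I_set_below :: "nat \<Rightarrow> real \<Rightarrow> (nat \<times> (nat \<Rightarrow> nat)) set" where
  "I_set_below n x = {(q, p) \<in> I_set n. real q < x}"

lemma finite_I_set_below: "finite (I_set_below n x)"
proof (rule finite_subset)
  show "I_set_below n x \<subseteq> {..nat \<lfloor>x\<rfloor>} \<times> ({1..n-1} \<rightarrow>\<^sub>E {..nat \<lfloor>x\<rfloor>})"
  proof
    fix z assume "z \<in> I_set_below n x"
    then obtain q p where z: "z = (q, p)" and q: "real q < x"
      and p: "p \<in> {1..n-1} \<rightarrow>\<^sub>E {0<..<q}"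
      by (auto simp: I_set_below_def I_set_def)
    have "q \<le> nat \<lfloor>x\<rfloor>" using q by (simp add: le_nat_floor)
    moreover have "p \<in> {1..n-1} \<rightarrow>\<^sub>E {..nat \<lfloor>x\<rfloor>}"
      by (rule subsetD[OF PiE_mono p]) (use \<open>q \<le> nat \<lfloor>x\<rfloor>\<close> in auto)
    ultimately show "z \<in> {..nat \<lfloor>x\<rfloor>} \<times> ({1..n-1} \<rightarrow>\<^sub>E {..nat \<lfloor>x\<rfloor>})"
      by (simp add: z)
  qed
qed (intro finite_cartesian_product finite_PiE finite_atMost finite_atLeastAtMost ballI)

text \<open>
  Weyl's criterion, taken as the definition of equidistribution in \<open>[0, 1)\<close> of the fractional
  parts of a family indexed by \<open>I_set n\<close>. Passing to fractional parts does not change the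
  exponentials.
\<close>

definition equidistributed_frac :: "nat \<Rightarrow> (nat \<Rightarrow> (nat \<Rightarrow> nat) \<Rightarrow> real) \<Rightarrow> bool" where
  "equidistributed_frac n f \<longleftrightarrow>
     (\<forall>k::int. k \<noteq> 0 \<longrightarrow>
        ((\<lambda>x::real. (\<Sum>(q, p)\<in>I_set_below n x. exp (2 * of_real pi * \<i> * of_int k * of_real (f q p)))
                     / of_nat (card (I_set_below n x)))
          \<longlongrightarrow> (0::complex)) at_top)"

subsection \<open>Todd polynomials\<close>

text \<open>
  Polynomials in \<open>x\<^sub>1, x\<^sub>2, \<dots>\<close> with rational coefficients are finitely supported maps from
  exponent vectors to \<open>rat\<close>, with the convolution product of \<^theory>\<open>HOL-Library.Poly_Mapping\<close>.
\<close>

definition compositions :: "nat \<Rightarrow> nat \<Rightarrow> (nat \<Rightarrow> nat) set" where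
  "compositions N n = {m \<in> {1..n} \<rightarrow>\<^sub>E UNIV. (\<Sum>i\<in>{1..n}. m i) = N}"

lemma finite_compositions: "finite (compositions N n)"
proof (rule finite_subset)
  show "compositions N n \<subseteq> {1..n} \<rightarrow>\<^sub>E {..N}"
  proof
    fix m assume m: "m \<in> compositions N n"
    then have "m i \<le> N" if "i \<in> {1..n}" for i
      using member_le_sum[of i "{1..n}" m] that by (simp add: compositions_def)
    with m show "m \<in> {1..n} \<rightarrow>\<^sub>E {..N}"
      unfolding compositions_def PiE_def Pi_def by blast
  qed
qed (intro finite_PiE finite_atMost finite_atLeastAtMost)

definition todd :: "nat \<Rightarrow> nat \<Rightarrow> (nat \<Rightarrow>\<^sub>0 nat) \<Rightarrow>\<^sub>0 rat" where
  "todd N n = (- 1) ^ N *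
     (\<Sum>m\<in>compositions N n.
        \<Prod>i\<in>{1..n}. Poly_Mapping.single (Poly_Mapping.single i (m i)) (bernoulli (m i) / fact (m i)))"

definition rat_denom :: "rat \<Rightarrow> int" where
  "rat_denom c = snd (quotient_of c)"

definition todd_denom :: "nat \<Rightarrow> nat \<Rightarrow> int" where
  "todd_denom N n = Lcm ((\<lambda>m. rat_denom (Poly_Mapping.lookup (todd N n) m)) ` Poly_Mapping.keys (todd N n))"

end

theory Submission
  imports Defs "HOL-Computational_Algebra.Computational_Algebra" "HOL-Number_Theory.Cong"
begin

text \<open>
  Expanding \<open>c(e\<^sup>y) = (e\<^sup>y + 1) / (2 (e\<^sup>y - 1))\<close> at the \<open>q\<close>-th roots of unity, the generalized Dedekind sums
  for all exponents become the Laurent coefficients in \<open>y\<close> of the sum of \<open>\<Prod>\<^sub>i c(\<zeta>\<^sup>w\<^sup>i e\<^sup>y\<^sup>i)\<close> over \<open>\<zeta>\<^sup>q = 1\<close>.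
  The residue theorem for \<open>c(z\<^sup>q) \<Prod>\<^sub>i c(z\<^sup>w\<^sup>i e\<^sup>y\<^sup>i) dz/z\<close> is a reciprocity law that expresses this sum by
  the analogous sums of orders \<open>w\<^sub>i\<close>.

  Fix a prime \<open>t\<close>. If \<open>t\<close> does not divide \<open>q\<close>, induction on \<open>q\<close> along the reciprocity law, with all
  orders prime to \<open>t\<close>, shows that \<open>d\<^sub>N\<^sub>,\<^sub>n\<close> clears \<open>t\<close> from the denominators; Gauss's lemma takes care of
  the linear forms in \<open>y\<close> that occur as denominators. If \<open>t\<close> divides \<open>q\<close>, one application of the law shows
  that the number in question is \<open>1/q\<close> times an explicit Laurent polynomial in the \<open>p\<^sub>i\<close>, up to a
  \<open>t\<close>-integral error. Its top coefficient in \<open>p\<^sub>1\<close> is a nonzero multiple of \<open>B\<^sub>N\<close>, and \<open>N\<close> is even.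

  Hence, if a large prime \<open>l\<close> divides \<open>q = l m\<close> exactly, the Weyl sum over the \<open>p\<close> in a fixed class modulo \<open>m\<close>
  is, up to a unimodular factor, an exponential sum modulo \<open>l\<close> in which the Laurent polynomial is
  multiplied by \<open>k m\<^sup>-\<^sup>1\<close>. Averaging over \<open>m\<close> modulo \<open>l\<close>, orthogonality and Lagrange's bound on the number of
  roots give a saving of \<open>l\<^sup>1\<^sup>/\<^sup>2\<close> on average, so that no bound for individual exponential sums is needed.
  As the sum of \<open>1/l\<close> over the primes diverges, all \<open>q\<close> outside a set of small density have such
  a prime in a suitable finite window.
\<close>

text \<open>The symmetric c(z) = 1/2 + 1/(z - 1) is chosen because c(1/z) = - c(z). It replaces B_1
  by 0, the convention of the periodic function at 0, and it allows w_i to be replaced by - w_i at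
  the cost of a sign. This freedom keeps the induction on q prime to t: if t divides a residue r of
  w_i but not q, then it does not divide q - r.

  The reciprocity law is one equation between whole families of sums, so single coefficients must be
  recovered from it. The y_i are therefore specialized to widely spaced powers of one transcendental
  complex number; complex, because roots of unity occur as well. When t divides q, the only factors
  that are not t-integral are inverses of q y_i / w_i. They come with m_i = 0, where the sum of
  order w_i collapses to a product of Bernoulli numbers, and a partial fraction identity rewrites
  the resulting rational functions of y as Laurent monomials.

  The final count is measured against the size of I_n(x), which is at least of order x^n; hence a
  saving that holds for most q suffices.\<close>

unbundle fps_syntax
unbundle no vec_syntax

subsection \<open>Residues of products of Cayley transforms\<close>

text \<open>Both sides are minus the residue at infinity of \<open>P\<close> over the product of all
  z - b. Being purely algebraic, this serves as residue theorem over a field of Laurent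
  series.\<close>

lemma lagrange_leading_coeff:
  fixes P :: "'a::field poly"
  assumes "finite T" "degree P < card T"
  shows "(\<Sum>a\<in>T. poly P a / (\<Prod>b\<in>T-{a}. a - b)) = coeff P (card T - 1)"
proof -
  define R where "R a = (\<Prod>b\<in>T-{a}. [:-b, 1:])" for a
  define Q where "Q = (\<Sum>a\<in>T. smult (poly P a / (\<Prod>b\<in>T-{a}. a - b)) (R a))"
  have degR: "degree (R a) = card T - 1" "coeff (R a) (card T - 1) = 1" if "a \<in> T" for a
  proof -
    show "degree (R a) = card T - 1"
      unfolding R_def using that assms by (subst degree_prod_sum_eq) (auto)
    moreover have "lead_coeff (R a) = 1"
      unfolding R_def by (simp add: lead_coeff_prod)
    ultimately show "coeff (R a) (card T - 1) = 1" by simp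
  qed
  have "poly Q c = poly P c" if c: "c \<in> T" for c
  proof -
    have "poly Q c = (\<Sum>a\<in>T. poly P a / (\<Prod>b\<in>T-{a}. a - b) * (\<Prod>b\<in>T-{a}. c - b))"
      by (simp add: Q_def R_def poly_sum poly_prod)
    also have "\<dots> = (\<Sum>a\<in>T. if a = c then poly P c else 0)"
    proof (rule sum.cong[OF refl])
      fix a assume a: "a \<in> T"
      have "(\<Prod>b\<in>T-{a}. c - b) = 0" if "a \<noteq> c"
        using assms c that by (intro prod_zero) auto
      moreover have "(\<Prod>b\<in>T-{c}. c - b) \<noteq> 0" using assms by auto
      ultimately show "poly P a / (\<Prod>b\<in>T-{a}. a - b) * (\<Prod>b\<in>T-{a}. c - b) = (if a = c then poly P c else 0)"
        by auto
    qed
    also have "\<dots> = poly P c" using c assms by simp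
    finally show ?thesis .
  qed
  moreover have "degree Q < card T"
  proof -
    have "degree Q \<le> card T - 1"
      unfolding Q_def using assms degR
      by (intro degree_sum_le) (auto intro: order_trans[OF degree_smult_le])
    then show ?thesis using assms(2) by linarith
  qed
  ultimately have "P = Q"
    using assms by (intro poly_eqI_degree[of T]) auto
  then have "coeff P (card T - 1) = coeff Q (card T - 1)" by simp
  also have "\<dots> = (\<Sum>a\<in>T. poly P a / (\<Prod>b\<in>T-{a}. a - b))"
    unfolding Q_def coeff_sum by (intro sum.cong refl) (simp add: degR(2) del: One_nat_def)
  finally show ?thesis by simp
qed

lemma poly_eq_smult_prod_roots:
  fixes D :: "'a::field poly"
  assumes "finite S" "\<And>a. a \<in> S \<Longrightarrow> poly D a = 0" "degree D = card S"
  shows "D = smult (lead_coeff D) (\<Prod>a\<in>S. [:-a, 1:])"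
proof (cases "S = {}")
  case True
  then show ?thesis using assms by (auto elim: degree_eq_zeroE)
next
  case False
  define M where "M = (\<Prod>a\<in>S. [:-a, 1:])"
  have "degree M = card S"
    unfolding M_def using assms by (subst degree_prod_sum_eq) auto
  moreover have "lead_coeff M = 1"
    unfolding M_def by (simp add: lead_coeff_prod)
  ultimately have M: "degree M = card S" "lead_coeff M = 1" by auto
  have pos: "card S > 0" using False assms by (simp add: card_gt_0_iff)
  have "degree (D - smult (lead_coeff D) M) < card S"
  proof -
    have "degree (D - smult (lead_coeff D) M) \<le> card S"
      using assms M by (intro degree_diff_le) auto
    moreover have "coeff (D - smult (lead_coeff D) M) (card S) = 0"
      using M assms by simp
    ultimately show ?thesis
      using pos by (metis coeff_0_degree_minus_1 eq_zero_or_degree_less degree_0)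
  qed
  moreover have "poly (D - smult (lead_coeff D) M) a = 0" if "a \<in> S" for a
    using assms that by (auto simp: M_def poly_prod intro!: prod_zero)
  ultimately have "D - smult (lead_coeff D) M = 0"
    using pos by (intro poly_eqI_degree[of S]) auto
  then show ?thesis by (simp add: M_def)
qed

text \<open>Equals 1/2 + 1/(z - 1): it tends to 1/2 at infinity, is -1/2 at 0, and changes sign
  under inversion of z.\<close>

definition cayley :: "'a::field \<Rightarrow> 'a" where
  "cayley z = (z + 1) / (2 * (z - 1))"

text \<open>Residue theorem for the product of all \<open>cayley (x i * z ^ w i)\<close> times dz/z.
  The zeros of the i-th denominator are the points \<xi> times \<open>\<eta> i\<close>, and the
  residue there is 1/\<open>w i\<close> times the other factors. The right side is the value of the
  product at infinity minus its value at 0. By \<open>dis\<close>, all poles are simple.\<close>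

lemma residue_sum:
  fixes x \<eta> :: "'i \<Rightarrow> 'a::field_char_0" and w :: "'i \<Rightarrow> nat"
  assumes fin: "finite J" and wpos: "\<And>i. i \<in> J \<Longrightarrow> w i > 0"
    and eta: "\<And>i. i \<in> J \<Longrightarrow> x i * \<eta> i ^ w i = 1"
    and cU: "\<And>i. i \<in> J \<Longrightarrow> card {\<xi>::'a. \<xi> ^ w i = 1} = w i"
    and dis: "\<And>i k \<xi>. i \<in> J \<Longrightarrow> k \<in> J \<Longrightarrow> i \<noteq> k \<Longrightarrow> \<xi> ^ w i = 1 \<Longrightarrow> x k * (\<xi> * \<eta> i) ^ w k \<noteq> 1"
  shows "(\<Sum>i\<in>J. (\<Sum>\<xi> | \<xi> ^ w i = 1. \<Prod>k\<in>J-{i}. cayley (x k * (\<xi> * \<eta> i) ^ w k)) / of_nat (w i))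
          = (1/2) ^ card J * (1 - (-1) ^ card J)" (is "?X = _")
proof -
  define S where "S i = {a. x i * a ^ w i = 1}" for i
  define T where "T = (\<Union>i\<in>J. S i)"
  have nz: "x i \<noteq> 0" "\<eta> i \<noteq> 0" if "i \<in> J" for i
    using eta[OF that] wpos[OF that] by (auto simp: power_0_left)
  have S_img: "S i = (\<lambda>\<xi>. \<xi> * \<eta> i) ` {\<xi>. \<xi> ^ w i = 1}" if "i \<in> J" for i
  proof -
    have "a \<in> (\<lambda>\<xi>. \<xi> * \<eta> i) ` {\<xi>. \<xi> ^ w i = 1}" if "x i * a ^ w i = 1" for a
    proof (rule image_eqI[where x = "a / \<eta> i"])
      have "a ^ w i = \<eta> i ^ w i" using that eta[OF \<open>i \<in> J\<close>] nz[OF \<open>i \<in> J\<close>]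
        by (metis mult_left_cancel)
      then show "a / \<eta> i \<in> {\<xi>. \<xi> ^ w i = 1}" using nz[OF \<open>i \<in> J\<close>]
        by (simp add: power_divide)
    qed (use nz \<open>i \<in> J\<close> in auto)
    then show ?thesis using eta[OF that] by (auto simp: S_def power_mult_distrib)
  qed
  have inj: "inj_on (\<lambda>\<xi>. \<xi> * \<eta> i) A" if "i \<in> J" for i A
    using nz[OF that] by (auto simp: inj_on_def)
  have cS: "card (S i) = w i" if "i \<in> J" for i
    using S_img[OF that] inj[OF that] cU[OF that] by (simp add: card_image)
  then have fS: "finite (S i)" if "i \<in> J" for i
    using that wpos by (intro card_ge_0_finite) force
  have disS: "x k * a ^ w k \<noteq> 1" if "i \<in> J" "k \<in> J" "i \<noteq> k" "a \<in> S i" for i k a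
    using that dis by (auto simp: S_img)
  have finT: "finite T" using fin fS by (auto simp: T_def)
  have disj: "S i \<inter> S k = {}" if "i \<in> J" "k \<in> J" "i \<noteq> k" for i k
  proof -
    have "a \<notin> S k" if "a \<in> S i" for a
      using disS[OF \<open>i \<in> J\<close> \<open>k \<in> J\<close> \<open>i \<noteq> k\<close> that] by (simp add: S_def)
    then show ?thesis by blast
  qed
  have "card T = (\<Sum>i\<in>J. card (S i))"
    unfolding T_def by (rule card_UN_disjoint) (use fin fS disj in blast)+
  then have cT: "card T = (\<Sum>i\<in>J. w i)" by (simp add: cS)
  have nzS: "a \<noteq> 0" if "i \<in> J" "a \<in> S i" for i a
    using that wpos[of i] by (auto simp: S_def power_0_left)
  define L where "L = (\<Prod>i\<in>J. x i)"
  define D where "D = (\<Prod>i\<in>J. smult (x i) (monom 1 (w i)) - 1)"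
  define P where "P = (\<Prod>i\<in>J. smult (x i) (monom 1 (w i)) + 1)"
  have L0: "L \<noteq> 0" using nz fin by (simp add: L_def)
  have d1: "degree (smult (x i) (monom 1 (w i)) + [:c:]) = w i"
       "lead_coeff (smult (x i) (monom 1 (w i)) + [:c:]) = x i" if "i \<in> J" for i c
  proof -
    have "degree (smult (x i) (monom 1 (w i))) = w i" using nz[OF that]
      by (simp add: degree_monom_eq)
    then show A: "degree (smult (x i) (monom 1 (w i)) + [:c:]) = w i"
      using wpos[OF that] by (subst degree_add_eq_left) auto
    show "lead_coeff (smult (x i) (monom 1 (w i)) + [:c:]) = x i"
      unfolding A using wpos[OF that] by (simp add: coeff_pCons split: nat.splits)
  qed
  have e1: "smult (x i) (monom 1 (w i)) + [:1:] = smult (x i) (monom 1 (w i)) + 1"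
    "smult (x i) (monom 1 (w i)) + [:-1:] = smult (x i) (monom 1 (w i)) - 1" for i
    by (simp_all add: one_pCons)
  note d2 = d1[where c=1, unfolded e1] d1[where c="-1", unfolded e1]
  have n0: "smult (x i) (monom 1 (w i)) + 1 \<noteq> 0" "smult (x i) (monom 1 (w i)) - 1 \<noteq> 0" if "i \<in> J" for i
    using d2[OF that] nz[OF that] by force+
  have P: "degree P = card T" "lead_coeff P = L"
    unfolding P_def L_def lead_coeff_prod using n0 d2
     apply (subst degree_prod_sum_eq)
      apply (auto simp: cT)[2]
    using d2 by (intro prod.cong refl) blast
  have D: "degree D = card T" "lead_coeff D = L"
    unfolding D_def L_def lead_coeff_prod using n0 d2
     apply (subst degree_prod_sum_eq)
      apply (auto simp: cT)[2]
    using d2 by (intro prod.cong refl) blast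
  have D0: "poly D a = 0" if "a \<in> T" for a
    using that fin by (auto simp: D_def T_def S_def poly_prod poly_monom intro!: prod_zero)
  have Deq: "D = smult L (\<Prod>a\<in>T. [:-a, 1:])"
    using poly_eq_smult_prod_roots[OF finT D0 D(1)] D(2) by simp
  have T0: "0 \<notin> T" using nzS by (auto simp: T_def)
  \<comment> \<open>The derivative of \<open>D\<close> at one of its zeros, computed from two
    factorizations; the factor \<open>a\<close> stems from dz/z.\<close>
  have der: "L * (a * (\<Prod>b\<in>T-{a}. a - b)) = of_nat (w i) * (\<Prod>k\<in>J-{i}. x k * a ^ w k - 1)"
    if i: "i \<in> J" and a: "a \<in> S i" for i a
  proof -
    have aT: "a \<in> T" using i a by (auto simp: T_def)
    have "D = smult L ([:-a, 1:] * (\<Prod>b\<in>T-{a}. [:-b, 1:]))"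
      unfolding Deq using prod.remove[OF finT aT, of "\<lambda>a. [:-a, 1:]"] by simp
    then have pd1: "poly (pderiv D) a = L * (\<Prod>b\<in>T-{a}. a - b)"
      by (simp add: pderiv_smult pderiv_mult pderiv_pCons poly_prod del: mult_pCons_left)
    have "D = (smult (x i) (monom 1 (w i)) - 1) * (\<Prod>k\<in>J-{i}. smult (x k) (monom 1 (w k)) - 1)"
      unfolding D_def using prod.remove[OF fin i] by blast
    then have pd2: "poly (pderiv D) a = x i * of_nat (w i) * a ^ (w i - 1) * (\<Prod>k\<in>J-{i}. x k * a ^ w k - 1)"
      using a by (simp add: pderiv_mult pderiv_diff pderiv_smult pderiv_monom poly_prod poly_monom S_def)
    have "L * (a * (\<Prod>b\<in>T-{a}. a - b)) = poly (pderiv D) a * a"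
      unfolding pd1 by (simp only: mult_ac)
    also have "\<dots> = of_nat (w i) * (x i * (a ^ (w i - 1) * a)) * (\<Prod>k\<in>J-{i}. x k * a ^ w k - 1)"
      unfolding pd2 by (simp only: mult_ac)
    also have "a ^ (w i - 1) * a = a ^ w i" using wpos[OF i] by (metis power_minus_mult)
    finally have "L * (a * (\<Prod>b\<in>T-{a}. a - b)) = of_nat (w i) * (x i * a ^ w i) * (\<Prod>k\<in>J-{i}. x k * a ^ w k - 1)" .
    then show ?thesis using a by (simp add: S_def)
  qed
  \<comment> \<open>The additional node 0 is the pole of dz/z; it also makes the number of nodes
    exceed the degree of \<open>P\<close>.\<close>
  have "(\<Sum>a\<in>insert 0 T. poly P a / (\<Prod>b\<in>insert 0 T-{a}. a - b)) = coeff P (card (insert 0 T) - 1)"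
    using finT P T0 by (intro lagrange_leading_coeff) auto
  also have "\<dots> = L" using finT T0 P by simp
  also have "(\<Sum>a\<in>insert 0 T. poly P a / (\<Prod>b\<in>insert 0 T-{a}. a - b)) =
     poly P 0 / (\<Prod>b\<in>T. - b) + (\<Sum>a\<in>T. poly P a / (\<Prod>b\<in>insert 0 T-{a}. a - b))"
    using finT T0 by (simp add: insert_Diff_if)
  also have "(\<Sum>a\<in>T. poly P a / (\<Prod>b\<in>insert 0 T-{a}. a - b)) = (\<Sum>a\<in>T. poly P a / (a * (\<Prod>b\<in>T-{a}. a - b)))"
  proof (rule sum.cong[OF refl])
    fix a assume "a \<in> T"
    then have "insert 0 T - {a} = insert 0 (T - {a})" using T0 by auto
    then show "poly P a / (\<Prod>b\<in>insert 0 T-{a}. a - b) = poly P a / (a * (\<Prod>b\<in>T-{a}. a - b))"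
      using finT T0 by simp
  qed
  also have "poly P 0 = 1"
    unfolding P_def poly_prod using wpos
    by (intro prod.neutral ballI) (simp add: poly_monom power_0_left less_imp_neq[symmetric])
  also have "(\<Prod>b\<in>T. - b) = (-1) ^ card J / L"
  proof -
    have "poly D 0 = L * (\<Prod>b\<in>T. - b)" by (simp add: Deq poly_prod)
    moreover have "poly D 0 = (\<Prod>i\<in>J. -1)"
      unfolding D_def poly_prod
    proof (rule prod.cong[OF refl])
      fix i assume "i \<in> J"
      then have "w i \<noteq> 0" using wpos by force
      then show "poly (smult (x i) (monom 1 (w i)) - 1) 0 = -1" by (simp add: poly_monom power_0_left)
    qed
    ultimately show ?thesis using L0 by (simp add: field_simps)
  qed
  finally have main: "(\<Sum>a\<in>T. poly P a / (a * (\<Prod>b\<in>T-{a}. a - b))) = L - 1 / ((-1) ^ card J / L)"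
    by (simp add: algebra_simps)
  have "(\<Sum>a\<in>T. poly P a / (a * (\<Prod>b\<in>T-{a}. a - b))) = (\<Sum>i\<in>J. \<Sum>a\<in>S i. poly P a / (a * (\<Prod>b\<in>T-{a}. a - b)))"
    unfolding T_def by (rule sum.UNION_disjoint) (use fin fS disj in blast)+
  also have "\<dots> = (\<Sum>i\<in>J. \<Sum>a\<in>S i. L * 2 ^ card J * ((\<Prod>k\<in>J-{i}. cayley (x k * a ^ w k)) / of_nat (w i)))"
  proof (intro sum.cong refl)
    fix i a assume i: "i \<in> J" and a: "a \<in> S i"
    have "poly P a = (\<Prod>k\<in>J. x k * a ^ w k + 1)" by (simp add: P_def poly_prod poly_monom)
    also have "\<dots> = 2 * (\<Prod>k\<in>J-{i}. x k * a ^ w k + 1)"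
      using prod.remove[OF fin i, of "\<lambda>k. x k * a ^ w k + 1"] a by (simp add: S_def)
    finally have Pa: "poly P a = \<dots>" .
    have "card J = Suc (card (J - {i}))" using fin i by (metis card.remove)
    then have two: "(2::'a) ^ card J = 2 * (\<Prod>k\<in>J-{i}. 2)" by simp
    have nzp: "(\<Prod>k\<in>J-{i}. x k * a ^ w k - 1) \<noteq> 0"
      using fin disS[OF i _ _ a] by auto
    have "a * (\<Prod>b\<in>T-{a}. a - b) = of_nat (w i) * (\<Prod>k\<in>J-{i}. x k * a ^ w k - 1) / L"
      using der[OF i a] L0 by (simp add: field_simps)
    then have "poly P a / (a * (\<Prod>b\<in>T-{a}. a - b)) =
        L * (2 * (\<Prod>k\<in>J-{i}. x k * a ^ w k + 1)) / (of_nat (w i) * (\<Prod>k\<in>J-{i}. x k * a ^ w k - 1))"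
      by (simp add: Pa)
    also have "\<dots> = L * 2 ^ card J * ((\<Prod>k\<in>J-{i}. cayley (x k * a ^ w k)) / of_nat (w i))"
      unfolding two cayley_def prod_dividef prod.distrib
      using nzp wpos[OF i] by (simp add: field_simps)
    finally show "poly P a / (a * (\<Prod>b\<in>T-{a}. a - b)) = \<dots>" .
  qed
  also have "\<dots> = L * 2 ^ card J * (\<Sum>i\<in>J. (\<Sum>a\<in>S i. \<Prod>k\<in>J-{i}. cayley (x k * a ^ w k)) / of_nat (w i))"
    by (simp add: sum_distrib_left sum_divide_distrib)
  also have "(\<Sum>i\<in>J. (\<Sum>a\<in>S i. \<Prod>k\<in>J-{i}. cayley (x k * a ^ w k)) / of_nat (w i)) =
     (\<Sum>i\<in>J. (\<Sum>\<xi> | \<xi> ^ w i = 1. \<Prod>k\<in>J-{i}. cayley (x k * (\<xi> * \<eta> i) ^ w k)) / of_nat (w i))"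
    by (intro sum.cong refl) (simp add: S_img sum.reindex[OF inj])
  finally have "L * 2 ^ card J * (\<Sum>i\<in>J. (\<Sum>\<xi> | \<xi> ^ w i = 1. \<Prod>k\<in>J-{i}. cayley (x k * (\<xi> * \<eta> i) ^ w k)) / of_nat (w i))
     = L * (1 - (-1) ^ card J)"
    unfolding main using L0 by (cases "even (card J)") auto
  then have "2 ^ card J * ?X = 1 - (-1) ^ card J"
    using L0 by (metis (no_types, lifting) mult.assoc mult_left_cancel)
  moreover have "X = (1/2) ^ c * r" if "2 ^ c * X = r" for X r :: 'a and c
    using that by (auto simp: power_one_over)
  ultimately show ?thesis by blast
qed

subsection \<open>Bernoulli numbers\<close>

lemma fps_exp_neq_1 [simp]: "y \<noteq> 0 \<Longrightarrow> fps_exp y - 1 \<noteq> (0::'a::field_char_0 fps)"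
  by (auto simp: fps_eq_iff intro!: exI[of _ 1])

definition bernoulli_fps :: "'a::field_char_0 fps" where
  "bernoulli_fps = Abs_fps (\<lambda>k. bernoulli k / fact k)"

lemma bernoulli_fps_eq: "(fps_exp 1 - 1) * bernoulli_fps = (fps_X :: 'a::field_char_0 fps)"
  using bernpoly_generating_function[of "0::'a"] by (simp add: bernoulli_fps_def bernoulli_def)

lemma bernpoly_fps_eq:
  "Abs_fps (\<lambda>k. bernpoly k x / fact k) = bernoulli_fps * fps_exp (x :: 'a::field_char_0)"
proof -
  have "(fps_exp 1 - 1) * Abs_fps (\<lambda>k. bernpoly k x / fact k) = (fps_exp 1 - 1) * (bernoulli_fps * fps_exp x)"
    unfolding bernpoly_generating_function mult.assoc[symmetric] bernoulli_fps_eq ..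
  then show ?thesis by (subst (asm) mult_left_cancel) auto
qed

lemma bernpoly_conv_bernoulli:
  "bernpoly m (x :: 'a::field_char_0) / fact m = (\<Sum>j\<le>m. bernoulli j / fact j * (x ^ (m - j) / fact (m - j)))"
proof -
  have "fps_nth (Abs_fps (\<lambda>k. bernpoly k x / fact k)) m = fps_nth (bernoulli_fps * fps_exp x) m"
    by (simp only: bernpoly_fps_eq)
  then show ?thesis
    by (simp add: fps_mult_nth bernoulli_fps_def atLeast0AtMost)
qed

lemma bernoulli_rec:
  "bernoulli k / fact k = (if k = 0 then 1 else 0) - (\<Sum>i<k. (bernoulli i / fact i) / fact (k + 1 - i) :: 'a::field_char_0)"
proof -
  have "fps_nth (bernoulli_fps * (fps_exp 1 - 1)) (Suc k) = fps_nth (fps_X :: 'a fps) (Suc k)"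
    by (simp only: mult.commute[of bernoulli_fps] bernoulli_fps_eq)
  moreover have "{0..Suc k} = insert (Suc k) (insert k {..<k})" by auto
  then have "fps_nth (bernoulli_fps * (fps_exp 1 - 1)) (Suc k) =
     bernoulli k / fact k + (\<Sum>i<k. (bernoulli i / fact i) / fact (k + 1 - i) :: 'a)"
    by (simp add: fps_mult_nth bernoulli_fps_def Suc_diff_le) (intro sum.cong refl, simp add: mult_ac)
  ultimately show ?thesis by (simp add: algebra_simps)
qed

text \<open>The recurrence determines the numbers inside every field of characteristic 0. The link
  is needed because Todd denominators live in \<open>rat\<close> and the sums in
  \<open>complex\<close>.\<close>

lemma of_rat_bernoulli: "of_rat (bernoulli k) = (bernoulli k :: 'a::field_char_0)"
proof (induction k rule: less_induct)
  case (less k)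
  have frat: "of_rat (fact m) = (fact m :: 'a)" for m
    by (metis of_nat_fact of_rat_of_nat_eq)
  have "of_rat (bernoulli k / fact k) = (bernoulli k / fact k :: 'a)"
    unfolding bernoulli_rec[of k] using less
    by (simp add: of_rat_diff of_rat_sum of_rat_divide of_rat_mult frat)
  then show ?case by (simp add: of_rat_divide frat)
qed

lemma of_real_bernoulli: "of_real (bernoulli k) = (bernoulli k :: 'a::{real_field})"
proof -
  have "(of_rat (x::rat) :: 'a) = of_real (of_rat x)" for x
    by (cases x) (simp add: of_rat_rat)
  then show ?thesis by (metis of_rat_bernoulli)
qed

lemma of_real_bernpoly: "of_real (bernpoly m x) = (bernpoly m (of_real x) :: 'a::{real_field})"
proof -
  have fr: "of_real (fact m) = (fact m :: 'a)" for m by simp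
  have "of_real (bernpoly m x / fact m) = (bernpoly m (of_real x) / fact m :: 'a)"
    unfolding bernpoly_conv_bernoulli by (simp add: of_real_bernoulli)
  then show ?thesis by simp
qed

lemma bernoulli_0 [simp]: "bernoulli 0 = (1::'a::field_char_0)"
  using bernoulli_rec[of 0, where ?'a='a] by simp

lemma bernoulli_1: "bernoulli (Suc 0) = (-1/2::'a::field_char_0)"
  using bernoulli_rec[of 1, where ?'a='a] by simp

lemma bernpoly_0 [simp]: "bernpoly 0 x = (1::'a::field_char_0)"
  using bernpoly_conv_bernoulli[of 0 x] by simp

lemma Rats_bernoulli: "(bernoulli k :: 'a::field_char_0) \<in> \<rat>"
  by (metis of_rat_bernoulli Rats_of_rat)

lemma Rats_bernpoly:
  assumes "x \<in> \<rat>"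
  shows "(bernpoly k x :: 'a::field_char_0) \<in> \<rat>"
proof -
  have f: "fact m \<in> (\<rat> :: 'a set)" for m by (metis Rats_of_nat of_nat_fact)
  have "bernpoly k x / fact k \<in> \<rat>"
    unfolding bernpoly_conv_bernoulli
    by (intro Rats_sum Rats_mult Rats_divide f Rats_bernoulli Rats_power assms)
  then have "bernpoly k x / fact k * fact k \<in> \<rat>" by (intro Rats_mult f)
  then show ?thesis by simp
qed

section \<open>Laurent coefficients of the Cayley transform at roots of unity\<close>

definition bern0_coeff :: "nat \<Rightarrow> 'a::field_char_0" where
  "bern0_coeff m = (if m = 1 then 0 else bernoulli m / fact m)"

text \<open>The coefficient of y^(m-1) in e^(k y) / (e^(q y) - 1), with 1/2 added to the function
  when k = 0. An integer power is needed since m = 0 gives 1/q.\<close>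

definition scaled_bernoulli :: "nat \<Rightarrow> nat \<Rightarrow> nat \<Rightarrow> 'a::field_char_0" where
  "scaled_bernoulli q m k = of_nat q powi (int m - 1) *
     (if k = 0 then bern0_coeff m else bernpoly m (of_nat k / of_nat q) / fact m)"

text \<open>For \<zeta>^q = 1 this is the coefficient of y^(m-1) in c(\<zeta> e^y), written as a
  finite Fourier transform of Bernoulli values.\<close>

definition beta :: "nat \<Rightarrow> 'a \<Rightarrow> nat \<Rightarrow> 'a::field_char_0" where
  "beta q \<zeta> m = (\<Sum>k<q. \<zeta> ^ k * scaled_bernoulli q m k)"

lemma bern0_coeff_0 [simp]: "bern0_coeff 0 = 1" by (simp add: bern0_coeff_def)

lemma Rats_bern0_coeff: "bern0_coeff m \<in> \<rat>"
  unfolding bern0_coeff_def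
  by (auto intro!: Rats_divide Rats_bernoulli) (metis Rats_of_nat of_nat_fact)

lemma Rats_powi: "x \<in> \<rat> \<Longrightarrow> x powi k \<in> (\<rat> :: 'a::field_char_0 set)"
  by (auto simp: power_int_def intro!: Rats_power Rats_inverse)

lemma Rats_scaled_bernoulli: "scaled_bernoulli q m k \<in> (\<rat> :: 'a::field_char_0 set)"
proof -
  have f: "fact m \<in> (\<rat> :: 'a set)" for m by (metis Rats_of_nat of_nat_fact)
  show ?thesis
    unfolding scaled_bernoulli_def
    by (auto intro!: Rats_mult Rats_powi Rats_bern0_coeff Rats_divide Rats_bernpoly f Rats_of_nat)
qed

lemma bern0_coeff_fps: "Abs_fps bern0_coeff = bernoulli_fps + fps_const (1/2) * (fps_X :: 'a::field_char_0 fps)"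
  by (auto simp: fps_eq_iff bern0_coeff_def bernoulli_fps_def bernoulli_1)

text \<open>Since \<zeta>^q = 1, a geometric sum shows that 1/(\<zeta> e^y - 1) is the sum of
  (\<zeta> e^y)^k over k < q, divided by e^(q y) - 1. Each summand generates Bernoulli polynomials
  at k/q, and the additive 1/2 of \<open>cayley\<close> is absorbed in the term k = 0. Here
  \<open>y\<close> is a field element; the series variable only marks the degree.\<close>

lemma fls_X_cayley_exp:
  fixes y :: "'a::field_char_0"
  assumes q: "q > 0" and z: "\<zeta> ^ q = 1" and y: "y \<noteq> 0"
  shows "fls_X * cayley (fls_const \<zeta> * fps_to_fls (fps_exp y)) =
           fps_to_fls (Abs_fps (\<lambda>m. beta q \<zeta> m * y powi (int m - 1)))"
proof -
  define e where "e = fps_to_fls (fps_exp y)"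
  define Y where "Y = of_nat q * y"
  have Y: "Y \<noteq> 0" using q y by (simp add: Y_def)
  define c where "c k = (if k = 0 then Abs_fps bern0_coeff else Abs_fps (\<lambda>m. bernpoly m (of_nat k / of_nat q) / fact m :: 'a))" for k
  define G where "G k = Abs_fps (\<lambda>m. scaled_bernoulli q m k * y powi (int m - 1))" for k
  have G_c: "fps_const Y * G k = fps_compose (c k) (fps_const Y * fps_X)" for k
  proof -
    have "Y * (scaled_bernoulli q m k * y powi (int m - 1)) = Y ^ m * c k $ m" for m
    proof -
      have "scaled_bernoulli q m k * y powi (int m - 1) = Y powi (int m - 1) * c k $ m"
        by (simp add: scaled_bernoulli_def c_def Y_def power_int_mult_distrib)
      moreover have "Y * Y powi (int m - 1) = Y ^ m"
        using Y by (simp add: power_int_diff)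
      ultimately show ?thesis by (metis mult.assoc)
    qed
    then show ?thesis by (simp add: G_def fps_compose_linear fps_eq_iff)
  qed
  have c_eq: "(fps_exp 1 - 1) * c k = fps_X * fps_exp (of_nat k / of_nat q) + (if k = 0 then fps_const (1/2) * fps_X * (fps_exp 1 - 1) else 0)" for k
  proof (cases "k = 0")
    case True
    then show ?thesis using bernoulli_fps_eq[where ?'a='a]
      by (simp add: c_def bern0_coeff_fps algebra_simps)
  next
    case False
    then show ?thesis by (simp add: c_def bernpoly_generating_function)
  qed
  have "fps_const Y * ((fps_exp Y - 1) * G k) = fps_const Y * (fps_X * fps_exp (of_nat k * y) + (if k = 0 then fps_const (1/2) * fps_X * (fps_exp Y - 1) else 0))" for k
  proof -
    have "fps_compose (fps_exp 1 - 1) (fps_const Y * fps_X) = fps_exp Y - 1"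
      by (simp add: fps_compose_sub_distrib)
    then have "fps_compose ((fps_exp 1 - 1) * c k) (fps_const Y * fps_X) = (fps_exp Y - 1) * (fps_const Y * G k)"
      unfolding G_c by (subst fps_compose_mult_distrib) auto
    then have "fps_const Y * ((fps_exp Y - 1) * G k) = fps_compose ((fps_exp 1 - 1) * c k) (fps_const Y * fps_X)"
      by (simp only: mult_ac)
    also have "\<dots> = (fps_const Y * fps_X) * fps_exp (of_nat k * y) + (if k = 0 then fps_const (1/2) * (fps_const Y * fps_X) * (fps_exp Y - 1) else 0)"
    proof -
      have "Y * (of_nat k / of_nat q) = of_nat k * y" using q by (simp add: Y_def)
      then show ?thesis
        unfolding c_eq
        by (simp add: fps_compose_mult_distrib fps_compose_add_distrib fps_compose_sub_distrib
              del: mult.commute[symmetric])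
    qed
    finally show ?thesis by (auto simp: algebra_simps)
  qed
  then have G_eq: "(fps_exp Y - 1) * G k = fps_X * fps_exp (of_nat k * y) + (if k = 0 then fps_const (1/2) * fps_X * (fps_exp Y - 1) else 0)" for k
    using Y by (subst (asm) mult_left_cancel) auto
  define S where "S = Abs_fps (\<lambda>m. beta q \<zeta> m * y powi (int m - 1))"
  have S: "S = (\<Sum>k<q. fps_const (\<zeta> ^ k) * G k)"
    by (simp add: S_def G_def fps_eq_iff fps_sum_nth beta_def sum_distrib_right mult.assoc)
  have eY: "fps_exp Y = fps_exp y ^ q" by (simp add: Y_def fps_exp_power_mult)
  have ek: "fps_exp (of_nat k * y) = fps_exp y ^ k" for k by (simp add: fps_exp_power_mult)
  have "(fps_exp Y - 1) * S = (\<Sum>k<q. fps_const (\<zeta> ^ k) * ((fps_exp Y - 1) * G k))"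
    unfolding S sum_distrib_left by (simp add: mult_ac)
  also have "\<dots> = (\<Sum>k<q. fps_X * (fps_const \<zeta> * fps_exp y) ^ k + (if k = 0 then fps_const (1/2) * fps_X * (fps_exp Y - 1) else 0))"
    unfolding G_eq ek by (intro sum.cong refl) (auto simp: power_mult_distrib fps_const_power algebra_simps)
  also have "\<dots> = fps_X * (\<Sum>k<q. (fps_const \<zeta> * fps_exp y) ^ k) + fps_const (1/2) * fps_X * (fps_exp Y - 1)"
    using q by (simp add: sum.distrib sum_distrib_left)
  finally have A: "(fps_exp Y - 1) * (S - fps_const (1/2) * fps_X) = fps_X * (\<Sum>k<q. (fps_const \<zeta> * fps_exp y) ^ k)"
    by (simp add: algebra_simps)
  have geo: "(fps_const \<zeta> * fps_exp y - 1) * (\<Sum>k<q. (fps_const \<zeta> * fps_exp y) ^ k) = fps_exp Y - 1"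
  proof -
    have "(fps_const \<zeta> * fps_exp y) ^ q = fps_exp Y"
      using z by (simp add: power_mult_distrib eY fps_const_power)
    then show ?thesis using power_diff_1_eq[of "fps_const \<zeta> * fps_exp y" q] by simp
  qed
  have "(fps_exp Y - 1) * ((fps_const \<zeta> * fps_exp y - 1) * (S - fps_const (1/2) * fps_X)) =
      (fps_const \<zeta> * fps_exp y - 1) * ((fps_exp Y - 1) * (S - fps_const (1/2) * fps_X))"
    by (simp only: mult_ac)
  also have "\<dots> = fps_X * ((fps_const \<zeta> * fps_exp y - 1) * (\<Sum>k<q. (fps_const \<zeta> * fps_exp y) ^ k))"
    unfolding A by (simp only: mult_ac)
  also have "\<dots> = (fps_exp Y - 1) * fps_X"
    unfolding geo by (simp only: mult_ac)
  finally have "(fps_exp Y - 1) * ((fps_const \<zeta> * fps_exp y - 1) * (S - fps_const (1/2) * fps_X)) = (fps_exp Y - 1) * fps_X" .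
  then have "(fps_const \<zeta> * fps_exp y - 1) * (S - fps_const (1/2) * fps_X) = fps_X"
    using Y by (subst (asm) mult_left_cancel) auto
  then have "fps_to_fls ((fps_const \<zeta> * fps_exp y - 1) * (S - fps_const (1/2) * fps_X)) = fls_X"
    by simp
  then have B: "(fls_const \<zeta> * e - 1) * (fps_to_fls S - fls_const (1/2) * fls_X) = fls_X"
    by (simp add: fls_times_fps_to_fls e_def)
  then have ne: "fls_const \<zeta> * e - 1 \<noteq> 0" by auto
  have half: "fls_const (1/2 :: 'a) = 1 / 2"
    by (metis fls_const_1 fls_const_divide_const fls_const_numeral)
  have "fps_to_fls S = fls_X / (fls_const \<zeta> * e - 1) + fls_X / 2"
    using B ne unfolding half by (simp add: field_simps)
  also have "\<dots> = fls_X * cayley (fls_const \<zeta> * e)"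
    using ne unfolding cayley_def by (simp add: field_simps)
  finally show ?thesis by (simp add: S_def e_def)
qed

lemma fls_X_cayley_exp_bern0_coeff:
  fixes y :: "'a::field_char_0"
  assumes y: "y \<noteq> 0"
  shows "fls_X * cayley (fps_to_fls (fps_exp y)) = fps_to_fls (Abs_fps (\<lambda>m. bern0_coeff m * y powi (int m - 1)))"
  using fls_X_cayley_exp[of 1 1 y] y by (simp add: beta_def scaled_bernoulli_def)

text \<open>A form of the multiplication theorem for Bernoulli polynomials: the function expanded in
  \<open>fls_X_cayley_exp\<close> does not see which q with \<zeta>^q = 1 was used.\<close>

lemma beta_1:
  assumes "q > 0" shows "beta q 1 m = (bern0_coeff m :: 'a::field_char_0)"
proof -
  have "fps_to_fls (Abs_fps (\<lambda>m. beta q 1 m * (1::'a) powi (int m - 1))) = fps_to_fls (Abs_fps (\<lambda>m. bern0_coeff m * 1 powi (int m - 1)))"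
    using fls_X_cayley_exp[of q 1 "1::'a"] fls_X_cayley_exp_bern0_coeff[of "1::'a"] assms by simp
  then show ?thesis by (simp add: fps_eq_iff)
qed

lemma cayley_inverse:
  fixes z :: "'a::field_char_0"
  assumes "z \<noteq> 0" shows "cayley (inverse z) = - cayley z"
proof (cases "z = 1")
  case False
  then have "inverse z - 1 \<noteq> 0" using assms by (simp add: field_simps)
  with assms False show ?thesis by (simp add: cayley_def divide_simps) (simp add: algebra_simps)
qed (simp add: cayley_def)

lemma inverse_fls_exp: "inverse (fps_to_fls (fps_exp y)) = fps_to_fls (fps_exp (- y :: 'a::field_char_0))"
proof (rule inverse_unique)
  have "fps_to_fls (fps_exp y * fps_exp (- y)) = 1"
    by (simp add: fps_exp_add_mult[symmetric])
  then show "fps_to_fls (fps_exp y) * fps_to_fls (fps_exp (- y)) = 1"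
    by (simp add: fls_times_fps_to_fls)
qed

text \<open>Inverting \<zeta> e^y means inverting \<zeta> and changing the sign of y, while
  \<open>cayley\<close> is odd under inversion.\<close>

lemma beta_inverse:
  fixes \<zeta> :: "'a::field_char_0"
  assumes "q > 0" "\<zeta> ^ q = 1"
  shows "beta q (inverse \<zeta>) m = (-1) ^ m * beta q \<zeta> m"
proof -
  have z0: "\<zeta> \<noteq> 0" using assms by (auto simp: power_0_left)
  have "cayley (fls_const (inverse \<zeta>) * fps_to_fls (fps_exp (-1))) = - cayley (fls_const \<zeta> * fps_to_fls (fps_exp 1))"
    using cayley_inverse[of "fls_const \<zeta> * fps_to_fls (fps_exp 1)"] z0
    by (simp add: inverse_fls_exp fls_inverse_const)
  then have "fps_to_fls (Abs_fps (\<lambda>m. beta q (inverse \<zeta>) m * (-1) powi (int m - 1))) =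
      - fps_to_fls (Abs_fps (\<lambda>m. beta q \<zeta> m * 1 powi (int m - 1)))"
    using assms by (subst (1 2) fls_X_cayley_exp[symmetric]) (auto simp: power_inverse)
  then have "fps_to_fls (Abs_fps (\<lambda>m. beta q (inverse \<zeta>) m * (-1) powi (int m - 1))) =
      fps_to_fls (- Abs_fps (\<lambda>m. beta q \<zeta> m))" by simp
  then have "beta q (inverse \<zeta>) m * (-1) powi (int m - 1) = - beta q \<zeta> m"
    unfolding fps_to_fls_eq_iff by (simp add: fps_eq_iff)
  moreover have "(-1) powi (int m - 1) = (- ((-1) ^ m) :: 'a)"
    by (simp add: power_int_diff)
  ultimately have "beta q (inverse \<zeta>) m * (-1) ^ m = beta q \<zeta> m"
    by (metis minus_equation_iff mult_minus_right)
  then have "beta q (inverse \<zeta>) m * ((-1) ^ m * (-1) ^ m) = beta q \<zeta> m * (-1) ^ m"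
    by (metis mult.assoc)
  moreover have "((-1) ^ m * (-1) ^ m) = (1::'a)" by (simp add: power_mult_distrib[symmetric])
  ultimately show ?thesis by (simp add: mult.commute)
qed

text \<open>This is the residue of c(\<zeta> e^y) at y = 0, and there is a pole only for \<zeta> =
  1.\<close>

lemma beta_0:
  fixes \<zeta> :: "'a::field_char_0"
  assumes "q > 0" "\<zeta> ^ q = 1"
  shows "beta q \<zeta> 0 = (if \<zeta> = 1 then 1 else 0)"
proof -
  have "beta q \<zeta> 0 = (\<Sum>k<q. \<zeta> ^ k) / of_nat q"
    by (simp add: beta_def scaled_bernoulli_def sum_divide_distrib divide_inverse power_int_minus mult.commute sum_distrib_left[symmetric] cong: if_cong)
  moreover have "(\<Sum>k<q. \<zeta> ^ k) = 0" if "\<zeta> \<noteq> 1"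
    using that assms by (simp add: sum_gp_strict)
  ultimately show ?thesis using assms by auto
qed

section \<open>Parity and signs of the Bernoulli numbers\<close>

lemma bern0_coeff_odd: "odd m \<Longrightarrow> bern0_coeff m = (0::'a::field_char_0)"
  using beta_inverse[of 1 "1::'a" m] by (simp add: beta_1)

text \<open>This is the equation \<open>c' = 1/4 - c\<^sup>2\<close> for \<open>c = (e\<^sup>x + 1) / (2 (e\<^sup>x - 1))\<close>, multiplied by \<open>x\<^sup>2\<close>.\<close>

lemma bern0_coeff_ode:
  fixes f :: "'a::field_char_0 fps"
  defines "f \<equiv> Abs_fps bern0_coeff"
  shows "fps_X * fps_deriv f - f = fps_const (1/4) * fps_X ^ 2 - f ^ 2"
proof -
  define e where "e = fps_exp (1::'a)"
  define h where "h = fps_const (1/2 :: 'a)"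
  have h2: "2 * h = 1" by (simp add: h_def fps_eq_iff fps_numeral_nth numeral_fps_const)
  have h4: "fps_const (1/4 :: 'a) = h * h" by (simp add: h_def)
  have E: "f * (e - 1) = h * fps_X * (e + 1)"
  proof -
    have "f * (e - 1) = fps_X + h * fps_X * (e - 1)"
      using bernoulli_fps_eq[where ?'a='a] by (simp add: f_def bern0_coeff_fps e_def h_def algebra_simps)
    then show ?thesis using h2 by algebra
  qed
  have "fps_deriv (f * (e - 1)) = fps_deriv (h * fps_X * (e + 1))" by (simp only: E)
  then have E': "fps_deriv f * (e - 1) + f * e = h * (e + 1) + h * fps_X * e"
    by (simp add: e_def h_def algebra_simps)
  have "(e - 1) ^ 2 * (fps_X * fps_deriv f - f - (fps_const (1/4) * fps_X ^ 2 - f ^ 2)) = 0"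
    unfolding h4 using E E' h2 by algebra
  moreover have "e - 1 \<noteq> 0" by (simp add: e_def)
  ultimately show ?thesis by simp
qed

text \<open>The differential equation gives (m + 1) b_m = - (sum of b_i b_(m-i)) for even m > 2. By
  induction, all products with even i have the same sign, and those with odd i vanish.\<close>

lemma bern0_coeff_sign:
  "(even m \<and> m \<ge> 2 \<longrightarrow> (-1) ^ (m div 2 + 1) * bern0_coeff m > (0::real))"
proof (induction m rule: less_induct)
  case (less m)
  define b :: "nat \<Rightarrow> real" where "b = bern0_coeff"
  have ode: "(fps_X * fps_deriv (Abs_fps b) - Abs_fps b) $ m = (fps_const (1/4) * fps_X ^ 2 - Abs_fps b ^ 2) $ m" for m
    unfolding b_def by (simp only: bern0_coeff_ode)
  show ?case
  proof (intro impI, elim conjE)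
    assume m: "even m" "m \<ge> 2"
    have "{0..m} = insert 0 (insert m {1..<m})" using m by auto
    then have sq: "(Abs_fps b ^ 2) $ m = 2 * b m + (\<Sum>i\<in>{1..<m}. b i * b (m - i))"
      using m by (simp add: power2_eq_square fps_mult_nth) (simp add: b_def)
    have lhs: "(fps_X * fps_deriv (Abs_fps b) - Abs_fps b) $ m = (real m - 1) * b m"
      using m by (cases m) (auto simp: algebra_simps)
    have rec: "(real m + 1) * b m = (if m = 2 then 1/4 else 0) - (\<Sum>i\<in>{1..<m}. b i * b (m - i))"
      using ode[of m] unfolding fps_sub_nth[of _ "Abs_fps b ^ 2"] sq lhs by (auto simp: algebra_simps fps_X_power_iff)
    define s where "s = (-1::real) ^ (m div 2 + 1)"
    have t: "- s * (b i * b (m - i)) \<ge> 0" "even i \<Longrightarrow> - s * (b i * b (m - i)) > 0" if i: "i \<in> {1..<m}" for i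
    proof -
      show pos: "- s * (b i * b (m - i)) > 0" if eval_poly: "even i"
      proof -
        obtain j where j: "i = 2 * j" using eval_poly by (blast elim: evenE)
        moreover obtain l where "m = 2 * l" using m by (blast elim: evenE)
        ultimately have "m = 2 * j + 2 * (l - j)" using i by auto
        with j obtain k where jk: "i = 2 * j" "m = 2 * j + 2 * k" by blast
        then have "j \<ge> 1" "k \<ge> 1" using i by auto
        then have "(-1) ^ (j + 1) * b i > 0" "(-1) ^ (k + 1) * b (m - i) > 0"
          using less[of i] less[of "m - i"] i jk by (auto simp: b_def)
        then have "((-1) ^ (j + 1) * b i) * ((-1) ^ (k + 1) * b (m - i)) > 0" by (rule mult_pos_pos)
        moreover have "s = - ((-1) ^ (j + 1) * (-1) ^ (k + 1))"
          unfolding s_def jk by (simp add: power_add)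
        ultimately show ?thesis by (simp add: mult_ac)
      qed
      show "- s * (b i * b (m - i)) \<ge> 0"
      proof (cases "even i")
        case False
        then show ?thesis by (simp add: b_def bern0_coeff_odd)
      qed (use pos in auto)
    qed
    have "s * ((real m + 1) * b m) > 0"
    \<comment> \<open>The constant 1/4 of the equation enters only for m = 2; for larger m, the term
      i = 2 makes the sum strictly positive.\<close>
    proof (cases "m = 2")
      case True
      then have "{1..<m} = {1}" by auto
      then show ?thesis unfolding rec using True by (simp add: s_def b_def bern0_coeff_def)
    next
      case False
      have "s * ((real m + 1) * b m) = (\<Sum>i\<in>{1..<m}. - s * (b i * b (m - i)))"
        unfolding rec using False by (simp add: sum_distrib_left sum_negf)
      also have "\<dots> > 0"
        by (rule sum_pos2[where i=2]) (use t m False in auto)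
      finally show ?thesis .
    qed
    then have "(real m + 1) * (s * b m) > 0" by (simp add: mult_ac)
    then have "s * b m > 0" by (rule zero_less_mult_pos) simp
    then show "(-1) ^ (m div 2 + 1) * bern0_coeff m > (0::real)"
      by (simp add: s_def b_def)
  qed
qed

lemma bernoulli_even_nonzero:
  assumes "even m" "m > 0"
  shows "bernoulli m \<noteq> (0 :: 'a::field_char_0)"
proof -
  have "m \<ge> 2" using assms by (auto elim!: evenE)
  then have "bernoulli m \<noteq> (0::real)"
    using bern0_coeff_sign[of m] assms by (auto simp: bern0_coeff_def split: if_splits)
  then have "bernoulli m \<noteq> (0::rat)" by (metis of_rat_bernoulli of_rat_0)
  then show ?thesis by (metis of_rat_bernoulli of_rat_eq_0_iff)
qed

subsection \<open>Gauss valuation rings and Todd denominators\<close>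

definition localization :: "int \<Rightarrow> complex set" where
  "localization t = {x. \<exists>a b. \<not> t dvd b \<and> x = of_int a / of_int b}"

text \<open>Rational functions in one variable are modelled as complex numbers, by evaluation at a
  transcendental point, so that they share a field with the roots of unity.\<close>

definition eval_poly :: "complex \<Rightarrow> int poly \<Rightarrow> complex" where
  "eval_poly Y a = poly (map_poly of_int a) Y"

lemma eval_poly_0 [simp]: "eval_poly Y 0 = 0" by (simp add: eval_poly_def)

lemma eval_poly_pCons: "eval_poly Y (pCons c a) = of_int c + Y * eval_poly Y a"
  by (cases "a = 0 \<and> c = 0") (auto simp: eval_poly_def map_poly_pCons)

lemma eval_poly_add: "eval_poly Y (a + b) = eval_poly Y a + eval_poly Y b"
  by (induction a b rule: poly_induct2) (auto simp: eval_poly_pCons algebra_simps)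

lemma eval_poly_smult: "eval_poly Y (smult c a) = of_int c * eval_poly Y a"
  by (induction a) (auto simp: eval_poly_pCons algebra_simps)

lemma eval_poly_mult: "eval_poly Y (a * b) = eval_poly Y a * eval_poly Y b"
  by (induction a) (auto simp: eval_poly_pCons eval_poly_add eval_poly_smult algebra_simps)

lemma eval_poly_uminus: "eval_poly Y (- a) = - eval_poly Y a"
  using eval_poly_smult[of Y "-1" a] by simp

lemma eval_poly_diff: "eval_poly Y (a - b) = eval_poly Y a - eval_poly Y b"
  using eval_poly_add[of Y a "- b"] by (simp add: eval_poly_uminus)

lemma eval_poly_sum: "eval_poly Y (sum f A) = (\<Sum>x\<in>A. eval_poly Y (f x))"
  by (induction A rule: infinite_finite_induct) (auto simp: eval_poly_add)

lemma eval_poly_monom: "eval_poly Y (monom c k) = of_int c * Y ^ k"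
  by (induction k) (auto simp: monom_0 monom_Suc eval_poly_pCons algebra_simps)

lemma eval_poly_const [simp]: "eval_poly Y [:c:] = of_int c" by (simp add: eval_poly_pCons)

lemma eval_poly_1 [simp]: "eval_poly Y 1 = 1" by (simp add: one_pCons)

definition transcendental :: "complex \<Rightarrow> bool" where
  "transcendental Y \<longleftrightarrow> (\<forall>a. a \<noteq> 0 \<longrightarrow> eval_poly Y a \<noteq> 0)"

text \<open>The countably many nonzero integer polynomials have only countably many complex
  roots.\<close>

lemma ex_transcendental: "\<exists>Y. transcendental Y"
proof (rule ccontr)
  assume "\<not> ?thesis"
  then have all: "\<exists>a. a \<noteq> 0 \<and> eval_poly Y a = 0" for Y by (auto simp: transcendental_def)
  have "countable (UNIV :: int poly set)"
    by (rule countableI'[of "to_nat \<circ> coeffs"]) (auto simp: inj_on_def coeffs_eq_iff)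
  then have "countable (\<Union>a\<in>UNIV - {0}. {Y. eval_poly Y a = 0})"
  proof (intro countable_UN)
    fix a :: "int poly" assume "a \<in> UNIV - {0}"
    then have "map_poly of_int a \<noteq> (0 :: complex poly)"
      by (simp add: map_poly_eq_0_iff)
    then show "countable {Y. eval_poly Y a = 0}"
      unfolding eval_poly_def by (intro countable_finite poly_roots_finite)
  qed (auto intro: countable_subset)
  moreover have "(\<Union>a\<in>UNIV - {0}. {Y. eval_poly Y a = 0}) = UNIV" using all by auto
  ultimately have "countable (UNIV :: complex set)" by simp
  then have "countable (range complex_of_real)" by (rule countable_subset[OF subset_UNIV])
  then have "countable (UNIV :: real set)"
    by (rule countable_image_inj_on) (simp add: inj_on_def)
  then show False using uncountable_UNIV_real by blast
qed

text \<open>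
  The valuation ring of the Gauss valuation at \<open>t\<close> on \<open>\<rat>(Y)\<close>. A linear form with
  coefficients in the local ring at \<open>t\<close> is a unit as soon as one coefficient is.
\<close>

definition gauss_ring :: "int \<Rightarrow> complex \<Rightarrow> complex set" where
  "gauss_ring t Y = {eval_poly Y a / eval_poly Y b | a b. \<not> [:t:] dvd b}"

locale gauss =
  fixes t :: int and Y :: complex
  assumes prime_t: "prime t" and trans: "transcendental Y"
begin

abbreviation "R \<equiv> gauss_ring t Y"

lemma eval_poly_neq_0: "\<not> [:t:] dvd b \<Longrightarrow> eval_poly Y b \<noteq> 0"
  using trans unfolding transcendental_def by (metis dvd_0_right)

lemma eval_poly_inj: "eval_poly Y a = eval_poly Y b \<longleftrightarrow> a = b"
  using trans eval_poly_diff[of Y a b] unfolding transcendental_def by (metis right_minus_eq)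

lemma Y_neq_0 [simp]: "Y \<noteq> 0"
proof -
  have "monom 1 1 \<noteq> (0 :: int poly)" by simp
  then have "eval_poly Y (monom 1 1) \<noteq> 0" using trans unfolding transcendental_def by blast
  moreover have "eval_poly Y (monom 1 1) = Y" unfolding eval_poly_monom by simp
  ultimately show ?thesis by simp
qed

lemma prime_elem_const: "prime_elem [:t:]"
  by (rule lift_prime_elem_poly[OF prime_imp_prime_elem[OF prime_t]])

lemma not_dvd_mult: "\<not> [:t:] dvd a \<Longrightarrow> \<not> [:t:] dvd b \<Longrightarrow> \<not> [:t:] dvd a * b"
  using prime_elem_const by (simp add: prime_elem_dvd_mult_iff)

lemma not_dvd_1: "\<not> [:t:] dvd 1"
  using prime_elem_not_unit[OF prime_elem_const] by blast

lemma gauss_add: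
  assumes "x \<in> R" "y \<in> R" shows "x + y \<in> R"
proof -
  obtain a b c d where *: "x = eval_poly Y a / eval_poly Y b" "y = eval_poly Y c / eval_poly Y d" "\<not> [:t:] dvd b" "\<not> [:t:] dvd d"
    using assms by (auto simp: gauss_ring_def)
  have "x + y = eval_poly Y (a * d + c * b) / eval_poly Y (b * d)"
    using *(3,4)[THEN eval_poly_neq_0] by (simp add: *(1,2) eval_poly_add eval_poly_mult field_simps)
  then show ?thesis using not_dvd_mult[OF *(3,4)] unfolding gauss_ring_def by blast
qed

lemma gauss_mult:
  assumes "x \<in> R" "y \<in> R" shows "x * y \<in> R"
proof -
  obtain a b c d where *: "x = eval_poly Y a / eval_poly Y b" "y = eval_poly Y c / eval_poly Y d" "\<not> [:t:] dvd b" "\<not> [:t:] dvd d"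
    using assms by (auto simp: gauss_ring_def)
  have "x * y = eval_poly Y (a * c) / eval_poly Y (b * d)" by (simp add: *(1,2) eval_poly_mult)
  then show ?thesis using not_dvd_mult[OF *(3,4)] unfolding gauss_ring_def by blast
qed

lemma gauss_eval_poly: "eval_poly Y a \<in> R"
  unfolding gauss_ring_def using not_dvd_1 by (intro CollectI exI[of _ a] exI[of _ 1]) simp

lemma gauss_inverse_eval_poly: "\<not> [:t:] dvd b \<Longrightarrow> inverse (eval_poly Y b) \<in> R"
  unfolding gauss_ring_def by (intro CollectI exI[of _ 1] exI[of _ b]) (simp add: inverse_eq_divide)

lemma gauss_of_int: "of_int k \<in> R" using gauss_eval_poly[of "[:k:]"] by simp

lemma gauss_of_nat: "of_nat k \<in> R" using gauss_of_int[of "int k"] by simp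

lemma gauss_0: "0 \<in> R" using gauss_of_int[of 0] by simp

lemma gauss_1: "1 \<in> R" using gauss_of_int[of 1] by simp

lemma gauss_uminus: "x \<in> R \<Longrightarrow> - x \<in> R"
  using gauss_mult[OF gauss_of_int[of "-1"]] by simp

lemma gauss_diff: "x \<in> R \<Longrightarrow> y \<in> R \<Longrightarrow> x - y \<in> R"
  using gauss_add gauss_uminus by fastforce

lemma gauss_power: "x \<in> R \<Longrightarrow> x ^ k \<in> R"
  by (induction k) (auto intro: gauss_1 gauss_mult)

lemma gauss_powi: "x \<in> R \<Longrightarrow> inverse x \<in> R \<Longrightarrow> x powi k \<in> R"
  by (auto simp: power_int_def intro: gauss_power)

lemma gauss_sum: "(\<And>i. i \<in> A \<Longrightarrow> f i \<in> R) \<Longrightarrow> sum f A \<in> R"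
  by (induction A rule: infinite_finite_induct) (auto intro: gauss_0 gauss_add)

lemma gauss_prod: "(\<And>i. i \<in> A \<Longrightarrow> f i \<in> R) \<Longrightarrow> prod f A \<in> R"
  by (induction A rule: infinite_finite_induct) (auto intro: gauss_1 gauss_mult)

lemma gauss_Ints: "x \<in> \<int> \<Longrightarrow> x \<in> R"
  by (auto elim!: Ints_cases intro: gauss_of_int)

lemma localization_subset_gauss: "x \<in> localization t \<Longrightarrow> x \<in> R"
proof -
  assume "x \<in> localization t"
  then obtain a b where "\<not> t dvd b" "x = of_int a / of_int b" by (auto simp: localization_def)
  moreover have "\<not> [:t:] dvd [:b:]" using \<open>\<not> t dvd b\<close> by simp
  ultimately show ?thesis
    unfolding gauss_ring_def by (intro CollectI exI[of _ "[:a:]"] exI[of _ "[:b:]"]) simp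
qed

lemma gauss_inverse_of_int: "\<not> t dvd b \<Longrightarrow> inverse (of_int b) \<in> R"
  using gauss_inverse_eval_poly[of "[:b:]"] by simp

text \<open>Gauss's lemma: after clearing denominators by \<open>D\<close> = t^v D', the constant
  t^v divides \<open>p * b\<close> and is coprime to \<open>b\<close>, hence divides all
  coefficients of \<open>p\<close>. As \<open>e\<close> is injective, each of these is a single
  \<open>\<alpha> m\<close>.\<close>

lemma localization_coeffs:
  assumes fin: "finite A" and inj: "inj_on e A" and rat: "\<And>m. m \<in> A \<Longrightarrow> c m \<in> \<rat>"
    and sum: "(\<Sum>m\<in>A. c m * Y ^ e m) \<in> R" and m: "m \<in> A"
  shows "c m \<in> localization t"
proof -
  have "\<exists>D::int. D \<noteq> 0 \<and> (\<forall>m\<in>A. of_int D * c m \<in> \<int>)"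
    using fin rat
  proof (induction A)
    case empty
    show ?case by (auto intro: exI[of _ 1])
  next
    case (insert x A)
    then obtain D where D: "D \<noteq> 0" "\<forall>m\<in>A. of_int D * c m \<in> \<int>" by auto
    obtain p q where pq: "c x = of_int p / of_int q" "q > 0"
      using insert.prems[of x] by (auto elim!: Rats_cases')
    have "of_int (D * q) * c x = of_int (D * p)" using pq by simp
    then have "of_int (D * q) * c x \<in> \<int>" by (metis Ints_of_int)
    moreover have "of_int (D * q) * c m \<in> \<int>" if "m \<in> A" for m
    proof -
      have "of_int (D * q) * c m = of_int q * (of_int D * c m)" by simp
      then show ?thesis using D that by (metis Ints_mult Ints_of_int)
    qed
    ultimately show ?case using D pq by (intro exI[of _ "D * q"]) auto
  qed
  then obtain D :: int where D: "D \<noteq> 0" "\<And>m. m \<in> A \<Longrightarrow> of_int D * c m \<in> \<int>" by auto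
  have "\<not> is_unit t" using prime_t not_prime_unit by blast
  then obtain D' v where D': "D = t ^ v * D'" "\<not> t dvd D'"
    using multiplicity_decompose'[of D t] D(1) by (metis mult.commute)
  have "\<exists>\<alpha>::int. of_int D * c m = of_int \<alpha>" if "m \<in> A" for m
    using D(2)[OF that] by (auto elim!: Ints_cases)
  then obtain \<alpha> :: "_ \<Rightarrow> int" where \<alpha>: "\<And>m. m \<in> A \<Longrightarrow> of_int D * c m = of_int (\<alpha> m)" by metis
  define p where "p = (\<Sum>m\<in>A. monom (\<alpha> m) (e m))"
  obtain a b where ab: "(\<Sum>m\<in>A. c m * Y ^ e m) = eval_poly Y a / eval_poly Y b" "\<not> [:t:] dvd b"
    using sum by (auto simp: gauss_ring_def)
  have "eval_poly Y p = (\<Sum>m\<in>A. of_int D * c m * Y ^ e m)"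
    by (simp add: p_def eval_poly_sum eval_poly_monom \<alpha>)
  also have "\<dots> = of_int D * (eval_poly Y a / eval_poly Y b)"
    by (simp add: ab(1)[symmetric] sum_distrib_left mult.assoc)
  finally have "eval_poly Y (p * b) = eval_poly Y ([:D:] * a)"
    using eval_poly_neq_0[OF ab(2)] by (simp add: eval_poly_mult eval_poly_smult del: mult_pCons_left)
  \<comment> \<open>Transcendence of \<open>Y\<close> turns the equation of values into one of
    polynomials.\<close>
  then have "p * b = [:D:] * a" by (simp only: eval_poly_inj)
  also have "\<dots> = [:t:] ^ v * ([:D':] * a)" by (simp add: D' poly_const_pow mult.commute)
  finally have "[:t:] ^ v dvd p * b" by (simp only: dvd_triv_left)
  moreover have "coprime ([:t:] ^ v) b"
    using prime_elem_imp_coprime[OF prime_elem_const ab(2)] by simp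
  ultimately have "[:t ^ v:] dvd p" by (simp add: coprime_dvd_mult_left_iff poly_const_pow)
  then have "t ^ v dvd coeff p (e m)" by (simp add: const_poly_dvd_iff)
  also have "coeff p (e m) = (\<Sum>m'\<in>A. if m' = m then \<alpha> m else 0)"
    unfolding p_def coeff_sum coeff_monom using inj m
    by (intro sum.cong) (auto simp: inj_on_def)
  also have "\<dots> = \<alpha> m" using fin m by simp
  finally obtain \<gamma> where \<gamma>: "\<alpha> m = t ^ v * \<gamma>" by (elim dvdE)
  have "t \<noteq> 0" using prime_t by auto
  then have "c m = of_int \<gamma> / of_int D'"
    using \<alpha>[OF m] D(1) unfolding \<gamma> D' by (auto simp: field_simps)
  then show ?thesis using D'(2) by (auto simp: localization_def)
qed

end

lemma localization_all_imp_Ints: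
  assumes "x \<in> \<rat>" "\<And>t. prime t \<Longrightarrow> x \<in> localization t"
  shows "x \<in> \<int>"
proof -
  obtain p q where pq: "x = of_int p / of_int q" "q > 0" "coprime p q"
    using assms(1) by (auto elim!: Rats_cases')
  have "q = 1"
  proof (rule ccontr)
    assume "q \<noteq> 1"
    then obtain t where t: "prime t" "t dvd q" using pq(2)
      by (metis prime_factor_int abs_of_pos)
    then obtain a b where ab: "\<not> t dvd b" "x = of_int a / of_int b"
      using assms(2)[OF t(1)] by (auto simp: localization_def)
    have "b \<noteq> 0" using ab by auto
    then have "of_int (p * b) = (of_int (a * q) :: complex)"
      using ab pq by (simp add: field_simps)
    then have "p * b = a * q" by (simp only: of_int_eq_iff)
    then have "t dvd p * b" using t by auto
    then have "t dvd p" using ab t by (simp add: prime_dvd_mult_iff)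
    then show False using t pq(3) by (meson coprime_common_divisor not_prime_unit)
  qed
  then show ?thesis using pq by simp
qed

text \<open>Uniqueness of digits in base N + 1. It makes the exponents produced by the Kronecker
  substitution distinct.\<close>

lemma base_expansion_inj:
  fixes m m' :: "nat \<Rightarrow> nat"
  assumes "\<And>i. i \<in> {1..n} \<Longrightarrow> m i \<le> N" "\<And>i. i \<in> {1..n} \<Longrightarrow> m' i \<le> N"
    and "(\<Sum>i\<in>{1..n}. m i * Suc N ^ i) = (\<Sum>i\<in>{1..n}. m' i * Suc N ^ i)"
  shows "\<forall>i\<in>{1..n}. m i = m' i"
proof -
  have lt: "(\<Sum>i\<in>{1..k}. f i * Suc N ^ i) < Suc N ^ Suc k" if "\<And>i. i \<in> {1..k} \<Longrightarrow> f i \<le> N" for k and f :: "nat \<Rightarrow> nat"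
    using that
  proof (induction k)
    case (Suc k)
    have "f (Suc k) * Suc N ^ Suc k \<le> N * Suc N ^ Suc k" using Suc.prems[of "Suc k"] by (intro mult_right_mono) auto
    moreover have "(\<Sum>i\<in>{1..k}. f i * Suc N ^ i) < Suc N ^ Suc k" using Suc by auto
    ultimately have "(\<Sum>i\<in>{1..k}. f i * Suc N ^ i) + f (Suc k) * Suc N ^ Suc k < Suc N ^ Suc k + N * Suc N ^ Suc k"
      by linarith
    then show ?case by simp
  qed simp
  show ?thesis using assms
  proof (induction n)
    case (Suc n)
    have a: "(\<Sum>i\<in>{1..n}. m i * Suc N ^ i) < Suc N ^ Suc n" "(\<Sum>i\<in>{1..n}. m' i * Suc N ^ i) < Suc N ^ Suc n"
      by (rule lt, use Suc.prems in simp)+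
    have b: "(\<Sum>i\<in>{1..n}. m i * Suc N ^ i) + m (Suc n) * Suc N ^ Suc n = (\<Sum>i\<in>{1..n}. m' i * Suc N ^ i) + m' (Suc n) * Suc N ^ Suc n"
      using Suc.prems(3) by simp
    have "((\<Sum>i\<in>{1..n}. m i * Suc N ^ i) + m (Suc n) * Suc N ^ Suc n) div Suc N ^ Suc n = m (Suc n)"
      "((\<Sum>i\<in>{1..n}. m' i * Suc N ^ i) + m' (Suc n) * Suc N ^ Suc n) div Suc N ^ Suc n = m' (Suc n)"
      using a by (auto simp del: power_Suc)
    then have c: "m (Suc n) = m' (Suc n)" using b by metis
    then have "(\<Sum>i\<in>{1..n}. m i * Suc N ^ i) = (\<Sum>i\<in>{1..n}. m' i * Suc N ^ i)" using b by simp
    then have "\<forall>i\<in>{1..n}. m i = m' i" using Suc.IH Suc.prems by simp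
    then show ?case using c by (auto simp: le_Suc_eq)
  qed simp
qed

section \<open>Denominators of Todd coefficients\<close>

lemma rat_denom_mult_Ints: "of_int (rat_denom c) * c \<in> \<int>"
proof -
  obtain a b where ab: "quotient_of c = (a, b)" by fastforce
  then have "c = of_int a / of_int b" "b > 0" using quotient_of_div quotient_of_denom_pos by auto
  then show ?thesis unfolding rat_denom_def ab by simp
qed

lemma todd_denom_nonzero: "todd_denom N n \<noteq> 0"
proof -
  have "rat_denom c \<noteq> 0" for c
    using quotient_of_denom_pos'[of c] by (simp add: rat_denom_def)
  then show ?thesis unfolding todd_denom_def by (subst Lcm_0_iff) auto
qed

lemma prod_single:
  assumes "finite A"
  shows "(\<Prod>i\<in>A. Poly_Mapping.single (f i) (g i :: 'b::comm_semiring_1)) = Poly_Mapping.single (\<Sum>i\<in>A. f i) (\<Prod>i\<in>A. g i)"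
  using assms by (induction A) (auto simp: mult_single single_one)

text \<open>Different compositions give different monomials, so each product is, up to the sign
  (-1)^N, a coefficient of the Todd polynomial. A vanishing product is not seen by
  \<open>keys\<close> and is treated separately.\<close>

lemma todd_denom_mult_Ints:
  assumes m: "m \<in> compositions N n"
  shows "of_int (todd_denom N n) * (\<Prod>i\<in>{1..n}. bernoulli (m i) / fact (m i)) \<in> (\<int> :: rat set)"
proof -
  define \<mu> where "\<mu> m = (\<Sum>i\<in>{1..n}. Poly_Mapping.single i (m i))" for m :: "nat \<Rightarrow> nat"
  define c where "c m = (\<Prod>i\<in>{1..n}. bernoulli (m i) / fact (m i) :: rat)" for m
  have lk: "Poly_Mapping.lookup (\<mu> m) i = (if i \<in> {1..n} then m i else 0)" for m i
    unfolding \<mu>_def lookup_sum by (simp add: lookup_single when_def)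
  have inj: "m' = m" if "m' \<in> compositions N n" "\<mu> m' = \<mu> m" for m'
  proof (rule PiE_ext)
    show "m' \<in> {1..n} \<rightarrow>\<^sub>E UNIV" "m \<in> {1..n} \<rightarrow>\<^sub>E UNIV" using that m by (auto simp: compositions_def)
    fix i assume "i \<in> {1..n}"
    then show "m' i = m i" using lk[of m i] lk[of m' i] that by simp
  qed
  have td: "todd N n = (-1) ^ N * (\<Sum>m\<in>compositions N n. Poly_Mapping.single (\<mu> m) (c m))"
    by (simp add: todd_def prod_single \<mu>_def c_def)
  have "Poly_Mapping.lookup (\<Sum>m\<in>compositions N n. Poly_Mapping.single (\<mu> m) (c m)) (\<mu> m) = (\<Sum>m'\<in>compositions N n. if m' = m then c m else 0)"
    unfolding lookup_sum lookup_single using inj by (intro sum.cong) (auto simp: when_def)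
  also have "\<dots> = c m" using m finite_compositions by simp
  finally have L: "Poly_Mapping.lookup (todd N n) (\<mu> m) = c m \<or> Poly_Mapping.lookup (todd N n) (\<mu> m) = - c m"
    unfolding td by (cases "even N") auto
  show ?thesis
  proof (cases "c m = 0")
    case False
    define l where "l = Poly_Mapping.lookup (todd N n) (\<mu> m)"
    have "\<mu> m \<in> Poly_Mapping.keys (todd N n)" using L False by (auto simp: in_keys_iff)
    then have "rat_denom l dvd todd_denom N n"
      unfolding todd_denom_def l_def by (intro dvd_Lcm imageI)
    then obtain k where "todd_denom N n = rat_denom l * k" by (elim dvdE)
    then have "of_int (todd_denom N n) * l = of_int k * (of_int (rat_denom l) * l)" by simp
    then have "of_int (todd_denom N n) * l \<in> \<int>"
      by (metis Ints_mult Ints_of_int rat_denom_mult_Ints)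
    then show ?thesis using L unfolding l_def[symmetric] c_def[symmetric] by auto
  next
    case True
    then show ?thesis unfolding c_def by (simp only: mult_zero_right Ints_0)
  qed
qed

subsection \<open>Dedekind sums as Laurent coefficients\<close>

lemma sum_compositions_Suc:
  fixes g :: "(nat \<Rightarrow> nat) \<Rightarrow> 'a::comm_monoid_add"
  assumes g: "\<And>m m'. (\<And>i. i \<in> {1..Suc n} \<Longrightarrow> m i = m' i) \<Longrightarrow> g m = g m'"
  shows "sum g (compositions N (Suc n)) = (\<Sum>k\<le>N. \<Sum>m\<in>compositions (N - k) n. g (m(Suc n := k)))"
proof -
  have "sum g (compositions N (Suc n)) = (\<Sum>(k, m)\<in>(SIGMA k:{..N}. compositions (N - k) n). g (m(Suc n := k)))"
  proof (rule sum.reindex_bij_witness)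
    fix m assume "m \<in> compositions N (Suc n)"
    then have m: "m \<in> {1..Suc n} \<rightarrow>\<^sub>E UNIV" "(\<Sum>i\<in>{1..n}. m i) + m (Suc n) = N"
      by (auto simp: compositions_def)
    show "(\<lambda>(k, m). m(Suc n := k)) ((\<lambda>m. (m (Suc n), restrict m {1..n})) m) = m"
    proof
      fix i
      show "(\<lambda>(k, m). m(Suc n := k)) ((\<lambda>m. (m (Suc n), restrict m {1..n})) m) i = m i"
        using m(1) by (cases "i \<in> {1..Suc n}") (auto simp: PiE_def extensional_def restrict_def le_Suc_eq)
    qed
    show "(\<lambda>m. (m (Suc n), restrict m {1..n})) m \<in> (SIGMA k:{..N}. compositions (N - k) n)"
      using m(2) by (auto simp: compositions_def)
    show "(case (\<lambda>m. (m (Suc n), restrict m {1..n})) m of (k, m) \<Rightarrow> g (m(Suc n := k))) = g m"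
      by (auto intro!: g simp: le_Suc_eq)
  next
    fix x assume "x \<in> (SIGMA k:{..N}. compositions (N - k) n)"
    then obtain k m where x: "x = (k, m)" and k: "k \<le> N" and m: "m \<in> {1..n} \<rightarrow>\<^sub>E UNIV" "(\<Sum>i\<in>{1..n}. m i) = N - k"
      by (auto simp: compositions_def)
    show "(\<lambda>m. (m (Suc n), restrict m {1..n})) ((\<lambda>(k, m). m(Suc n := k)) x) = x"
    proof -
      have "restrict (m(Suc n := k)) {1..n} = m"
        using m(1) by (auto simp: PiE_def extensional_def restrict_def fun_eq_iff)
      then show ?thesis by (simp add: x)
    qed
    have "(\<Sum>i\<in>{1..n}. (m(Suc n := k)) i) = (\<Sum>i\<in>{1..n}. m i)" by (rule sum.cong) auto
    then show "(\<lambda>(k, m). m(Suc n := k)) x \<in> compositions N (Suc n)"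
      using m k by (auto simp: x compositions_def PiE_def extensional_def)
  qed
  also have "\<dots> = (\<Sum>k\<le>N. \<Sum>m\<in>compositions (N - k) n. g (m(Suc n := k)))"
    by (rule sum.Sigma[symmetric]) (auto simp: finite_compositions)
  finally show ?thesis .
qed

lemma fps_prod_compositions:
  fixes f :: "nat \<Rightarrow> 'a::comm_ring_1 fps"
  shows "(\<Prod>i\<in>{1..n}. f i) $ N = (\<Sum>m\<in>compositions N n. \<Prod>i\<in>{1..n}. f i $ m i)"
proof (induction n arbitrary: N)
  case 0
  have "compositions N 0 = (if N = 0 then {\<lambda>_. undefined} else {})" by (auto simp: compositions_def)
  then show ?case by simp
next
  case (Suc n)
  have "(\<Prod>i\<in>{1..Suc n}. f i) $ N = (f (Suc n) * (\<Prod>i\<in>{1..n}. f i)) $ N"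
    by (simp add: mult.commute)
  also have "\<dots> = (\<Sum>k\<le>N. f (Suc n) $ k * (\<Sum>m\<in>compositions (N - k) n. \<Prod>i\<in>{1..n}. f i $ m i))"
    by (simp add: fps_mult_nth Suc.IH[simplified] atLeast0AtMost)
  also have "\<dots> = (\<Sum>k\<le>N. \<Sum>m\<in>compositions (N - k) n. \<Prod>i\<in>{1..Suc n}. f i $ ((m(Suc n := k)) i))"
  proof (intro sum.cong refl)
    fix k
    have "(\<Prod>i\<in>{1..n}. f i $ ((m(Suc n := k)) i)) = (\<Prod>i\<in>{1..n}. f i $ m i)" for m
      by (rule prod.cong) auto
    then show "f (Suc n) $ k * (\<Sum>m\<in>compositions (N - k) n. \<Prod>i\<in>{1..n}. f i $ m i) =
       (\<Sum>m\<in>compositions (N - k) n. \<Prod>i\<in>{1..Suc n}. f i $ ((m(Suc n := k)) i))"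
      by (simp add: sum_distrib_left mult.commute)
  qed
  also have "\<dots> = (\<Sum>m\<in>compositions N (Suc n). \<Prod>i\<in>{1..Suc n}. f i $ m i)"
    by (rule sum_compositions_Suc[symmetric]) (auto intro!: prod.cong)
  finally show ?case .
qed

lemma sum_powers_roots_unity:
  assumes "q > 0"
  shows "(\<Sum>\<zeta> | \<zeta> ^ q = 1. \<zeta> ^ s) = (if q dvd s then of_nat q else (0::complex))"
proof (cases "q dvd s")
  case True
  then obtain k where "s = q * k" by (elim dvdE)
  then have "(\<Sum>\<zeta> | \<zeta> ^ q = 1. \<zeta> ^ s) = (\<Sum>\<zeta> | \<zeta> ^ q = (1::complex). (1::complex))"
    by (intro sum.cong[OF refl]) (simp add: power_mult)
  also have "\<dots> = of_nat q" using card_complex_roots_unity[of q] assms by simp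
  finally show ?thesis using True by simp
next
  case False
  define z where "z = exp (2 * of_real pi * \<i> * of_nat 1 / of_nat q)"
  have z: "z ^ q = 1" unfolding z_def by (rule complex_root_unity) (use assms in auto)
  have zs: "z ^ s \<noteq> 1"
  proof -
    have "z ^ s = exp (2 * of_real pi * \<i> * of_nat s / of_nat q)"
      unfolding z_def by (simp add: exp_of_nat_mult[symmetric] mult_ac)
    then show ?thesis using complex_root_unity_eq_1[of q s] assms False by simp
  qed
  have z0: "z \<noteq> 0" by (simp add: z_def)
  define T where "T = (\<Sum>\<zeta> | \<zeta> ^ q = 1. (\<zeta>::complex) ^ s)"
  have "T = (\<Sum>\<zeta> | \<zeta> ^ q = 1. (z * \<zeta>) ^ s)"
    unfolding T_def
    by (rule sum.reindex_bij_witness[where j="\<lambda>\<zeta>. \<zeta> / z" and i="\<lambda>\<zeta>. z * \<zeta>"])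
       (use z z0 in \<open>auto simp: power_mult_distrib power_divide\<close>)
  also have "\<dots> = z ^ s * T" by (simp add: T_def power_mult_distrib sum_distrib_left)
  finally have "T = 0" using zs by (metis mult_cancel_right1)
  then show ?thesis using False by (simp add: T_def)
qed

text \<open>The sum in the statement is the case \<open>w\<^sub>n = q - 1\<close>, that is \<open>w\<^sub>n \<equiv> -1 (mod q)\<close>, up to a power of \<open>q\<close>.\<close>

definition dedekind_coeff :: "nat \<Rightarrow> nat \<Rightarrow> (nat \<Rightarrow> nat) \<Rightarrow> (nat \<Rightarrow> nat) \<Rightarrow> complex" where
  "dedekind_coeff n q w m = (\<Sum>k | k \<in> {1..n} \<rightarrow>\<^sub>E {..<q} \<and> q dvd (\<Sum>i\<in>{1..n}. w i * k i).
     \<Prod>i\<in>{1..n}. scaled_bernoulli q (m i) (k i))"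

lemma Rats_dedekind_coeff: "dedekind_coeff n q w m \<in> \<rat>"
  unfolding dedekind_coeff_def by (intro Rats_sum Rats_prod Rats_scaled_bernoulli)

text \<open>The divisibility condition on k is detected by averaging powers of \<zeta> over all q-th
  roots of unity.\<close>

lemma dedekind_coeff_conv_roots:
  assumes "q > 0"
  shows "dedekind_coeff n q w m = (\<Sum>\<zeta> | \<zeta> ^ q = 1. \<Prod>i\<in>{1..n}. beta q (\<zeta> ^ w i) (m i)) / of_nat q"
proof -
  let ?K = "{1..n} \<rightarrow>\<^sub>E {..<q}"
  have "(\<Sum>\<zeta> | \<zeta> ^ q = 1. \<Prod>i\<in>{1..n}. beta q (\<zeta> ^ w i) (m i)) =
     (\<Sum>\<zeta> | \<zeta> ^ q = 1. \<Sum>k\<in>?K. \<Prod>i\<in>{1..n}. (\<zeta> ^ w i) ^ k i * scaled_bernoulli q (m i) (k i) :: complex)"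
    unfolding beta_def by (intro sum.cong refl prod_sum_PiE) auto
  also have "\<dots> = (\<Sum>\<zeta> | \<zeta> ^ q = 1. \<Sum>k\<in>?K. \<zeta> ^ (\<Sum>i\<in>{1..n}. w i * k i) * (\<Prod>i\<in>{1..n}. scaled_bernoulli q (m i) (k i)))"
    by (simp add: prod.distrib power_mult power_sum)
  also have "\<dots> = (\<Sum>k\<in>?K. (\<Sum>\<zeta> | \<zeta> ^ q = 1. \<zeta> ^ (\<Sum>i\<in>{1..n}. w i * k i)) * (\<Prod>i\<in>{1..n}. scaled_bernoulli q (m i) (k i)))"
    by (subst sum.swap) (simp add: sum_distrib_right)
  also have "\<dots> = (\<Sum>k\<in>?K. of_nat q * (if q dvd (\<Sum>i\<in>{1..n}. w i * k i) then \<Prod>i\<in>{1..n}. scaled_bernoulli q (m i) (k i) else 0))"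
    unfolding sum_powers_roots_unity[OF assms] by (intro sum.cong) auto
  also have "\<dots> = of_nat q * (\<Sum>k\<in>{k\<in>?K. q dvd (\<Sum>i\<in>{1..n}. w i * k i)}. \<Prod>i\<in>{1..n}. scaled_bernoulli q (m i) (k i))"
    unfolding sum_distrib_left[symmetric]
    by (subst sum.inter_filter[symmetric]) (auto intro!: finite_PiE)
  finally show ?thesis using assms by (simp add: dedekind_coeff_def)
qed

text \<open>Only the powers of \<zeta> with exponent \<open>w i\<close> enter, so \<open>w i\<close>
  matters modulo q, and by \<open>beta_inverse\<close> its negation costs (-1)^(m i). This gives the
  freedom to choose small representatives prime to t.\<close>

lemma dedekind_coeff_cong_sign:
  assumes q: "q > 0"
    and w: "\<And>i. i \<in> {1..n} \<Longrightarrow> [w i = w' i] (mod q) \<or> [w i + w' i = 0] (mod q)"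
  shows "\<exists>s\<in>{1,-1}. dedekind_coeff n q w' m = s * dedekind_coeff n q w m"
proof -
  define s where "s = (\<Prod>i\<in>{1..n}. if [w i = w' i] (mod q) then 1 else (-1::complex) ^ m i)"
  have red: "\<zeta> ^ a = \<zeta> ^ (a mod q)" if "\<zeta> ^ q = 1" for \<zeta> :: complex and a
  proof -
    have "\<zeta> ^ a = \<zeta> ^ (q * (a div q) + a mod q)" by simp
    also have "\<dots> = \<zeta> ^ (a mod q)" unfolding power_add power_mult that by simp
    finally show ?thesis .
  qed
  have "(\<Prod>i\<in>{1..n}. beta q (\<zeta> ^ w' i) (m i)) = s * (\<Prod>i\<in>{1..n}. beta q (\<zeta> ^ w i) (m i))" if \<zeta>: "\<zeta> ^ q = 1" for \<zeta> :: complex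
    unfolding s_def prod.distrib[symmetric]
  proof (rule prod.cong[OF refl])
    fix i assume i: "i \<in> {1..n}"
    show "beta q (\<zeta> ^ w' i) (m i) = (if [w i = w' i] (mod q) then 1 else (-1) ^ m i) * beta q (\<zeta> ^ w i) (m i)"
    proof (cases "[w i = w' i] (mod q)")
      case True
      then show ?thesis using red[OF \<zeta>, of "w i"] red[OF \<zeta>, of "w' i"] by (simp add: cong_def)
    next
      case False
      then have "\<zeta> ^ (w i + w' i) = 1"
        using w[OF i] red[OF \<zeta>, of "w i + w' i"] by (simp add: cong_def)
      then have "\<zeta> ^ w' i = inverse (\<zeta> ^ w i)" by (metis inverse_unique power_add)
      moreover have "(\<zeta> ^ w i) ^ q = 1" using \<zeta> by (metis power_commutes power_mult power_one mult.commute)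
      ultimately show ?thesis using beta_inverse[OF q, of "\<zeta> ^ w i"] False by simp
    qed
  qed
  then have "dedekind_coeff n q w' m = s * dedekind_coeff n q w m"
    unfolding dedekind_coeff_conv_roots[OF q] by (simp add: sum_distrib_left)
  moreover have "s \<in> {1, -1}"
  proof -
    have "s ^ 2 = 1" unfolding s_def prod_power_distrib
      by (intro prod.neutral) (auto simp: power_mult[symmetric] mult.commute[of _ 2] power_mult)
    then show ?thesis by (simp add: power2_eq_1_iff)
  qed
  ultimately show ?thesis by blast
qed

section \<open>Reciprocity as an identity of Laurent series\<close>

abbreviation fls_exp :: "complex \<Rightarrow> complex fls" where "fls_exp y \<equiv> fps_to_fls (fps_exp y)"

lemma fls_exp_add: "fls_exp (a + b) = fls_exp a * fls_exp b"
  by (simp add: fps_exp_add_mult fls_times_fps_to_fls)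

lemma fls_exp_power: "fls_exp a ^ k = fls_exp (of_nat k * a)"
  by (simp add: fps_exp_power_mult flip: fps_to_fls_power)

lemma const_fls_exp_neq_1:
  assumes "c \<noteq> 0" "y \<noteq> 0" shows "fls_const c * fls_exp y \<noteq> 1"
proof
  assume "fls_const c * fls_exp y = 1"
  then have "fps_to_fls (fps_const c * fps_exp y) = fps_to_fls 1" by (simp add: fls_times_fps_to_fls)
  then have "fps_const c * fps_exp y = 1" by (simp only: fps_to_fls_eq_iff)
  then have "(fps_const c * fps_exp y) $ 1 = (1 :: complex fps) $ 1" by simp
  then show False using assms by simp
qed

text \<open>The generating function of all \<open>dedekind_coeff n q w\<close>. The series variable
  records the total degree, shifted by n on account of the n possible simple poles.\<close>

definition dedekind_fls :: "nat \<Rightarrow> nat \<Rightarrow> (nat \<Rightarrow> nat) \<Rightarrow> (nat \<Rightarrow> complex) \<Rightarrow> complex fls" where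
  "dedekind_fls n q w y = (\<Sum>\<zeta> | \<zeta> ^ q = 1. \<Prod>i\<in>{1..n}. cayley (fls_const (\<zeta> ^ w i) * fls_exp (y i))) / of_nat q"

lemma fps_to_fls_prod: "fps_to_fls (\<Prod>i\<in>A. f i) = (\<Prod>i\<in>A. fps_to_fls (f i :: 'a::comm_ring_1 fps))"
  by (induction A rule: infinite_finite_induct) (auto simp: fls_times_fps_to_fls)

lemma fps_to_fls_sum: "fps_to_fls (\<Sum>i\<in>A. f i) = (\<Sum>i\<in>A. fps_to_fls (f i :: 'a::comm_ring_1 fps))"
  by (induction A rule: infinite_finite_induct) auto

lemma dedekind_fls_coeff:
  assumes q: "q > 0" and y: "\<And>i. i \<in> {1..n} \<Longrightarrow> y i \<noteq> 0"
  shows "(fls_X ^ n * dedekind_fls n q w y) $$ int N =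
     (\<Sum>m\<in>compositions N n. dedekind_coeff n q w m * (\<Prod>i\<in>{1..n}. y i powi (int (m i) - 1)))"
proof -
  define f where "f \<zeta> i = Abs_fps (\<lambda>m. beta q (\<zeta> ^ w i) m * y i powi (int m - 1))" for \<zeta> i
  have qc: "(of_nat q :: complex fls) = fls_const (of_nat q)" by (simp add: fls_of_nat)
  have dq: "F / fls_const (of_nat q) = fls_const (inverse (of_nat q)) * F" for F :: "complex fls"
    using q by (simp add: fls_inverse_const divide_inverse mult.commute)
  have "fls_X ^ n * dedekind_fls n q w y = fls_const (inverse (of_nat q)) * (\<Sum>\<zeta> | \<zeta> ^ q = 1. fls_X ^ n * (\<Prod>i\<in>{1..n}. cayley (fls_const (\<zeta> ^ w i) * fls_exp (y i))))"
    unfolding dedekind_fls_def qc dq sum_distrib_left[symmetric] by (simp only: mult_ac)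
  also have "(\<Sum>\<zeta> | \<zeta> ^ q = 1. fls_X ^ n * (\<Prod>i\<in>{1..n}. cayley (fls_const (\<zeta> ^ w i) * fls_exp (y i)))) =
     (\<Sum>\<zeta> | \<zeta> ^ q = 1. \<Prod>i\<in>{1..n}. fps_to_fls (f \<zeta> i))"
  proof (rule sum.cong[OF refl])
    fix \<zeta> :: complex assume "\<zeta> \<in> {\<zeta>. \<zeta> ^ q = 1}"
    then have z1: "\<zeta> ^ q = 1" by simp
    have \<zeta>: "(\<zeta> ^ a) ^ q = 1" for a
    proof -
      have "(\<zeta> ^ a) ^ q = (\<zeta> ^ q) ^ a" by (simp only: power_mult[symmetric] mult.commute)
      then show ?thesis by (simp add: z1)
    qed
    have "fls_X ^ n * (\<Prod>i\<in>{1..n}. cayley (fls_const (\<zeta> ^ w i) * fls_exp (y i))) =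
      (\<Prod>i\<in>{1..n}. fls_X * cayley (fls_const (\<zeta> ^ w i) * fls_exp (y i)))"
      by (simp only: prod.distrib prod_constant card_atLeastAtMost diff_Suc_1)
    also have "\<dots> = (\<Prod>i\<in>{1..n}. fps_to_fls (f \<zeta> i))"
      unfolding f_def using y by (intro prod.cong refl fls_X_cayley_exp[OF q \<zeta>])
    finally show "fls_X ^ n * (\<Prod>i\<in>{1..n}. cayley (fls_const (\<zeta> ^ w i) * fls_exp (y i))) = \<dots>" .
  qed
  also have "fls_const (inverse (of_nat q)) * \<dots> = fps_to_fls (fps_const (inverse (of_nat q)) * (\<Sum>\<zeta> | \<zeta> ^ q = 1. \<Prod>i\<in>{1..n}. f \<zeta> i))"
    by (simp add: fls_times_fps_to_fls fps_to_fls_prod fps_to_fls_sum)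
  finally have "(fls_X ^ n * dedekind_fls n q w y) $$ int N = inverse (of_nat q) * (\<Sum>\<zeta> | \<zeta> ^ q = 1. (\<Prod>i\<in>{1..n}. f \<zeta> i) $ N)"
    by (simp add: fps_sum_nth)
  also have "(\<Sum>\<zeta> | \<zeta> ^ q = 1. (\<Prod>i\<in>{1..n}. f \<zeta> i) $ N) =
    (\<Sum>m\<in>compositions N n. \<Sum>\<zeta> | \<zeta> ^ q = 1. (\<Prod>i\<in>{1..n}. beta q (\<zeta> ^ w i) (m i)) * (\<Prod>i\<in>{1..n}. y i powi (int (m i) - 1)))"
    unfolding fps_prod_compositions by (subst sum.swap) (simp add: f_def prod.distrib)
  finally show ?thesis
    unfolding dedekind_coeff_conv_roots[OF q] by (simp add: sum_distrib_left sum_distrib_right divide_inverse mult_ac)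
qed

text \<open>At a zero z = \<xi> e^(- y_i / w_i) of the i-th denominator, z^(w_k) e^(y_k) is
  \<xi>^(w_k) times the exponential of coordinate k, and z^q is \<xi>^q times that of coordinate i.
  Slot i, vacated by the residue, is thus reused for the factor c(z^q).\<close>

definition cone_coord :: "nat \<Rightarrow> (nat \<Rightarrow> nat) \<Rightarrow> (nat \<Rightarrow> complex) \<Rightarrow> nat \<Rightarrow> nat \<Rightarrow> complex" where
  "cone_coord q w y i k = (if k = i then - (of_nat q * y i / of_nat (w i)) else y k - of_nat (w k) * y i / of_nat (w i))"

text \<open>A polynomial of degree q has at most q roots in the field of Laurent series, and the
  constants already supply q.\<close>

lemma roots_unity_fls:
  assumes "q > 0"
  shows "{\<xi> :: complex fls. \<xi> ^ q = 1} = fls_const ` {\<xi>. \<xi> ^ q = 1}"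
proof (rule sym, rule card_seteq)
  have ne: "monom 1 q - 1 \<noteq> (0 :: complex fls poly)"
  proof
    assume "monom 1 q - 1 = (0 :: complex fls poly)"
    then have "coeff (monom 1 q - 1) q = (0 :: complex fls)" by simp
    then show False using assms by simp
  qed
  have eq: "{\<xi> :: complex fls. \<xi> ^ q = 1} = {\<xi>. poly (monom 1 q - 1) \<xi> = 0}" by (simp add: poly_monom)
  show "finite {\<xi> :: complex fls. \<xi> ^ q = 1}" unfolding eq by (rule poly_roots_finite[OF ne])
  show "fls_const ` {\<xi>. \<xi> ^ q = 1} \<subseteq> {\<xi> :: complex fls. \<xi> ^ q = 1}"
    by (auto simp flip: fls_const_power)
  have "card {\<xi> :: complex fls. \<xi> ^ q = 1} \<le> degree (monom 1 q - 1 :: complex fls poly)"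
    unfolding eq by (rule card_poly_roots_bound[OF ne])
  also have "\<dots> \<le> q" by (intro degree_diff_le) (auto simp: degree_monom_le)
  also have "q = card (fls_const ` {\<xi>::complex. \<xi> ^ q = 1})"
    using assms card_complex_roots_unity[of q]
    by (subst card_image) (auto simp: inj_on_def fls_eq_iff)
  finally show "card {\<xi> :: complex fls. \<xi> ^ q = 1} \<le> card (fls_const ` {\<xi>::complex. \<xi> ^ q = 1})" .
qed

lemma inj_fls_const: "inj_on fls_const A"
  by (rule inj_onI) (metis fls_const_nth)

text \<open>An instance of \<open>residue_sum\<close> in which index 0 stands for c(z^q), that is,
  for order q and x_0 = 1. Factors with w_i = 0 do not depend on z and are carried along as
  \<open>PZ\<close>. By \<open>gen\<close>, no two denominators share a zero.\<close>

lemma dedekind_fls_reciprocity: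
  fixes w :: "nat \<Rightarrow> nat" and y :: "nat \<Rightarrow> complex"
  assumes q: "q > 0" and y: "\<And>i. i \<in> {1..n} \<Longrightarrow> y i \<noteq> 0"
    and gen: "\<And>i k. i \<in> {1..n} \<Longrightarrow> k \<in> {1..n} \<Longrightarrow> i \<noteq> k \<Longrightarrow> w i > 0 \<Longrightarrow> of_nat (w i) * y k \<noteq> of_nat (w k) * y i"
  defines "J \<equiv> {i\<in>{1..n}. w i > 0}"
  shows "dedekind_fls n q w y + (\<Sum>i\<in>J. dedekind_fls n (w i) (w(i := q)) (cone_coord q w y i)) =
     (1/2) ^ Suc (card J) * (1 - (-1) ^ Suc (card J)) * (\<Prod>i\<in>{1..n}-J. cayley (fls_exp (y i)))"
proof -
  define I where "I = insert 0 J"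
  define w' where "w' = w(0 := q)"
  define x where "x i = (if i = 0 then 1 else fls_exp (y i))" for i :: nat
  define \<eta> where "\<eta> i = (if i = 0 then 1 else fls_exp (- (y i / of_nat (w i))))" for i :: nat
  define PZ where "PZ = (\<Prod>i\<in>{1..n}-J. cayley (fls_exp (y i)))"
  have finJ: "finite J" and J: "i \<in> J \<Longrightarrow> i \<in> {1..n} \<and> w i > 0 \<and> i \<noteq> 0" for i by (auto simp: J_def)
  have J0: "0 \<notin> J" by (simp add: J_def)
  have finI: "finite I" using finJ by (simp add: I_def)
  have wpos: "w' i > 0" if "i \<in> I" for i using that q J by (auto simp: I_def w'_def)
  have eta: "x i * \<eta> i ^ w' i = 1" if "i \<in> I" for i
  proof (cases "i = 0")
    case False
    then have "i \<in> J" using that by (simp add: I_def)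
    then have "of_nat (w i) * (- (y i / of_nat (w i))) = - y i" using J by simp
    then show ?thesis using False by (simp add: x_def \<eta>_def w'_def fls_exp_power flip: fls_exp_add)
  qed (simp add: x_def \<eta>_def)
  have key0: "x k * (fls_const c * \<eta> 0) ^ w' k = fls_const (c ^ w k) * fls_exp (y k)" if "k \<in> J" for k c
    using that J[OF that] by (simp add: x_def \<eta>_def w'_def fls_const_power mult.commute)
  have keyi: "x k * (fls_const c * \<eta> i) ^ w' k = fls_const (c ^ (w(i := q)) (if k = 0 then i else k)) * fls_exp (cone_coord q w y i (if k = 0 then i else k))"
    if "i \<in> J" "k \<in> I - {i}" for i k c
  proof (cases "k = 0")
    case True
    then show ?thesis using that J[OF that(1)]
      by (simp add: x_def \<eta>_def w'_def cone_coord_def power_mult_distrib fls_exp_power fls_const_power)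
  next
    case False
    then have "cone_coord q w y i k = y k + of_nat (w k) * (- (y i / of_nat (w i)))"
      using that by (simp add: cone_coord_def)
    then have "fls_exp (cone_coord q w y i k) = fls_exp (y k) * fls_exp (- (y i / of_nat (w i))) ^ w k"
      by (simp only: fls_exp_add fls_exp_power)
    then show ?thesis using that False J[OF that(1)]
      by (simp add: x_def \<eta>_def w'_def power_mult_distrib fls_const_power)
  qed
  have dis: "x k * (\<xi> * \<eta> i) ^ w' k \<noteq> 1" if ik: "i \<in> I" "k \<in> I" "i \<noteq> k" and xi: "\<xi> ^ w' i = 1" for i k \<xi>
  proof -
    obtain c where c: "\<xi> = fls_const c" "c ^ w' i = 1"
      using roots_unity_fls[OF wpos[OF ik(1)]] xi by blast
    then have c0: "c \<noteq> 0" using wpos[OF ik(1)] by (auto simp: power_0_left)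
    show ?thesis
    proof (cases "i = 0")
      case True
      then have "k \<in> J" using ik by (auto simp: I_def)
      then show ?thesis using key0[of k c] c0 y J True
        by (simp add: c const_fls_exp_neq_1)
    next
      case False
      then have i: "i \<in> J" using ik by (auto simp: I_def)
      have "cone_coord q w y i (if k = 0 then i else k) \<noteq> 0"
      proof (cases "k = 0")
        case True
        then show ?thesis using J[OF i] y q by (simp add: cone_coord_def)
      next
        case False
        then have "k \<in> J" using ik by (auto simp: I_def)
        then show ?thesis using J[OF i] J[of k] gen[of i k] ik False by (simp add: cone_coord_def field_simps)
      qed
      then show ?thesis using keyi[OF i, of k c] ik c0 by (simp add: c const_fls_exp_neq_1)
    qed
  qed
  have cU: "card {\<xi> :: complex fls. \<xi> ^ w' i = 1} = w' i" if "i \<in> I" for i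
    unfolding roots_unity_fls[OF wpos[OF that]] card_image[OF inj_fls_const]
    using wpos[OF that] card_complex_roots_unity[of "w' i"] by simp
  have "(\<Sum>i\<in>I. (\<Sum>\<xi> | \<xi> ^ w' i = 1. \<Prod>k\<in>I-{i}. cayley (x k * (\<xi> * \<eta> i) ^ w' k)) / of_nat (w' i)) =
     (1/2) ^ card I * (1 - (-1) ^ card I)"
    by (rule residue_sum[OF finI wpos eta cU dis])
  also have "(\<Sum>i\<in>I. (\<Sum>\<xi> | \<xi> ^ w' i = 1. \<Prod>k\<in>I-{i}. cayley (x k * (\<xi> * \<eta> i) ^ w' k)) / of_nat (w' i)) =
     (\<Sum>i\<in>I. (\<Sum>c | c ^ w' i = 1. \<Prod>k\<in>I-{i}. cayley (x k * (fls_const c * \<eta> i) ^ w' k)) / of_nat (w' i))"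
    by (intro sum.cong refl) (simp add: roots_unity_fls wpos sum.reindex[OF inj_fls_const])
  finally have main: "(\<Sum>i\<in>I. (\<Sum>c | c ^ w' i = 1. \<Prod>k\<in>I-{i}. cayley (x k * (fls_const c * \<eta> i) ^ w' k)) / of_nat (w' i)) * PZ =
     (1/2) ^ Suc (card J) * (1 - (-1) ^ Suc (card J)) * PZ"
    using finJ J0 by (simp add: I_def)
  have split: "{1..n} = J \<union> ({1..n} - J)" by (auto simp: J_def)
  have T0: "(\<Sum>c | c ^ w' 0 = 1. \<Prod>k\<in>I-{0}. cayley (x k * (fls_const c * \<eta> 0) ^ w' k)) / of_nat (w' 0) * PZ = dedekind_fls n q w y"
  proof -
    have "(\<Prod>k\<in>I-{0}. cayley (x k * (fls_const c * \<eta> 0) ^ w' k)) * PZ = (\<Prod>i\<in>{1..n}. cayley (fls_const (c ^ w i) * fls_exp (y i)))" for c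
    proof -
      have "(\<Prod>k\<in>I-{0}. cayley (x k * (fls_const c * \<eta> 0) ^ w' k)) = (\<Prod>k\<in>J. cayley (fls_const (c ^ w k) * fls_exp (y k)))"
        using J0 by (intro prod.cong) (auto simp: I_def key0)
      moreover have "PZ = (\<Prod>k\<in>{1..n}-J. cayley (fls_const (c ^ w k) * fls_exp (y k)))"
        unfolding PZ_def by (intro prod.cong) (auto simp: J_def)
      moreover have "(\<Prod>i\<in>{1..n}. cayley (fls_const (c ^ w i) * fls_exp (y i))) =
        (\<Prod>i\<in>J. cayley (fls_const (c ^ w i) * fls_exp (y i))) * (\<Prod>i\<in>{1..n}-J. cayley (fls_const (c ^ w i) * fls_exp (y i)))"
        by (subst split, rule prod.union_disjoint) (auto simp: finJ)
      ultimately show ?thesis by simp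
    qed
    then show ?thesis by (simp add: dedekind_fls_def w'_def sum_distrib_right)
  qed
  have Ti: "(\<Sum>c | c ^ w' i = 1. \<Prod>k\<in>I-{i}. cayley (x k * (fls_const c * \<eta> i) ^ w' k)) / of_nat (w' i) * PZ = dedekind_fls n (w i) (w(i := q)) (cone_coord q w y i)"
    if i: "i \<in> J" for i
  proof -
    have "(\<Prod>k\<in>I-{i}. cayley (x k * (fls_const c * \<eta> i) ^ w' k)) * PZ =
       (\<Prod>k\<in>{1..n}. cayley (fls_const (c ^ (w(i := q)) k) * fls_exp (cone_coord q w y i k)))" (is "_ = prod ?g _") for c
    proof -
      have "(\<Prod>k\<in>I-{i}. cayley (x k * (fls_const c * \<eta> i) ^ w' k)) = (\<Prod>k\<in>I-{i}. ?g (if k = 0 then i else k))"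
        by (intro prod.cong refl, subst keyi) (use i in auto)
      also have "\<dots> = prod ?g J"
        by (rule prod.reindex_bij_witness[where i="\<lambda>k. if k = i then 0 else k" and j="\<lambda>k. if k = 0 then i else k"])
           (use i J0 in \<open>auto simp: I_def dest: J\<close>)
      finally have "(\<Prod>k\<in>I-{i}. cayley (x k * (fls_const c * \<eta> i) ^ w' k)) = prod ?g J" .
      moreover have "PZ = prod ?g ({1..n}-J)"
        unfolding PZ_def using i by (intro prod.cong) (auto simp: J_def cone_coord_def)
      moreover have "prod ?g {1..n} = prod ?g J * prod ?g ({1..n}-J)"
        by (subst split, rule prod.union_disjoint) (auto simp: finJ)
      ultimately show ?thesis by simp
    qed
    moreover have "w' i = w i" using J[OF i] by (simp add: w'_def)
    ultimately show ?thesis by (simp add: dedekind_fls_def sum_distrib_right)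
  qed
  show ?thesis
    unfolding PZ_def[symmetric] main[symmetric]
    unfolding I_def sum.insert[OF finJ J0] distrib_right sum_distrib_right
    unfolding I_def[symmetric] T0 using Ti by simp
qed

subsection \<open>A partial fraction identity\<close>

text \<open>The binomial coefficient (m - 1 choose r - 1), with upper index -1 when m = 0. The value
  0 at r = 0 reflects the extra factor \<open>fls_X\<close> in the expansion below.\<close>

definition laurent_binom :: "nat \<Rightarrow> nat \<Rightarrow> complex" where
  "laurent_binom m r = (if r = 0 then 0 else of_int (int m - 1) gchoose (r - 1))"

lemma fls_X_linear_powi:
  fixes a y :: complex
  assumes a: "a \<noteq> 0" and y: "y \<noteq> 0"
  shows "fls_X * (fls_const a + fls_const y * fls_X) powi (int m - 1) =
    fps_to_fls (Abs_fps (\<lambda>r. laurent_binom m r * a powi (int m - int r) * y powi (int r - 1)))"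
proof -
  define e where "e = int m - 1"
  define H where "H = fps_const (y / a) * (fps_X :: complex fps)"
  have H: "H \<noteq> 0" "H $ 0 = 0" using a y by (auto simp: H_def)
  have "fls_compose_fps ((1 + fls_X) powi e) H = fls_compose_fps (1 + fls_X) H powi e"
    using H by (intro fls_compose_fps_powi)
  also have "fls_compose_fps (1 + fls_X) H = fls_const (inverse a) * (fls_const a + fls_const y * fls_X)"
  proof -
    have "fls_compose_fps (1 + fls_X) H = 1 + fps_to_fls H"
      using H by (simp add: fls_compose_fps_add)
    then show ?thesis using a
      by (simp add: H_def fls_times_fps_to_fls distrib_left divide_inverse mult.assoc[symmetric] mult.commute[of y])
  qed
  also have "fls_compose_fps ((1 + fls_X) powi e) H = fps_to_fls (fps_binomial (of_int e) oo H)"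
    using H unfolding one_plus_fls_X_powi_eq by (subst fls_compose_fps_to_fls) auto
  finally have "fps_to_fls (fps_binomial (of_int e) oo H) = fls_const (inverse a powi e) * (fls_const a + fls_const y * fls_X) powi e"
    by (simp add: power_int_mult_distrib fls_const_power_int)
  then have "fls_const (a powi e) * fps_to_fls (fps_binomial (of_int e) oo H) =
      fls_const (a powi e) * (fls_const (inverse a powi e) * (fls_const a + fls_const y * fls_X) powi e)" by simp
  also have "\<dots> = (fls_const a + fls_const y * fls_X) powi e"
    using a by (simp add: mult.assoc[symmetric] power_int_inverse)
  finally have "fls_X * (fls_const a + fls_const y * fls_X) powi e =
      fps_to_fls (fps_X * (fps_const (a powi e) * (fps_binomial (of_int e) oo H)))"
    by (simp add: fls_times_fps_to_fls)
  also have "fps_X * (fps_const (a powi e) * (fps_binomial (of_int e) oo H)) =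
     Abs_fps (\<lambda>r. laurent_binom m r * a powi (int m - int r) * y powi (int r - 1))"
  proof (rule fps_ext)
    fix r
    show "(fps_X * (fps_const (a powi e) * (fps_binomial (of_int e) oo H))) $ r =
       Abs_fps (\<lambda>r. laurent_binom m r * a powi (int m - int r) * y powi (int r - 1)) $ r"
    proof (cases r)
      case (Suc k)
      have "a powi e * (y / a) ^ k = a powi (int m - int r) * y powi (int r - 1)"
      proof -
        have e1: "int m - int r = e - int k" "int r - 1 = int k" by (simp_all add: e_def Suc)
        show ?thesis unfolding e1 using a by (simp add: power_int_diff power_divide)
      qed
      moreover have "(fps_binomial (of_int e) oo H) $ k = (y / a) ^ k * (of_int e gchoose k)"
        unfolding H_def fps_compose_linear by simp
      moreover have "laurent_binom m r = of_int e gchoose k" by (simp add: laurent_binom_def Suc e_def)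
      ultimately show ?thesis by (simp add: Suc mult_ac)
    qed (simp add: laurent_binom_def)
  qed
  finally show ?thesis by (simp add: e_def)
qed

text \<open>A polynomial in s, expanded at s = infinity with 1/s as series variable.\<close>

definition eval_X_inv :: "complex poly \<Rightarrow> complex fls" where
  "eval_X_inv P = poly (map_poly fls_const P) fls_X_inv"

lemma eval_X_inv_pCons: "eval_X_inv (pCons c P) = fls_const c + fls_X_inv * eval_X_inv P"
  by (cases "P = 0 \<and> c = 0") (auto simp: eval_X_inv_def map_poly_pCons)

lemma eval_X_inv_0 [simp]: "eval_X_inv 0 = 0" by (simp add: eval_X_inv_def)

lemma eval_X_inv_add: "eval_X_inv (a + b) = eval_X_inv a + eval_X_inv b"
  by (induction a b rule: poly_induct2) (auto simp: eval_X_inv_pCons algebra_simps simp flip: fls_plus_const)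

lemma eval_X_inv_smult: "eval_X_inv (smult c a) = fls_const c * eval_X_inv a"
  by (induction a) (auto simp: eval_X_inv_pCons algebra_simps)

lemma eval_X_inv_mult: "eval_X_inv (a * b) = eval_X_inv a * eval_X_inv b"
  by (induction a) (auto simp: eval_X_inv_pCons eval_X_inv_add eval_X_inv_smult algebra_simps)

lemma eval_X_inv_1 [simp]: "eval_X_inv 1 = 1" by (simp add: one_pCons eval_X_inv_pCons)

lemma eval_X_inv_power: "eval_X_inv (a ^ k) = eval_X_inv a ^ k"
  by (induction k) (auto simp: eval_X_inv_mult)

lemma eval_X_inv_prod: "eval_X_inv (prod f A) = (\<Prod>x\<in>A. eval_X_inv (f x))"
  by (induction A rule: infinite_finite_induct) (auto simp: eval_X_inv_mult)

lemma eval_X_inv_nth: "eval_X_inv P $$ k = (if k \<le> 0 then coeff P (nat (- k)) else 0)"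
proof (induction P arbitrary: k)
  case (pCons c P)
  have "nat (- k) = Suc (nat (- (k + 1)))" if "k < 0" using that by simp
  then show ?case
    by (auto simp: eval_X_inv_pCons fls_X_inv_times_conv_shift pCons.IH coeff_pCons split: nat.splits)
qed simp

lemma eval_X_inv_eq_0_iff [simp]: "eval_X_inv P = 0 \<longleftrightarrow> P = 0"
proof
  assume "eval_X_inv P = 0"
  then have "coeff P k = 0" for k using eval_X_inv_nth[of P "- int k"] by simp
  then show "P = 0" by (simp add: poly_eq_iff)
qed simp

lemma fls_subdegree_eval_X_inv: "P \<noteq> 0 \<Longrightarrow> fls_subdegree (eval_X_inv P) = - int (degree P)"
  by (rule fls_subdegree_eqI) (auto simp: eval_X_inv_nth coeff_eq_0)

text \<open>By division with remainder: the proper fraction vanishes at infinity, so only the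
  quotient contributes to the constant term.\<close>

lemma eval_X_inv_quotient_nth_0:
  assumes "D \<noteq> 0"
  shows "(eval_X_inv P / eval_X_inv D) $$ 0 = coeff (P div D) 0"
proof -
  define M where "M = P mod D"
  have "eval_X_inv P = eval_X_inv (P div D) * eval_X_inv D + eval_X_inv M"
    by (simp add: M_def flip: eval_X_inv_mult eval_X_inv_add)
  then have "eval_X_inv P / eval_X_inv D = eval_X_inv (P div D) + eval_X_inv M / eval_X_inv D"
    using assms by (simp add: field_simps)
  moreover have "(eval_X_inv M / eval_X_inv D) $$ 0 = 0"
  proof (cases "M = 0")
    case False
    then have "degree M < degree D" using degree_mod_less[of D P] assms by (simp add: M_def)
    moreover have "fls_subdegree (eval_X_inv M / eval_X_inv D) = fls_subdegree (eval_X_inv M) - fls_subdegree (eval_X_inv D)"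
      using assms False by (simp add: fls_divide_subdegree)
    ultimately have "fls_subdegree (eval_X_inv M / eval_X_inv D) > 0"
      using assms False by (simp add: fls_subdegree_eval_X_inv)
    then show ?thesis by (intro fls_eq0_below_subdegree)
  qed simp
  ultimately show ?thesis by (simp add: eval_X_inv_nth)
qed

text \<open>The sum is the coefficient of X^N in the product of X (w_k + y_k X)^(m_k - 1). Writing
  w_k + y_k X = X (y_k + w_k / X) and using that the m_k add up to N leaves the constant term of a
  product of powers of linear forms in s = 1/X.\<close>

lemma sum_laurent_binom_compositions:
  fixes w :: "nat \<Rightarrow> nat" and y :: "nat \<Rightarrow> complex"
  assumes w: "\<And>i. i \<in> {1..n} \<Longrightarrow> w i > 0" and y: "\<And>i. i \<in> {1..n} \<Longrightarrow> y i \<noteq> 0"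
    and m: "m \<in> compositions N n"
  shows "(\<Sum>r\<in>compositions N n. (\<Prod>k\<in>{1..n}. laurent_binom (m k) (r k) * of_nat (w k) powi (int (m k) - int (r k))) *
            (\<Prod>k\<in>{1..n}. y k powi (int (r k) - 1))) =
     (\<Prod>k\<in>{1..n}. eval_X_inv [:y k, of_nat (w k):] powi (int (m k) - 1)) $$ 0" (is "?S = ?G $$ 0")
proof -
  define L where "L k = eval_X_inv [:y k, of_nat (w k):]" for k
  have L: "L k = fls_const (y k) + fls_X_inv * fls_const (of_nat (w k))" for k by (simp add: L_def eval_X_inv_pCons)
  have unit_tuples: "fls_X * fls_X_inv = (1 :: complex fls)"
    unfolding fls_inverse_X[symmetric] by (rule right_inverse) simp
  have XL: "fls_const (of_nat (w k)) + fls_const (y k) * fls_X = fls_X * L k" for k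
    unfolding L distrib_left mult.assoc[symmetric] unit_tuples by (simp add: mult.commute)
  define e where "e k = int (m k) - 1" for k
  have "?S = (\<Prod>k\<in>{1..n}. Abs_fps (\<lambda>r. laurent_binom (m k) r * of_nat (w k) powi (int (m k) - int r) * y k powi (int r - 1))) $ N"
    unfolding fps_prod_compositions by (simp add: prod.distrib)
  also have "\<dots> = (\<Prod>k\<in>{1..n}. fls_X * (fls_X * L k) powi e k) $$ int N"
  proof -
    have "(\<Prod>k\<in>{1..n}. fls_X * (fls_X * L k) powi e k) =
       fps_to_fls (\<Prod>k\<in>{1..n}. Abs_fps (\<lambda>r. laurent_binom (m k) r * of_nat (w k) powi (int (m k) - int r) * y k powi (int r - 1)))"
      unfolding fps_to_fls_prod XL[symmetric] e_def
      by (intro prod.cong refl fls_X_linear_powi) (use w y in force)+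
    then show ?thesis by simp
  qed
  also have "(\<Prod>k\<in>{1..n}. fls_X * (fls_X * L k) powi e k) = (\<Prod>k\<in>{1..n}. fls_X ^ m k * L k powi e k)"
  proof (intro prod.cong refl)
    fix k
    have "fls_X * fls_X powi e k = (fls_X :: complex fls) ^ m k"
      unfolding power_int_of_nat[symmetric] power_int_add_1'[symmetric, OF disjI1[OF fls_X_nonzero]] e_def
      by simp
    then show "fls_X * (fls_X * L k) powi e k = fls_X ^ m k * L k powi e k"
      unfolding power_int_mult_distrib mult.assoc[symmetric] by simp
  qed
  also have "\<dots> = fls_X ^ N * (\<Prod>k\<in>{1..n}. L k powi e k)"
    using m by (simp only: prod.distrib power_sum[symmetric]) (simp only: compositions_def mem_Collect_eq)
  also have "(fls_X ^ N * (\<Prod>k\<in>{1..n}. L k powi e k)) $$ int N = (\<Prod>k\<in>{1..n}. L k powi e k) $$ 0"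
    by (simp add: fls_X_power_times_conv_shift)
  finally show ?thesis by (simp add: L_def e_def)
qed

lemma prod_inverse: "(\<Prod>k\<in>A. inverse (f k)) = inverse (\<Prod>k\<in>A. f k :: 'a::field)"
  by (induction A rule: infinite_finite_induct) auto

text \<open>For f(s), the product of (y_k + w_k s)^(m_k - 1), the value f(0) is compared with the
  constant term of the polynomial part of f. They differ by the value at 0 of the partial fractions
  at the simple poles - y_i / w_i with m_i = 0. These fractions are what the reciprocity law
  produces, and the identity replaces them by monomials in the y_k.\<close>

lemma partial_fractions_sum:
  fixes w :: "nat \<Rightarrow> nat" and y :: "nat \<Rightarrow> complex"
  assumes w: "\<And>i. i \<in> {1..n} \<Longrightarrow> w i > 0" and y: "\<And>i. i \<in> {1..n} \<Longrightarrow> y i \<noteq> 0"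
    and gen: "\<And>i k. i \<in> {1..n} \<Longrightarrow> k \<in> {1..n} \<Longrightarrow> i \<noteq> k \<Longrightarrow> of_nat (w i) * y k \<noteq> of_nat (w k) * y i"
    and m: "m \<in> compositions N n"
  shows "(\<Sum>r\<in>compositions N n. (\<Prod>k\<in>{1..n}. laurent_binom (m k) (r k) * of_nat (w k) powi (int (m k) - int (r k))) *
            (\<Prod>k\<in>{1..n}. y k powi (int (r k) - 1))) =
     (\<Prod>k\<in>{1..n}. y k powi (int (m k) - 1)) -
     (\<Sum>i | i \<in> {1..n} \<and> m i = 0. inverse (y i) *
        (\<Prod>k\<in>{1..n}-{i}. (y k - of_nat (w k) * y i / of_nat (w i)) powi (int (m k) - 1)))"
proof -
  define Z where "Z = {i\<in>{1..n}. m i = 0}"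
  define I where "I = {1..n} - Z"
  define l where "l k = [:y k, of_nat (w k):]" for k
  define P where "P = (\<Prod>k\<in>I. l k ^ (m k - 1))"
  define D where "D = (\<Prod>k\<in>Z. l k)"
  define a where "a i = - (y i / of_nat (w i))" for i
  define M where "M = P mod D"
  have fin: "finite Z" "finite I" by (auto simp: Z_def I_def)
  have ZI: "{1..n} = Z \<union> I" "Z \<inter> I = {}" by (auto simp: Z_def I_def)
  have inZ: "i \<in> {1..n}" "m i = 0" "w i > 0" "y i \<noteq> 0" "w i \<noteq> 0" if "i \<in> Z" for i
    using that w[of i] y[of i] by (auto simp: Z_def)
  have l0: "l k \<noteq> 0" if "k \<in> {1..n}" for k using y[OF that] by (simp add: l_def)
  have D0: "D \<noteq> 0" using l0 fin by (auto simp: D_def Z_def)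
  have "degree D = (\<Sum>k\<in>Z. degree (l k))"
    unfolding D_def by (rule degree_prod_sum_eq) (use l0 Z_def in auto)
  also have "\<dots> = (\<Sum>k\<in>Z. 1)"
  proof (rule sum.cong[OF refl])
    fix k assume "k \<in> Z"
    then have "w k \<noteq> 0" using w by (force simp: Z_def)
    then show "degree (l k) = 1" by (simp add: l_def)
  qed
  also have "\<dots> = card Z" by simp
  finally have degD: "degree D = card Z" .
  have "(\<Prod>k\<in>{1..n}. eval_X_inv (l k) powi (int (m k) - 1)) = (\<Prod>k\<in>Z. inverse (eval_X_inv (l k))) * (\<Prod>k\<in>I. eval_X_inv (l k) ^ (m k - 1))"
  proof -
    have "(\<Prod>k\<in>Z. eval_X_inv (l k) powi (int (m k) - 1)) = (\<Prod>k\<in>Z. inverse (eval_X_inv (l k)))"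
      by (intro prod.cong refl) (simp add: Z_def power_int_minus)
    moreover have "eval_X_inv (l k) powi (int (m k) - 1) = eval_X_inv (l k) ^ (m k - 1)" if "k \<in> I" for k
    proof -
      have "m k > 0" using that by (auto simp: Z_def I_def)
      then have "int (m k) - 1 = int (m k - 1)" by simp
      then show ?thesis by (simp only: power_int_of_nat)
    qed
    then have "(\<Prod>k\<in>I. eval_X_inv (l k) powi (int (m k) - 1)) = (\<Prod>k\<in>I. eval_X_inv (l k) ^ (m k - 1))"
      by (intro prod.cong refl)
    ultimately show ?thesis unfolding ZI(1) by (subst prod.union_disjoint) (use fin ZI in auto)
  qed
  also have "\<dots> = eval_X_inv P / eval_X_inv D"
    unfolding P_def D_def eval_X_inv_prod eval_X_inv_power by (simp add: prod_inverse divide_inverse mult.commute)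
  finally have "(\<Prod>k\<in>{1..n}. eval_X_inv (l k) powi (int (m k) - 1)) $$ 0 = coeff (P div D) 0"
    using eval_X_inv_quotient_nth_0[OF D0] by simp
  also have "\<dots> = poly (P div D) 0" by (simp add: poly_0_coeff_0)
  also have "\<dots> = poly P 0 / poly D 0 - poly M 0 / poly D 0"
  proof -
    have "P = P div D * D + M" by (simp add: M_def)
    then have "poly P 0 = poly (P div D) 0 * poly D 0 + poly M 0" by (metis poly_add poly_mult)
    moreover have "poly D 0 \<noteq> 0" using inZ fin by (auto simp: D_def l_def poly_prod)
    ultimately show ?thesis by (simp add: field_simps)
  qed
  also have "poly P 0 / poly D 0 = (\<Prod>k\<in>{1..n}. y k powi (int (m k) - 1))"
  proof -
    have "(\<Prod>k\<in>Z. y k powi (int (m k) - 1)) = inverse (\<Prod>k\<in>Z. y k)"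
      unfolding prod_inverse[symmetric] by (intro prod.cong refl) (simp add: Z_def power_int_minus)
    moreover have "y k powi (int (m k) - 1) = y k ^ (m k - 1)" if "k \<in> I" for k
    proof -
      have "m k > 0" using that by (auto simp: Z_def I_def)
      then have "int (m k) - 1 = int (m k - 1)" by simp
      then show ?thesis by (simp only: power_int_of_nat)
    qed
    then have "(\<Prod>k\<in>I. y k powi (int (m k) - 1)) = (\<Prod>k\<in>I. y k ^ (m k - 1))"
      by (intro prod.cong refl)
    ultimately have "(\<Prod>k\<in>{1..n}. y k powi (int (m k) - 1)) = inverse (\<Prod>k\<in>Z. y k) * (\<Prod>k\<in>I. y k ^ (m k - 1))"
      unfolding ZI(1) by (subst prod.union_disjoint) (use fin ZI in auto)
    then show ?thesis by (simp add: P_def D_def l_def poly_prod divide_inverse mult.commute)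
  qed
  also have "poly M 0 / poly D 0 = (\<Sum>i\<in>Z. inverse (y i) *
        (\<Prod>k\<in>{1..n}-{i}. (y k - of_nat (w k) * y i / of_nat (w i)) powi (int (m k) - 1)))"
  proof -
    \<comment> \<open>The remainder \<open>M\<close> is interpolated at 0 and at the poles; its
      degree is below the number of poles, so the leading divided difference vanishes.\<close>
    define T where "T = insert 0 (a ` Z)"
    have inj: "inj_on a Z"
    proof (rule inj_onI)
      fix i k assume "i \<in> Z" "k \<in> Z" "a i = a k"
      then show "i = k" using gen[of i k] inZ(1,3)[of i] inZ(1,3)[of k] by (auto simp: a_def field_simps)
    qed
    have a0: "0 \<notin> a ` Z"
    proof
      assume "0 \<in> a ` Z"
      then obtain i where "i \<in> Z" "a i = 0" by (metis imageE)
      then show False using inZ(4,5)[of i] by (simp add: a_def)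
    qed
    have cT: "card T = Suc (card Z)" using a0 fin by (simp add: T_def card_image inj)
    have Mdeg: "coeff M (card Z) = 0" "degree M < card T"
    proof -
      have "M = 0 \<or> degree M < card Z" using degree_mod_less[of D P] D0 degD by (auto simp: M_def)
      then show "coeff M (card Z) = 0" "degree M < card T" by (auto simp: coeff_eq_0 cT)
    qed
    define W where "W = (\<Prod>k\<in>Z. of_nat (w k) :: complex)"
    have W0: "W \<noteq> 0" using inZ(5) fin(1) by (simp only: W_def prod_zero_iff of_nat_eq_0_iff) blast
    have "(\<Sum>c\<in>T. poly M c / (\<Prod>b\<in>T-{c}. c - b)) = 0"
      using lagrange_leading_coeff[of T M] Mdeg fin cT by (simp add: T_def)
    moreover have "(\<Sum>c\<in>T. poly M c / (\<Prod>b\<in>T-{c}. c - b)) =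
       poly M 0 / (\<Prod>b\<in>a ` Z. - b) + (\<Sum>c\<in>a ` Z. poly M c / (\<Prod>b\<in>T-{c}. c - b))"
      unfolding T_def using fin a0 by (simp add: insert_Diff_if)
    moreover have "(\<Prod>b\<in>a ` Z. - b) = poly D 0 / W"
    proof -
      have "(\<Prod>b\<in>a ` Z. - b) = (\<Prod>i\<in>Z. - a i)" by (simp add: prod.reindex[OF inj])
      then show ?thesis by (simp add: D_def W_def poly_prod l_def a_def prod_dividef)
    qed
    moreover have "(\<Sum>c\<in>a ` Z. poly M c / (\<Prod>b\<in>T-{c}. c - b)) = (\<Sum>i\<in>Z. poly M (a i) / (\<Prod>b\<in>T-{a i}. a i - b))"
      by (simp add: sum.reindex[OF inj])
    ultimately have "poly M 0 / poly D 0 = - (\<Sum>i\<in>Z. poly M (a i) / (\<Prod>b\<in>T-{a i}. a i - b)) / W"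
      using W0 by (simp add: field_simps eq_neg_iff_add_eq_0)
    also have "\<dots> = (\<Sum>i\<in>Z. - (poly M (a i) / (\<Prod>b\<in>T-{a i}. a i - b)) / W)"
      by (simp add: sum_divide_distrib sum_negf)
    also have "\<dots> = (\<Sum>i\<in>Z. inverse (y i) *
        (\<Prod>k\<in>{1..n}-{i}. (y k - of_nat (w k) * y i / of_nat (w i)) powi (int (m k) - 1)))"
    proof (rule sum.cong[OF refl])
      fix i assume i: "i \<in> Z"
      define v where "v k = y k - of_nat (w k) * y i / of_nat (w i)" for k
      have lv: "poly (l k) (a i) = v k" for k by (simp add: l_def a_def v_def)
      have vi: "v i = 0" using inZ[OF i] by (simp add: v_def)
      have "poly D (a i) = 0" unfolding D_def poly_prod using i lv vi fin by (auto intro!: prod_zero)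
      moreover have "P = P div D * D + M" by (simp add: M_def)
      then have "poly P (a i) = poly (P div D) (a i) * poly D (a i) + poly M (a i)" by (metis poly_add poly_mult)
      ultimately have "poly M (a i) = (\<Prod>k\<in>I. v k ^ (m k - 1))"
        by (simp add: P_def poly_prod lv)
      also have "\<dots> = (\<Prod>k\<in>I. v k powi (int (m k) - 1))"
      proof (intro prod.cong refl)
        fix k assume "k \<in> I"
        then have "m k > 0" by (auto simp: Z_def I_def)
        then have "int (m k) - 1 = int (m k - 1)" by simp
        then show "v k ^ (m k - 1) = v k powi (int (m k) - 1)" by (simp only: power_int_of_nat)
      qed
      finally have Mi: "poly M (a i) = (\<Prod>k\<in>I. v k powi (int (m k) - 1))" .
      have "(\<Prod>b\<in>T-{a i}. a i - b) = a i * (\<Prod>k\<in>Z-{i}. a i - a k)"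
      proof -
        have "T - {a i} = insert 0 (a ` (Z - {i}))"
          using i a0 inj by (auto simp: T_def inj_on_def)
        moreover have "0 \<notin> a ` (Z - {i})" using a0 by auto
        ultimately show ?thesis
          using fin inj by (simp add: prod.reindex inj_on_diff)
      qed
      also have "(\<Prod>k\<in>Z-{i}. a i - a k) = (\<Prod>k\<in>Z-{i}. v k) / (\<Prod>k\<in>Z-{i}. of_nat (w k))"
        unfolding prod_dividef[symmetric]
      proof (intro prod.cong refl)
        fix k assume "k \<in> Z - {i}"
        then show "a i - a k = v k / of_nat (w k)"
          using inZ(5)[of k] inZ(5)[OF i] by (simp add: a_def v_def field_simps)
      qed
      also have "(\<Prod>k\<in>Z-{i}. of_nat (w k)) = W / of_nat (w i)"
        using prod.remove[OF fin(1) i, of "\<lambda>k. of_nat (w k) :: complex"] inZ[OF i] by (simp add: W_def)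
      also have "a i * ((\<Prod>k\<in>Z-{i}. v k) / (W / of_nat (w i))) = - y i * (\<Prod>k\<in>Z-{i}. v k) / W"
        using inZ[OF i] by (simp add: a_def)
      finally have Q: "(\<Prod>b\<in>T-{a i}. a i - b) = - y i * (\<Prod>k\<in>Z-{i}. v k) / W" .
      have "- (poly M (a i) / (\<Prod>b\<in>T-{a i}. a i - b)) / W = inverse (y i) * (inverse (\<Prod>k\<in>Z-{i}. v k) * poly M (a i))"
        unfolding Q using W0 by (simp add: field_simps)
      also have "inverse (\<Prod>k\<in>Z-{i}. v k) = (\<Prod>k\<in>Z-{i}. v k powi (int (m k) - 1))"
        unfolding prod_inverse[symmetric] by (intro prod.cong refl) (simp add: Z_def power_int_minus)
      also have "(\<Prod>k\<in>Z-{i}. v k powi (int (m k) - 1)) * poly M (a i) = (\<Prod>k\<in>{1..n}-{i}. v k powi (int (m k) - 1))"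
      proof -
        have "{1..n} - {i} = (Z - {i}) \<union> I" using i ZI by auto
        then show ?thesis unfolding Mi by (simp only:) (subst prod.union_disjoint, use fin ZI in auto)
      qed
      finally show "- (poly M (a i) / (\<Prod>b\<in>T-{a i}. a i - b)) / W = inverse (y i) *
          (\<Prod>k\<in>{1..n}-{i}. (y k - of_nat (w k) * y i / of_nat (w i)) powi (int (m k) - 1))"
        by (simp only: v_def)
    qed
    finally show ?thesis .
  qed
  finally show ?thesis
    using sum_laurent_binom_compositions[where w=w and y=y, OF w y m] by (simp only: l_def Z_def)
qed

subsection \<open>Denominators of Dedekind sums\<close>

lemma localization_uminus:
  assumes "x \<in> localization t" shows "- x \<in> localization t"
proof -
  obtain a b where ab: "\<not> t dvd b" "x = of_int a / of_int b" using assms unfolding localization_def by blast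
  then have "- x = of_int (- a) / of_int b" by simp
  then show ?thesis using ab(1) unfolding localization_def by blast
qed

lemma fls_nth_sum: "(\<Sum>i\<in>A. f i) $$ k = (\<Sum>i\<in>A. f i $$ k)"
  by (induction A rule: infinite_finite_induct) auto

text \<open>For m = 0 and r > 0 the value is (-1 choose r - 1), a sign; for m, r > 0 it is an
  ordinary binomial coefficient.\<close>

lemma laurent_binom_Ints: "laurent_binom m r \<in> \<int>"
proof (cases "r = 0")
  case False
  show ?thesis
  proof (cases "m = 0")
    case True
    have "1 + of_nat (r - 1) - 1 = (of_nat (r - 1) :: complex)" by simp
    then have "(- 1 gchoose (r - 1)) = (-1 :: complex) ^ (r - 1)"
      using gbinomial_minus[of "1::complex" "r - 1"] by (simp only: binomial_gbinomial[symmetric]) simp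
    then show ?thesis using True False by (simp add: laurent_binom_def)
  next
    case False
    then have "of_int (int m - 1) = (of_nat (m - 1) :: complex)" by simp
    then have "laurent_binom m r = of_nat (m - 1 choose (r - 1))" using \<open>r \<noteq> 0\<close>
      by (simp only: laurent_binom_def binomial_gbinomial[symmetric] if_False)
    then show ?thesis by simp
  qed
qed (simp add: laurent_binom_def)

text \<open>As a function of \<open>w\<close> this is the explicit Laurent polynomial. Up to sign
  and the factor 1/q, it collects what the residues with m_i = 0 contribute to the monomial with
  exponents r_k - 1.\<close>

definition laurent_coeff :: "nat \<Rightarrow> nat \<Rightarrow> int \<Rightarrow> (nat \<Rightarrow> nat) \<Rightarrow> (nat \<Rightarrow> nat) \<Rightarrow> complex" where
  "laurent_coeff n N d w r = of_int d * ((\<Prod>k\<in>{1..n}. bern0_coeff (r k)) -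
     (\<Sum>m\<in>compositions N n. (\<Prod>k\<in>{1..n}. bern0_coeff (m k)) *
        (\<Prod>k\<in>{1..n}. laurent_binom (m k) (r k) * of_nat (w k) powi (int (m k) - int (r k)))))"

lemma Rats_laurent_coeff: "laurent_coeff n N d w r \<in> \<rat>"
proof -
  have "laurent_binom m r \<in> \<rat>" for m r using laurent_binom_Ints[of m r] Ints_subset_Rats by blast
  then show ?thesis
    unfolding laurent_coeff_def
    by (intro Rats_mult Rats_diff Rats_prod Rats_sum Rats_bern0_coeff Rats_powi) simp_all
qed

text \<open>By \<open>beta_0\<close>, the factor with index i vanishes unless \<zeta>^q = 1. Since
  the order of the sum is coprime to q, only \<zeta> = 1 is left.\<close>

lemma dedekind_coeff_index_0:
  assumes i: "i \<in> {1..n}" "w i > 0" "coprime (w i) q" "m i = 0"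
  shows "dedekind_coeff n (w i) (w(i := q)) m = (\<Prod>k\<in>{1..n}. bern0_coeff (m k)) / of_nat (w i)"
proof -
  define a where "a = w i"
  have a: "a > 0" using i by (simp add: a_def)
  have one: "\<zeta> = 1" if "\<zeta> ^ a = 1" "\<zeta> ^ q = 1" for \<zeta> :: complex
  proof -
    obtain x y where xy: "a * x = q * y + 1"
      using bezout_nat[of a q] i(3) a by (auto simp: a_def coprime_iff_gcd_eq_1)
    have "1 = \<zeta> ^ (a * x)" by (simp add: power_mult that)
    also have "\<dots> = \<zeta>" unfolding xy by (simp add: power_add power_mult that)
    finally show ?thesis by simp
  qed
  have "(\<Prod>k\<in>{1..n}. beta a (\<zeta> ^ (w(i := q)) k) (m k)) = (if \<zeta> = 1 then \<Prod>k\<in>{1..n}. bern0_coeff (m k) else 0)"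
    if \<zeta>: "\<zeta> ^ a = 1" for \<zeta> :: complex
  proof (cases "\<zeta> = 1")
    case True
    then show ?thesis using a by (simp add: beta_1)
  next
    case False
    then have "\<zeta> ^ q \<noteq> 1" using one \<zeta> by blast
    moreover have "(\<zeta> ^ q) ^ a = 1"
      using \<zeta> by (metis mult.commute power_mult power_one)
    ultimately have "beta a (\<zeta> ^ (w(i := q)) i) (m i) = 0" using a i(4) by (simp add: beta_0)
    then show ?thesis using False i(1) by (auto intro!: prod_zero)
  qed
  then have "(\<Sum>\<zeta> | \<zeta> ^ a = (1::complex). \<Prod>k\<in>{1..n}. beta a (\<zeta> ^ (w(i := q)) k) (m k)) =
     (\<Sum>\<zeta> | \<zeta> ^ a = (1::complex). if \<zeta> = 1 then \<Prod>k\<in>{1..n}. bern0_coeff (m k) else 0)"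
    by (intro sum.cong) auto
  also have "\<dots> = (\<Prod>k\<in>{1..n}. bern0_coeff (m k))"
    using finite_roots_unity[of a] a by (subst sum.delta) auto
  finally show ?thesis using dedekind_coeff_conv_roots[OF a, of n "w(i := q)" m] by (simp add: a_def)
qed

section \<open>Integrality at one prime\<close>

locale gauss_todd = gauss +
  fixes n N :: nat and d :: int
  assumes N_pos: "N > 0"
    and todd_Ints: "\<And>m. m \<in> compositions N n \<Longrightarrow>
          of_int d * (\<Prod>i\<in>{1..n}. bernoulli (m i) / fact (m i)) \<in> (\<int> :: complex set)"
begin

text \<open>Kronecker substitution: the monomials of degree at most \<open>N\<close> in these points are distinct powers of \<open>Y\<close>.\<close>

definition gen_point :: "nat \<Rightarrow> complex" where "gen_point i = Y ^ (Suc N ^ i)"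

lemma gen_point_neq_0 [simp]: "gen_point i \<noteq> 0" by (simp add: gen_point_def)

lemma gen_point_eval_poly: "gen_point i = eval_poly Y (monom 1 (Suc N ^ i))" by (simp add: gen_point_def eval_poly_monom)

lemma monom_not_dvd: "\<not> t dvd c \<Longrightarrow> \<not> [:t:] dvd monom c k"
  by (metis coeff_monom const_poly_dvd_iff)

lemma t_not_dvd_1: "\<not> t dvd 1"
  using prime_t not_prime_unit by blast

lemma gen_point_R: "gen_point i \<in> R" "inverse (gen_point i) \<in> R"
  unfolding gen_point_eval_poly using gauss_eval_poly gauss_inverse_eval_poly[OF monom_not_dvd[OF t_not_dvd_1]] by blast+

text \<open>The two exponents of \<open>Y\<close> differ, so \<open>a\<close> is itself a
  coefficient of the form, which is therefore not divisible by t.\<close>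

lemma gen_point_form:
  assumes "\<not> t dvd int a" "i \<noteq> k"
  shows "of_nat a * gen_point k - of_nat b * gen_point i \<in> R" "inverse (of_nat a * gen_point k - of_nat b * gen_point i) \<in> R"
    "of_nat a * gen_point k - of_nat b * gen_point i \<noteq> 0"
proof -
  define f where "f = monom (int a) (Suc N ^ k) - monom (int b) (Suc N ^ i)"
  have f: "of_nat a * gen_point k - of_nat b * gen_point i = eval_poly Y f"
    by (simp add: f_def eval_poly_diff eval_poly_monom gen_point_def)
  have "Suc N ^ i \<noteq> Suc N ^ k"
    using assms(2) N_pos by (metis power_inject_exp Suc_less_eq One_nat_def)
  then have "coeff f (Suc N ^ k) = int a" by (simp add: f_def)
  then have ndvd: "\<not> [:t:] dvd f" using assms(1) by (metis const_poly_dvd_iff)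
  show "of_nat a * gen_point k - of_nat b * gen_point i \<in> R" "inverse (of_nat a * gen_point k - of_nat b * gen_point i) \<in> R"
    "of_nat a * gen_point k - of_nat b * gen_point i \<noteq> 0"
    unfolding f using gauss_eval_poly gauss_inverse_eval_poly[OF ndvd] eval_poly_neq_0[OF ndvd] by blast+
qed

lemma nat_units:
  assumes "\<not> t dvd int a"
  shows "of_nat a \<in> R" "inverse (of_nat a) \<in> R" "of_nat a \<noteq> (0::complex)"
proof -
  show "of_nat a \<in> R" by (rule gauss_of_nat)
  show "inverse (of_nat a) \<in> R" using gauss_inverse_of_int[OF assms] by simp
  show "of_nat a \<noteq> (0::complex)" using assms by (cases "a = 0") auto
qed

lemma cone_coord_unit:
  assumes "\<not> t dvd int (w i)" "k \<noteq> i"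
  shows "cone_coord q w gen_point i k \<in> R" "inverse (cone_coord q w gen_point i k) \<in> R" "cone_coord q w gen_point i k \<noteq> 0"
proof -
  have e: "cone_coord q w gen_point i k = (of_nat (w i) * gen_point k - of_nat (w k) * gen_point i) * inverse (of_nat (w i))"
    using nat_units[OF assms(1)] assms(2) by (simp add: cone_coord_def field_simps)
  show "cone_coord q w gen_point i k \<in> R"
    unfolding e by (intro gauss_mult gen_point_form(1) nat_units(2) assms) (use assms in auto)
  have "inverse (cone_coord q w gen_point i k) = inverse (of_nat (w i) * gen_point k - of_nat (w k) * gen_point i) * of_nat (w i)"
    unfolding e by simp
  then show "inverse (cone_coord q w gen_point i k) \<in> R"
    by (simp only:) (intro gauss_mult gen_point_form(2) nat_units(1) assms, use assms in auto)
  show "cone_coord q w gen_point i k \<noteq> 0"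
    unfolding e using gen_point_form(3)[of "w i" i k "w k"] nat_units[OF assms(1)] assms by auto
qed

text \<open>Unlike the other coordinates, this one is a unit only if t does not divide q. Otherwise
  nonnegative powers of it are harmless, and exponent -1 is the only source of denominators.\<close>

lemma cone_coord_self:
  assumes "\<not> t dvd int (w i)"
  shows "cone_coord q w gen_point i i \<in> R" "q > 0 \<Longrightarrow> cone_coord q w gen_point i i \<noteq> 0"
    "\<not> t dvd int q \<Longrightarrow> inverse (cone_coord q w gen_point i i) \<in> R"
proof -
  have e: "cone_coord q w gen_point i i = - (of_nat q * gen_point i * inverse (of_nat (w i)))"
    by (simp add: cone_coord_def divide_inverse)
  show "cone_coord q w gen_point i i \<in> R"
    unfolding e by (intro gauss_uminus gauss_mult gen_point_R nat_units gauss_of_nat assms)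
  show "cone_coord q w gen_point i i \<noteq> 0" if "q > 0"
    unfolding e using that nat_units[OF assms] by simp
  show "inverse (cone_coord q w gen_point i i) \<in> R" if "\<not> t dvd int q"
  proof -
    have "inverse (cone_coord q w gen_point i i) = - (inverse (of_nat q) * inverse (gen_point i) * of_nat (w i))"
      unfolding e by simp
    then show ?thesis
      by (simp only:) (intro gauss_uminus gauss_mult gen_point_R nat_units gauss_of_nat assms that)
  qed
qed

text \<open>Replacing factors by 0 or by their negatives multiplies the product by 0 or a sign. For
  B_1 = -1/2 both changes occur: 0 in \<open>bern0_coeff\<close> and 1/2 in the boundary term of the
  reciprocity law.\<close>

lemma todd_Ints_general:
  assumes m: "m \<in> compositions N n"
    and c: "\<And>i. i \<in> {1..n} \<Longrightarrow> c i = 0 \<or> c i = bernoulli (m i) / fact (m i) \<or> c i = - (bernoulli (m i) / fact (m i))"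
  shows "of_int d * (\<Prod>i\<in>{1..n}. c i) \<in> (\<int> :: complex set)"
proof -
  define s where "s i = (if c i = 0 then 0 else if c i = bernoulli (m i) / fact (m i) then 1 else (-1::complex))" for i
  have "c i = s i * (bernoulli (m i) / fact (m i))" if "i \<in> {1..n}" for i
    using c[OF that] by (auto simp: s_def)
  then have "(\<Prod>i\<in>{1..n}. c i) = (\<Prod>i\<in>{1..n}. s i * (bernoulli (m i) / fact (m i)))"
    by (rule prod.cong[OF refl])
  then have "of_int d * (\<Prod>i\<in>{1..n}. c i) = (\<Prod>i\<in>{1..n}. s i) * (of_int d * (\<Prod>i\<in>{1..n}. bernoulli (m i) / fact (m i)))"
    by (simp only: prod.distrib mult_ac)
  moreover have "(\<Prod>i\<in>{1..n}. s i) \<in> \<int>" by (intro Ints_prod) (simp add: s_def)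
  ultimately show ?thesis using todd_Ints[OF m] by (metis Ints_mult)
qed

lemma todd_Ints_bern0_coeff:
  assumes m: "m \<in> compositions N n"
  shows "of_int d * (\<Prod>i\<in>{1..n}. bern0_coeff (m i)) \<in> (\<int> :: complex set)"
  using m by (rule todd_Ints_general) (auto simp: bern0_coeff_def)

text \<open>For odd \<open>card J\<close> the contributions of 0 and infinity cancel. For even
  \<open>card J\<close> each index in \<open>J\<close> contributes a factor 1/2 = - B_1, which is
  counted as the degree-one part of a Todd factor; this is why \<open>d\<close> clears these powers
  of 2.\<close>

lemma boundary_coeff:
  assumes J: "J \<subseteq> {1..n}"
  shows "of_int d * ((fls_X ^ n * ((1/2) ^ Suc (card J) * (1 - (-1) ^ Suc (card J)) * (\<Prod>i\<in>{1..n}-J. cayley (fls_exp (gen_point i))))) $$ int N) \<in> R"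
proof (cases "even (card J)")
  case False
  then have "(1 - (-1) ^ Suc (card J)) = (0 :: complex fls)" by simp
  then show ?thesis by (simp only: mult_zero_right mult_zero_left fls_zero_nth gauss_0)
next
  case True
  define h where "h i = (if i \<in> J then fps_const (1/2) * fps_X else Abs_fps (\<lambda>m. bern0_coeff m * gen_point i powi (int m - 1)))" for i
  have half: "fls_const (1/2 :: complex) = 1 / 2"
    by (metis fls_const_1 fls_const_divide_const fls_const_numeral)
  have fin: "finite J" using J finite_subset by blast
  have "(1/2) ^ Suc (card J) * (1 - (-1) ^ Suc (card J)) = ((1/2) ^ card J :: complex fls)"
    using True by simp
  also have "\<dots> = (\<Prod>i\<in>J. fls_const (1/2))" by (simp add: half)
  finally have "fls_X ^ n * ((1/2) ^ Suc (card J) * (1 - (-1) ^ Suc (card J)) * (\<Prod>i\<in>{1..n}-J. cayley (fls_exp (gen_point i)))) =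
     fls_X ^ n * ((\<Prod>i\<in>J. fls_const (1/2)) * (\<Prod>i\<in>{1..n}-J. cayley (fls_exp (gen_point i))))" by simp
  also have "(\<Prod>i\<in>J. fls_const (1/2)) * (\<Prod>i\<in>{1..n}-J. cayley (fls_exp (gen_point i))) =
     (\<Prod>i\<in>{1..n}. if i \<in> J then fls_const (1/2) else cayley (fls_exp (gen_point i)))"
  proof -
    have "{1..n} = J \<union> ({1..n} - J)" using J by auto
    then have "(\<Prod>i\<in>{1..n}. if i \<in> J then fls_const (1/2) else cayley (fls_exp (gen_point i))) =
      (\<Prod>i\<in>J. if i \<in> J then fls_const (1/2) else cayley (fls_exp (gen_point i))) * (\<Prod>i\<in>{1..n}-J. if i \<in> J then fls_const (1/2) else cayley (fls_exp (gen_point i)))"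
      by (metis (no_types, lifting) Diff_disjoint fin finite_Diff finite_atLeastAtMost prod.union_disjoint)
    then show ?thesis by simp
  qed
  also have "fls_X ^ n * (\<Prod>i\<in>{1..n}. if i \<in> J then fls_const (1/2) else cayley (fls_exp (gen_point i))) =
    (\<Prod>i\<in>{1..n}. fls_X * (if i \<in> J then fls_const (1/2) else cayley (fls_exp (gen_point i))))"
    by (simp only: prod.distrib prod_constant card_atLeastAtMost diff_Suc_1)
  also have "\<dots> = (\<Prod>i\<in>{1..n}. fps_to_fls (h i))"
  proof (rule prod.cong[OF refl])
    fix i
    show "fls_X * (if i \<in> J then fls_const (1/2) else cayley (fls_exp (gen_point i))) = fps_to_fls (h i)"
      using fls_X_cayley_exp_bern0_coeff[OF gen_point_neq_0, of i]
      by (simp add: h_def fls_times_fps_to_fls mult.commute)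
  qed
  also have "\<dots> = fps_to_fls (\<Prod>i\<in>{1..n}. h i)" by (simp only: fps_to_fls_prod)
  finally have eq: "fls_X ^ n * ((1/2) ^ Suc (card J) * (1 - (-1) ^ Suc (card J)) * (\<Prod>i\<in>{1..n}-J. cayley (fls_exp (gen_point i)))) =
     fps_to_fls (\<Prod>i\<in>{1..n}. h i)" .
  have "(fls_X ^ n * ((1/2) ^ Suc (card J) * (1 - (-1) ^ Suc (card J)) * (\<Prod>i\<in>{1..n}-J. cayley (fls_exp (gen_point i))))) $$ int N =
     (\<Sum>m\<in>compositions N n. \<Prod>i\<in>{1..n}. h i $ m i)"
    unfolding eq fps_prod_compositions[symmetric] by simp
  also have "of_int d * \<dots> \<in> R"
    unfolding sum_distrib_left
  proof (rule gauss_sum)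
    fix m assume m: "m \<in> compositions N n"
    define c where "c i = (if i \<in> J then if m i = 1 then 1/2 else 0 else bern0_coeff (m i) :: complex)" for i
    define p where "p i = (if i \<in> J then 1 else gen_point i powi (int (m i) - 1))" for i
    have "(\<Prod>i\<in>{1..n}. h i $ m i) = (\<Prod>i\<in>{1..n}. c i) * (\<Prod>i\<in>{1..n}. p i)"
      unfolding prod.distrib[symmetric] by (rule prod.cong) (auto simp: h_def c_def p_def)
    moreover have "of_int d * (\<Prod>i\<in>{1..n}. c i) \<in> R"
      by (rule gauss_Ints, rule todd_Ints_general[OF m]) (auto simp: c_def bern0_coeff_def bernoulli_1)
    moreover have "(\<Prod>i\<in>{1..n}. p i) \<in> R"
      by (rule gauss_prod) (auto simp: p_def gauss_1 intro!: gauss_powi gen_point_R)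
    ultimately show "of_int d * (\<Prod>i\<in>{1..n}. h i $ m i) \<in> R"
      by (metis gauss_mult mult.assoc)
  qed
  finally show ?thesis .
qed

lemma reciprocity_R:
  assumes q: "q > 0" and w: "\<And>i. i \<in> {1..n} \<Longrightarrow> w i = 0 \<or> \<not> t dvd int (w i)"
  defines "J \<equiv> {i\<in>{1..n}. w i > 0}"
  shows "(\<Sum>m\<in>compositions N n. of_int d * dedekind_coeff n q w m * (\<Prod>i\<in>{1..n}. gen_point i powi (int (m i) - 1))) +
    (\<Sum>i\<in>J. \<Sum>m\<in>compositions N n. of_int d * dedekind_coeff n (w i) (w(i := q)) m * (\<Prod>k\<in>{1..n}. cone_coord q w gen_point i k powi (int (m k) - 1))) \<in> R"
proof -
  have gen: "of_nat (w i) * gen_point k \<noteq> of_nat (w k) * gen_point i"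
    if "i \<in> {1..n}" "k \<in> {1..n}" "i \<noteq> k" "w i > 0" for i k
    using gen_point_form(3)[of "w i" i k "w k"] w[OF that(1)] that by auto
  have eq: "dedekind_fls n q w gen_point + (\<Sum>i\<in>J. dedekind_fls n (w i) (w(i := q)) (cone_coord q w gen_point i)) =
     (1/2) ^ Suc (card J) * (1 - (-1) ^ Suc (card J)) * (\<Prod>i\<in>{1..n}-J. cayley (fls_exp (gen_point i)))"
    unfolding J_def by (rule dedekind_fls_reciprocity[OF q _ gen]) auto
  have "of_int d * ((fls_X ^ n * (dedekind_fls n q w gen_point + (\<Sum>i\<in>J. dedekind_fls n (w i) (w(i := q)) (cone_coord q w gen_point i)))) $$ int N) \<in> R"
    unfolding eq by (rule boundary_coeff) (auto simp: J_def)
  also have "(fls_X ^ n * (dedekind_fls n q w gen_point + (\<Sum>i\<in>J. dedekind_fls n (w i) (w(i := q)) (cone_coord q w gen_point i)))) $$ int N =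
     (fls_X ^ n * dedekind_fls n q w gen_point) $$ int N + (\<Sum>i\<in>J. (fls_X ^ n * dedekind_fls n (w i) (w(i := q)) (cone_coord q w gen_point i)) $$ int N)"
    unfolding distrib_left sum_distrib_left fls_plus_nth fls_nth_sum ..
  also have "(fls_X ^ n * dedekind_fls n q w gen_point) $$ int N = (\<Sum>m\<in>compositions N n. dedekind_coeff n q w m * (\<Prod>i\<in>{1..n}. gen_point i powi (int (m i) - 1)))"
    by (rule dedekind_fls_coeff[OF q]) simp
  also have "(\<Sum>i\<in>J. (fls_X ^ n * dedekind_fls n (w i) (w(i := q)) (cone_coord q w gen_point i)) $$ int N) =
     (\<Sum>i\<in>J. \<Sum>m\<in>compositions N n. dedekind_coeff n (w i) (w(i := q)) m * (\<Prod>k\<in>{1..n}. cone_coord q w gen_point i k powi (int (m k) - 1)))"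
  proof (rule sum.cong[OF refl])
    fix i assume "i \<in> J"
    then have i: "w i > 0" "\<not> t dvd int (w i)" using w[of i] by (auto simp: J_def)
    show "(fls_X ^ n * dedekind_fls n (w i) (w(i := q)) (cone_coord q w gen_point i)) $$ int N =
      (\<Sum>m\<in>compositions N n. dedekind_coeff n (w i) (w(i := q)) m * (\<Prod>k\<in>{1..n}. cone_coord q w gen_point i k powi (int (m k) - 1)))"
    proof (rule dedekind_fls_coeff[OF i(1)])
      fix k
      show "cone_coord q w gen_point i k \<noteq> 0"
        using cone_coord_unit(3)[of w i k q] cone_coord_self(2)[of w i q] i q by (cases "k = i") simp_all
    qed
  qed
  finally show ?thesis by (simp add: distrib_left sum_distrib_left mult.assoc)
qed

text \<open>Multiplication by all the points turns the sum into a polynomial in \<open>Y\<close>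
  whose exponents have the m_i as digits in base N + 1, so that single coefficients can be read
  off.\<close>

lemma localization_from_R:
  assumes R: "(\<Sum>m\<in>compositions N n. c m * (\<Prod>i\<in>{1..n}. gen_point i powi (int (m i) - 1))) \<in> R"
    and rat: "\<And>m. m \<in> compositions N n \<Longrightarrow> c m \<in> \<rat>"
    and m: "m \<in> compositions N n"
  shows "c m \<in> localization t"
proof -
  define e where "e m = (\<Sum>i\<in>{1..n}. m i * Suc N ^ i)" for m :: "nat \<Rightarrow> nat"
  have bd: "m i \<le> N" if "m \<in> compositions N n" "i \<in> {1..n}" for m i
    using that member_le_sum[of i "{1..n}" m] by (simp add: compositions_def)
  have inj: "inj_on e (compositions N n)"
  proof (rule inj_onI)
    fix m m' assume mm: "m \<in> compositions N n" "m' \<in> compositions N n" "e m = e m'"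
    have "\<forall>i\<in>{1..n}. m i = m' i"
      using mm bd by (intro base_expansion_inj[of n m N m']) (auto simp: e_def)
    then show "m = m'" using mm by (intro PiE_ext[of m "{1..n}" "\<lambda>_. UNIV" m']) (auto simp: compositions_def)
  qed
  have eq: "(\<Prod>i\<in>{1..n}. gen_point i) * (\<Sum>m\<in>compositions N n. c m * (\<Prod>i\<in>{1..n}. gen_point i powi (int (m i) - 1))) =
     (\<Sum>m\<in>compositions N n. c m * Y ^ e m)"
    unfolding sum_distrib_left
  proof (rule sum.cong[OF refl])
    fix m
    have "(\<Prod>i\<in>{1..n}. gen_point i) * (\<Prod>i\<in>{1..n}. gen_point i powi (int (m i) - 1)) = (\<Prod>i\<in>{1..n}. gen_point i ^ m i)"
      unfolding prod.distrib[symmetric] by (intro prod.cong refl) (simp add: power_int_diff)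
    also have "\<dots> = Y ^ e m"
      unfolding gen_point_def e_def power_sum by (intro prod.cong refl) (simp add: power_mult[symmetric] mult.commute)
    finally show "(\<Prod>i\<in>{1..n}. gen_point i) * (c m * (\<Prod>i\<in>{1..n}. gen_point i powi (int (m i) - 1))) = c m * Y ^ e m"
      by (metis mult.left_commute)
  qed
  have "(\<Prod>i\<in>{1..n}. gen_point i) \<in> R" by (intro gauss_prod gen_point_R)
  from gauss_mult[OF this R] have "(\<Sum>m\<in>compositions N n. c m * Y ^ e m) \<in> R" by (simp only: eq)
  from localization_coeffs[OF finite_compositions inj rat this m] show ?thesis .
qed

lemma Rats_d: "of_int d * dedekind_coeff n q w m \<in> \<rat>"
  by (intro Rats_mult Rats_dedekind_coeff) simp

text \<open>A descent as in the Euclidean algorithm: the reciprocity law produces only sums of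
  orders below q and prime to t, and all coordinates that occur in them are units at t.\<close>

lemma dedekind_coeff_integral:
  assumes "q > 0" "\<not> t dvd int q" "m \<in> compositions N n"
  shows "of_int d * dedekind_coeff n q w m \<in> localization t"
  using assms
proof (induction q arbitrary: w m rule: less_induct)
  case (less q)
  \<comment> \<open>If t divides the residue r, then it does not divide q - r, because it does not
    divide q.\<close>
  define w' where "w' i = (let r = w i mod q in if r \<noteq> 0 \<and> t dvd int r then q - r else r)" for i
  have w'_lt: "w' i < q" for i
    using less.prems(1) by (auto simp: w'_def Let_def)
  have w'_t: "w' i = 0 \<or> \<not> t dvd int (w' i)" for i
  proof -
    have "\<not> t dvd int (q - r)" if "t dvd int r" "r < q" for r
    proof
      assume "t dvd int (q - r)"
      then have "t dvd int (q - r) + int r" using that by (intro dvd_add)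
      then show False using that less.prems(2) by (simp add: of_nat_diff)
    qed
    then show ?thesis using less.prems(1) by (auto simp: w'_def Let_def)
  qed
  have "[w i = w' i] (mod q) \<or> [w i + w' i = 0] (mod q)" for i
  proof -
    have "[w i + (q - w i mod q) = 0] (mod q)"
    proof -
      have "(w i + (q - w i mod q)) mod q = (w i mod q + (q - w i mod q)) mod q" by (simp add: mod_add_left_eq)
      also have "w i mod q + (q - w i mod q) = q" using less.prems(1) by (simp add: less_imp_le)
      finally show ?thesis by (simp add: cong_def)
    qed
    then show ?thesis by (auto simp: w'_def Let_def cong_def)
  qed
  then obtain s where s: "s \<in> {1,-1}" "dedekind_coeff n q w m = s * dedekind_coeff n q w' m"
    using dedekind_coeff_cong_sign[OF less.prems(1), of n w' w m]
    by (metis add.commute cong_sym)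
  have "(\<Sum>i\<in>{i\<in>{1..n}. w' i > 0}. \<Sum>m\<in>compositions N n. of_int d * dedekind_coeff n (w' i) (w'(i := q)) m * (\<Prod>k\<in>{1..n}. cone_coord q w' gen_point i k powi (int (m k) - 1))) \<in> R"
  proof (intro gauss_sum)
    fix i m assume i: "i \<in> {i\<in>{1..n}. w' i > 0}" and m: "m \<in> compositions N n"
    then have ti: "\<not> t dvd int (w' i)" using w'_t[of i] by auto
    have "of_int d * dedekind_coeff n (w' i) (w'(i := q)) m \<in> R"
      using less.IH[OF w'_lt, of i m] i ti m by (intro localization_subset_gauss) auto
    moreover have "(\<Prod>k\<in>{1..n}. cone_coord q w' gen_point i k powi (int (m k) - 1)) \<in> R"
    proof (intro gauss_prod gauss_powi)
      fix k
      show "cone_coord q w' gen_point i k \<in> R" "inverse (cone_coord q w' gen_point i k) \<in> R"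
        using cone_coord_unit(1,2)[of w' i k q] cone_coord_self(1,3)[of w' i q] ti less.prems(2)
        by (cases "k = i"; simp)+
    qed
    ultimately show "of_int d * dedekind_coeff n (w' i) (w'(i := q)) m * (\<Prod>k\<in>{1..n}. cone_coord q w' gen_point i k powi (int (m k) - 1)) \<in> R"
      by (rule gauss_mult)
  qed
  from gauss_diff[OF reciprocity_R[where w=w', OF less.prems(1) w'_t] this]
  have "(\<Sum>m\<in>compositions N n. of_int d * dedekind_coeff n q w' m * (\<Prod>i\<in>{1..n}. gen_point i powi (int (m i) - 1))) \<in> R"
    by (simp only: add_diff_cancel_right')
  then have z: "of_int d * dedekind_coeff n q w' m \<in> localization t"
    by (rule localization_from_R) (use Rats_d less.prems in auto)
  then show ?case using s localization_uminus[OF z] by auto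
qed

text \<open>All w_i are prime to t, being coprime to q, so the sums of order w_i are covered by
  \<open>dedekind_coeff_integral\<close>. Terms with m_i > 0 contain q y_i / w_i to a nonnegative
  power and are integral. For m_i = 0 the coefficient is known exactly, and partial fractions turn
  these terms into Laurent monomials.\<close>

lemma dedekind_coeff_laurent:
  assumes q: "q > 0" "t dvd int q" and w: "\<And>i. i \<in> {1..n} \<Longrightarrow> w i > 0" "\<And>i. i \<in> {1..n} \<Longrightarrow> coprime (w i) q"
    and m: "m \<in> compositions N n"
  shows "of_int d * dedekind_coeff n q w m - laurent_coeff n N d w m / of_nat q \<in> localization t"
proof -
  have tw: "\<not> t dvd int (w i)" if "i \<in> {1..n}" for i
  proof
    assume "t dvd int (w i)"
    moreover have "coprime (int (w i)) (int q)" using w(2)[OF that] by simp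
    ultimately show False using q(2) prime_t by (meson coprime_common_divisor not_prime_unit)
  qed
  define T where "T i m = of_int d * dedekind_coeff n (w i) (w(i := q)) m * (\<Prod>k\<in>{1..n}. cone_coord q w gen_point i k powi (int (m k) - 1))" for i m
  define v where "v i m = inverse (gen_point i) * (\<Prod>k\<in>{1..n}-{i}. (gen_point k - of_nat (w k) * gen_point i / of_nat (w i)) powi (int (m k) - 1))" for i m
  define b where "b m = (\<Prod>k\<in>{1..n}. bern0_coeff (m k) :: complex)" for m
  define yp where "yp m = (\<Prod>i\<in>{1..n}. gen_point i powi (int (m i) - 1))" for m
  have "{i \<in> {1..n}. 0 < w i} = {1..n}" using w by auto
  then have R1: "(\<Sum>m\<in>compositions N n. of_int d * dedekind_coeff n q w m * yp m) + (\<Sum>i\<in>{1..n}. \<Sum>m\<in>compositions N n. T i m) \<in> R"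
    using reciprocity_R[OF q(1), of w] tw by (simp only: T_def yp_def) auto
  have T0: "T i m = - (of_int d * (b m * v i m) / of_nat q)" if i: "i \<in> {1..n}" "m i = 0" for i m
  proof -
    have "(\<Prod>k\<in>{1..n}. cone_coord q w gen_point i k powi (int (m k) - 1)) =
       cone_coord q w gen_point i i powi (int (m i) - 1) * (\<Prod>k\<in>{1..n}-{i}. cone_coord q w gen_point i k powi (int (m k) - 1))"
      using i by (intro prod.remove) auto
    also have "(\<Prod>k\<in>{1..n}-{i}. cone_coord q w gen_point i k powi (int (m k) - 1)) =
       (\<Prod>k\<in>{1..n}-{i}. (gen_point k - of_nat (w k) * gen_point i / of_nat (w i)) powi (int (m k) - 1))"
      by (intro prod.cong refl) (simp add: cone_coord_def)
    also have "cone_coord q w gen_point i i powi (int (m i) - 1) = - (of_nat (w i) / of_nat q) * inverse (gen_point i)"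
      using i by (simp add: cone_coord_def power_int_minus divide_inverse)
    finally have "(\<Prod>k\<in>{1..n}. cone_coord q w gen_point i k powi (int (m k) - 1)) = - (of_nat (w i) / of_nat q) * v i m"
      by (simp only: v_def mult.assoc)
    moreover have "dedekind_coeff n (w i) (w(i := q)) m = b m / of_nat (w i)"
      unfolding b_def using i w by (intro dedekind_coeff_index_0) auto
    ultimately show ?thesis using w(1)[OF i(1)] by (simp add: T_def)
  qed
  have T1: "T i m \<in> R" if i: "i \<in> {1..n}" "m i \<noteq> 0" and m: "m \<in> compositions N n" for i m
  proof -
    have "of_int d * dedekind_coeff n (w i) (w(i := q)) m \<in> R"
      using i tw w m by (intro localization_subset_gauss dedekind_coeff_integral) auto
    moreover have "(\<Prod>k\<in>{1..n}. cone_coord q w gen_point i k powi (int (m k) - 1)) \<in> R"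
    proof (rule gauss_prod)
      fix k
      show "cone_coord q w gen_point i k powi (int (m k) - 1) \<in> R"
      proof (cases "k = i")
        case True
        have "int (m i) - 1 = int (m i - 1)" using i by simp
        then show ?thesis using cone_coord_self(1)[of w i q] tw[OF i(1)] True
          by (simp only: power_int_of_nat) (simp add: gauss_power)
      next
        case False
        then show ?thesis using cone_coord_unit(1,2)[of w i k q] tw[OF i(1)] by (intro gauss_powi) auto
      qed
    qed
    ultimately show ?thesis unfolding T_def by (rule gauss_mult)
  qed
  have "(\<Sum>i\<in>{1..n}. \<Sum>m\<in>compositions N n. if m i = 0 then 0 else T i m) \<in> R"
    by (intro gauss_sum) (auto simp: gauss_0 intro: T1)
  from gauss_diff[OF R1 this]
  have "(\<Sum>m\<in>compositions N n. of_int d * dedekind_coeff n q w m * yp m) +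
     ((\<Sum>i\<in>{1..n}. \<Sum>m\<in>compositions N n. T i m) - (\<Sum>i\<in>{1..n}. \<Sum>m\<in>compositions N n. if m i = 0 then 0 else T i m)) \<in> R"
    by (simp only: add_diff_eq)
  also have "(\<Sum>i\<in>{1..n}. \<Sum>m\<in>compositions N n. T i m) - (\<Sum>i\<in>{1..n}. \<Sum>m\<in>compositions N n. if m i = 0 then 0 else T i m) =
     (\<Sum>i\<in>{1..n}. \<Sum>m\<in>compositions N n. if m i = 0 then - (of_int d * (b m * v i m) / of_nat q) else 0)"
    unfolding sum_subtractf[symmetric] by (intro sum.cong refl) (auto simp: T0)
  also have "\<dots> = (\<Sum>m\<in>compositions N n. \<Sum>i\<in>{1..n}. if m i = 0 then - (of_int d * (b m * v i m) / of_nat q) else 0)"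
    by (rule sum.swap)
  also have "\<dots> = (\<Sum>m\<in>compositions N n. - (of_int d * (b m * (\<Sum>i | i \<in> {1..n} \<and> m i = 0. v i m)) / of_nat q))"
  proof (rule sum.cong[OF refl])
    fix m
    have "(\<Sum>i\<in>{1..n}. if m i = 0 then - (of_int d * (b m * v i m) / of_nat q) else 0) =
      (\<Sum>i\<in>{i\<in>{1..n}. m i = 0}. - (of_int d * (b m * v i m) / of_nat q))"
      by (rule sum.inter_filter[symmetric]) simp
    also have "\<dots> = - (of_int d * (b m * (\<Sum>i | i \<in> {1..n} \<and> m i = 0. v i m)) / of_nat q)"
      by (simp add: sum_negf sum_distrib_left sum_divide_distrib)
    finally show "(\<Sum>i\<in>{1..n}. if m i = 0 then - (of_int d * (b m * v i m) / of_nat q) else 0) = \<dots>" .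
  qed
  also have "\<dots> = - (of_int d * (\<Sum>m\<in>compositions N n. b m * (\<Sum>i | i \<in> {1..n} \<and> m i = 0. v i m)) / of_nat q)"
    by (simp only: sum_negf sum_distrib_left sum_divide_distrib)
  also have "(\<Sum>m\<in>compositions N n. b m * (\<Sum>i | i \<in> {1..n} \<and> m i = 0. v i m)) =
     (\<Sum>m\<in>compositions N n. b m * (yp m - (\<Sum>r\<in>compositions N n. (\<Prod>k\<in>{1..n}. laurent_binom (m k) (r k) * of_nat (w k) powi (int (m k) - int (r k))) * yp r)))"
  proof (rule sum.cong[OF refl])
    fix m assume m: "m \<in> compositions N n"
    have gen: "of_nat (w i) * gen_point k \<noteq> of_nat (w k) * gen_point i"
      if "i \<in> {1..n}" "k \<in> {1..n}" "i \<noteq> k" for i k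
      using gen_point_form(3)[of "w i" i k "w k"] tw[OF that(1)] that by auto
    show "b m * (\<Sum>i | i \<in> {1..n} \<and> m i = 0. v i m) = b m * (yp m - (\<Sum>r\<in>compositions N n. (\<Prod>k\<in>{1..n}. laurent_binom (m k) (r k) * of_nat (w k) powi (int (m k) - int (r k))) * yp r))"
      using partial_fractions_sum[where w=w and y=gen_point, OF w(1) _ gen m] by (simp only: v_def yp_def) simp
  qed
  also have "\<dots> = (\<Sum>m\<in>compositions N n. b m * yp m) - (\<Sum>m\<in>compositions N n. \<Sum>r\<in>compositions N n. b m * (\<Prod>k\<in>{1..n}. laurent_binom (m k) (r k) * of_nat (w k) powi (int (m k) - int (r k))) * yp r)"
    by (simp only: right_diff_distrib sum_subtractf sum_distrib_left mult.assoc)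
  also have "\<dots> = (\<Sum>m\<in>compositions N n. b m * yp m) - (\<Sum>r\<in>compositions N n. \<Sum>m\<in>compositions N n. b m * (\<Prod>k\<in>{1..n}. laurent_binom (m k) (r k) * of_nat (w k) powi (int (m k) - int (r k))) * yp r)"
    by (rule arg_cong2[where f = minus, OF refl sum.swap])
  also have "of_int d * \<dots> = (\<Sum>r\<in>compositions N n. laurent_coeff n N d w r * yp r)"
    unfolding laurent_coeff_def b_def
    by (simp only: left_diff_distrib right_diff_distrib sum_subtractf sum_distrib_left sum_distrib_right mult.assoc)
  also have "(\<Sum>m\<in>compositions N n. of_int d * dedekind_coeff n q w m * yp m) + - ((\<Sum>r\<in>compositions N n. laurent_coeff n N d w r * yp r) / of_nat q) =
    (\<Sum>m\<in>compositions N n. (of_int d * dedekind_coeff n q w m - laurent_coeff n N d w m / of_nat q) * yp m)"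
    by (simp add: left_diff_distrib sum_subtractf sum_divide_distrib)
  finally have "(\<Sum>m\<in>compositions N n. (of_int d * dedekind_coeff n q w m - laurent_coeff n N d w m / of_nat q) * yp m) \<in> R" .
  then show ?thesis
    unfolding yp_def by (rule localization_from_R[OF _ _ m]) (intro Rats_diff Rats_d Rats_divide Rats_laurent_coeff, simp)
qed

end

section \<open>Passage from one prime to all primes\<close>

lemma localization_add:
  assumes "prime t" "x \<in> localization t" "y \<in> localization t" shows "x + y \<in> localization t"
proof -
  obtain a b c e where ab: "\<not> t dvd b" "x = of_int a / of_int b" "\<not> t dvd e" "y = of_int c / of_int e"
    using assms(2,3) unfolding localization_def by blast
  have "b \<noteq> 0" "e \<noteq> 0" using ab by auto
  then have "x + y = of_int (a * e + c * b) / of_int (b * e)" by (simp add: ab add_frac_eq)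
  moreover have "\<not> t dvd b * e" using ab assms(1) by (simp add: prime_dvd_mult_iff)
  ultimately show ?thesis unfolding localization_def by blast
qed

lemma localization_diff: "prime t \<Longrightarrow> x \<in> localization t \<Longrightarrow> y \<in> localization t \<Longrightarrow> x - y \<in> localization t"
  using localization_add[of t x "- y"] localization_uminus[of y t] by simp

lemma localization_divide: "\<not> t dvd b \<Longrightarrow> of_int a / of_int b \<in> localization t"
  unfolding localization_def by blast

lemma prod_powi_diff:
  assumes "\<And>k. k \<in> A \<Longrightarrow> w k > 0"
  shows "(\<Prod>k\<in>A. of_nat (w k) powi (int (m k) - int (r k))) =
    of_int (\<Prod>k\<in>A. int (w k) ^ m k) / (of_int (\<Prod>k\<in>A. int (w k) ^ r k) :: complex)"
proof -
  have "(\<Prod>k\<in>A. of_nat (w k) powi (int (m k) - int (r k))) = (\<Prod>k\<in>A. of_nat (w k) ^ m k / (of_nat (w k) ^ r k :: complex))"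
    using assms by (intro prod.cong refl) (simp add: power_int_diff less_imp_neq[symmetric])
  then show ?thesis by (simp add: prod_dividef)
qed

text \<open>The assumptions of \<open>gauss_todd\<close> without a chosen prime and point, so that
  all primes can be treated in one statement.\<close>

locale todd_data =
  fixes n N :: nat and d :: int
  assumes N_pos: "N > 0"
    and todd_Ints: "\<And>m. m \<in> compositions N n \<Longrightarrow>
          of_int d * (\<Prod>i\<in>{1..n}. bernoulli (m i) / fact (m i)) \<in> (\<int> :: complex set)"
begin

lemma dedekind_coeff_zloc:
  assumes "prime t" "q > 0" "\<not> t dvd int q" "m \<in> compositions N n"
  shows "of_int d * dedekind_coeff n q w m \<in> localization t"
proof -
  obtain Y where "transcendental Y" using ex_transcendental by blast
  then interpret gauss_todd t Y n N d
    by unfold_locales (use assms N_pos todd_Ints in auto)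
  show ?thesis by (rule dedekind_coeff_integral) (use assms in auto)
qed

lemma dedekind_coeff_laurent_zloc:
  assumes "prime t" "q > 0" "t dvd int q" "\<And>i. i \<in> {1..n} \<Longrightarrow> w i > 0" "\<And>i. i \<in> {1..n} \<Longrightarrow> coprime (w i) q"
    "m \<in> compositions N n"
  shows "of_int d * dedekind_coeff n q w m - laurent_coeff n N d w m / of_nat q \<in> localization t"
proof -
  obtain Y where "transcendental Y" using ex_transcendental by blast
  then interpret gauss_todd t Y n N d
    by unfold_locales (use assms N_pos todd_Ints in auto)
  show ?thesis by (rule dedekind_coeff_laurent) (use assms in auto)
qed

text \<open>The choice is from a singleton when \<open>m\<close> has sum \<open>N\<close>, since \<open>d\<close> clears the denominators of the Todd polynomial.\<close>

definition laurent_int_coeff :: "(nat \<Rightarrow> nat) \<Rightarrow> (nat \<Rightarrow> nat) \<Rightarrow> int" where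
  "laurent_int_coeff r m = (SOME c. of_int c = - (of_int d * (\<Prod>k\<in>{1..n}. bern0_coeff (m k)) * (\<Prod>k\<in>{1..n}. laurent_binom (m k) (r k))))"

lemma of_int_laurent_int_coeff:
  assumes "m \<in> compositions N n"
  shows "of_int (laurent_int_coeff r m) = - (of_int d * (\<Prod>k\<in>{1..n}. bern0_coeff (m k)) * (\<Prod>k\<in>{1..n}. laurent_binom (m k) (r k)))"
proof -
  obtain Y where "transcendental Y" using ex_transcendental by blast
  then interpret gauss_todd 2 Y n N d
    by unfold_locales (use N_pos todd_Ints in auto)
  have "- (of_int d * (\<Prod>k\<in>{1..n}. bern0_coeff (m k)) * (\<Prod>k\<in>{1..n}. laurent_binom (m k) (r k))) \<in> \<int>"
    by (intro Ints_minus Ints_mult todd_Ints_bern0_coeff assms Ints_prod laurent_binom_Ints)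
  then obtain c where "- (of_int d * (\<Prod>k\<in>{1..n}. bern0_coeff (m k)) * (\<Prod>k\<in>{1..n}. laurent_binom (m k) (r k))) = of_int c"
    by (elim Ints_cases)
  then show ?thesis unfolding laurent_int_coeff_def by (metis (mono_tags, lifting) someI)
qed

lemma laurent_coeff_eq:
  assumes "\<And>i. i \<in> {1..n} \<Longrightarrow> w i > 0"
  shows "laurent_coeff n N d w r = of_int d * (\<Prod>k\<in>{1..n}. bern0_coeff (r k)) +
    (\<Sum>m\<in>compositions N n. of_int (laurent_int_coeff r m * (\<Prod>k\<in>{1..n}. int (w k) ^ m k))) / of_int (\<Prod>k\<in>{1..n}. int (w k) ^ r k)"
proof -
  have pd: "(\<Prod>k\<in>{1..n}. of_nat (w k) powi (int (m k) - int (r k))) =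
      of_int (\<Prod>k\<in>{1..n}. int (w k) ^ m k) / (of_int (\<Prod>k\<in>{1..n}. int (w k) ^ r k) :: complex)" for m
    using assms by (rule prod_powi_diff)
  have "of_int d * (\<Sum>m\<in>compositions N n. (\<Prod>k\<in>{1..n}. bern0_coeff (m k)) *
        (\<Prod>k\<in>{1..n}. laurent_binom (m k) (r k) * of_nat (w k) powi (int (m k) - int (r k)))) =
    (\<Sum>m\<in>compositions N n. - (of_int (laurent_int_coeff r m * (\<Prod>k\<in>{1..n}. int (w k) ^ m k)) / of_int (\<Prod>k\<in>{1..n}. int (w k) ^ r k)))"
    unfolding sum_distrib_left
  proof (rule sum.cong[OF refl])
    fix m assume m: "m \<in> compositions N n"
    show "of_int d * ((\<Prod>k\<in>{1..n}. bern0_coeff (m k)) * (\<Prod>k\<in>{1..n}. laurent_binom (m k) (r k) * of_nat (w k) powi (int (m k) - int (r k)))) =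
      - (of_int (laurent_int_coeff r m * (\<Prod>k\<in>{1..n}. int (w k) ^ m k)) / of_int (\<Prod>k\<in>{1..n}. int (w k) ^ r k))"
      unfolding prod.distrib pd of_int_mult of_int_laurent_int_coeff[OF m] by simp
  qed
  then show ?thesis
    unfolding laurent_coeff_def right_diff_distrib by (simp add: sum_negf sum_divide_distrib)
qed

text \<open>An integer version of \<open>laurent_coeff\<close>, with \<open>iv\<close> standing for
  inversion modulo l. The summand independent of \<open>w\<close> is dropped, as it cancels in
  differences.\<close>

definition laurent_mod_sum :: "(nat \<Rightarrow> int) \<Rightarrow> (nat \<Rightarrow> nat) \<Rightarrow> (nat \<Rightarrow> nat) \<Rightarrow> int" where
  "laurent_mod_sum iv r w = (\<Sum>m\<in>compositions N n. laurent_int_coeff r m * (\<Prod>k\<in>{1..n}. int (w k) ^ m k)) * (\<Prod>k\<in>{1..n}. iv (w k) ^ r k)"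

text \<open>Integrality is checked prime by prime. For a prime not dividing q, each term is
  integral. For a prime other than l dividing q, the congruence modulo m makes the difference of the
  Laurent polynomials divisible by m. At l itself, 1/(l m) may be replaced by c/l, since c m is 1
  modulo l.\<close>

lemma dedekind_coeff_diff_Ints:
  fixes l m :: nat and c :: int
  assumes l: "prime l" and lm: "\<not> l dvd m" "m > 0" and q: "q = l * m"
    and w: "\<And>i. i \<in> {1..n} \<Longrightarrow> w i > 0" "\<And>i. i \<in> {1..n} \<Longrightarrow> coprime (w i) q"
    and w': "\<And>i. i \<in> {1..n} \<Longrightarrow> w' i > 0" "\<And>i. i \<in> {1..n} \<Longrightarrow> coprime (w' i) q"
    and cong: "\<And>i. i \<in> {1..n} \<Longrightarrow> [w i = w' i] (mod m)"
    and iv: "\<And>a. \<not> l dvd a \<Longrightarrow> [int a * iv a = 1] (mod (int l))"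
    and c: "[c * int m = 1] (mod (int l))"
    and r: "r \<in> compositions N n"
  shows "of_int d * dedekind_coeff n q w r - of_int d * dedekind_coeff n q w' r
     - of_int (c * (laurent_mod_sum iv r w - laurent_mod_sum iv r w')) / of_nat l \<in> \<int>"
proof (rule localization_all_imp_Ints)
  define P where "P w m = (\<Prod>k\<in>{1..n}. int (w k) ^ m k)" for w m :: "nat \<Rightarrow> nat"
  define S where "S w = (\<Sum>m\<in>compositions N n. laurent_int_coeff r m * P w m)" for w
  define H where "H = laurent_mod_sum iv r"
  define X where "X = S w * P w' r - S w' * P w r"
  define U where "U = P w r * P w' r"
  let ?e = "of_int d * dedekind_coeff n q w r - of_int d * dedekind_coeff n q w' r
     - of_int (c * (H w - H w')) / of_nat l"
  show "of_int d * dedekind_coeff n q w r - of_int d * dedekind_coeff n q w' r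
     - of_int (c * (laurent_mod_sum iv r w - laurent_mod_sum iv r w')) / of_nat l \<in> \<rat>"
    by (intro Rats_diff Rats_mult Rats_dedekind_coeff Rats_divide) simp_all
  fix t :: int assume t: "prime t"
  have q0: "q > 0" using q l lm prime_gt_0_nat by simp
  have tP: "\<not> t dvd P v r" if "t dvd int q" "\<And>i. i \<in> {1..n} \<Longrightarrow> coprime (v i) q" for v
  proof
    assume "t dvd P v r"
    then obtain k where k: "k \<in> {1..n}" "t dvd int (v k) ^ r k"
      unfolding P_def using t by (auto simp: prime_dvd_prod_iff)
    then have "t dvd int (v k)" using t prime_dvd_power by blast
    moreover have "coprime (int (v k)) (int q)" using that(2)[OF k(1)] by simp
    ultimately show False using that(1) t by (meson coprime_common_divisor not_prime_unit)
  qed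
  have tl: "t = int l" if "t dvd int l"
    using that t l by (metis prime_nat_int_transfer primes_dvd_imp_eq)
  show "of_int d * dedekind_coeff n q w r - of_int d * dedekind_coeff n q w' r
     - of_int (c * (laurent_mod_sum iv r w - laurent_mod_sum iv r w')) / of_nat l \<in> localization t"
    unfolding H_def[symmetric]
  proof (cases "t dvd int q")
    case False
    then have "\<not> t dvd int l" using q by auto
    then have "of_int (c * (H w - H w')) / of_int (int l) \<in> localization t" by (rule localization_divide)
    then show "?e \<in> localization t"
      using False by (intro localization_diff t dedekind_coeff_zloc q0 r) auto
  next
    case True
    define A where "A v = of_int d * dedekind_coeff n q v r" for v
    define L where "L v = laurent_coeff n N d v r" for v
    have A: "A w - L w / of_nat q \<in> localization t" "A w' - L w' / of_nat q \<in> localization t"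
      unfolding A_def L_def
      using dedekind_coeff_laurent_zloc[where w=w, OF t q0 True w r]
        dedekind_coeff_laurent_zloc[where w=w', OF t q0 True w' r] by blast+
    have P0: "P v r \<noteq> 0" if "\<And>i. i \<in> {1..n} \<Longrightarrow> v i > 0" for v
      unfolding P_def using that by (force simp: prod_zero_iff)
    have reduced_tuples: "P w r \<noteq> 0" "P w' r \<noteq> 0" by (rule P0, rule w, assumption) (rule P0, rule w', assumption)
    have L: "L v = of_int d * (\<Prod>k\<in>{1..n}. bern0_coeff (r k)) + of_int (S v) / of_int (P v r)"
      if "\<And>i. i \<in> {1..n} \<Longrightarrow> v i > 0" for v
      unfolding L_def S_def P_def of_int_sum using that by (rule laurent_coeff_eq)
    have LL: "L w - L w' = of_int X / of_int U"
    proof -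
      have "L w = of_int d * (\<Prod>k\<in>{1..n}. bern0_coeff (r k)) + of_int (S w) / of_int (P w r)"
        "L w' = of_int d * (\<Prod>k\<in>{1..n}. bern0_coeff (r k)) + of_int (S w') / of_int (P w' r)"
        using w(1) w'(1) by (intro L; blast)+
      then show ?thesis unfolding X_def U_def using reduced_tuples by (simp add: diff_frac_eq)
    qed
    have tU: "\<not> t dvd U" unfolding U_def using tP[of w] tP[of w'] True w(2) w'(2) t
      by (simp add: prime_dvd_mult_iff)
    then have U0: "U \<noteq> 0" by auto
    have "L w / of_nat q - L w' / of_nat q - of_int (c * (H w - H w')) / of_nat l \<in> localization t"
    proof (cases "t = int l")
      case False
      then have tl': "\<not> t dvd int l" using tl by blast
      have "[P w m' = P w' m'] (mod (int m))" for m'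
        unfolding P_def using cong by (intro cong_prod cong_pow) (simp add: cong_int_iff)
      then have "[X = 0] (mod (int m))"
      proof -
        assume cc: "\<And>m'. [P w m' = P w' m'] (mod (int m))"
        have "[S w = S w'] (mod (int m))"
          unfolding S_def by (intro cong_sum cong_mult cong_refl cc)
        then have "[S w * P w' r = S w' * P w r] (mod (int m))"
          using cc[of r] by (intro cong_mult) (auto intro: cong_sym)
        then show ?thesis unfolding X_def by (simp add: cong_diff_iff_cong_0)
      qed
      then obtain x where x: "X = int m * x" by (auto simp: cong_0_iff)
      have "L w / of_nat q - L w' / of_nat q = (L w - L w') / of_nat q" by (simp add: diff_divide_distrib)
      also have "\<dots> = of_int x / of_int (int l * U)"
        unfolding LL x q using lm U0 by simp
      finally have "L w / of_nat q - L w' / of_nat q = \<dots>" .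
      moreover have "\<not> t dvd int l * U" using tl' tU t by (simp add: prime_dvd_mult_iff)
      ultimately have z1: "L w / of_nat q - L w' / of_nat q \<in> localization t" using localization_divide by metis
      have "of_int (c * (H w - H w')) / of_int (int l) \<in> localization t" using tl' by (rule localization_divide)
      from localization_diff[OF t z1 this] show ?thesis by (simp only: of_int_of_nat_eq)
    next
      case True
      have key: "[P v r * H v = S v] (mod (int l))" if v: "\<And>i. i \<in> {1..n} \<Longrightarrow> coprime (v i) q" for v
      proof -
        have "[(\<Prod>k\<in>{1..n}. (int (v k) * iv (v k)) ^ r k) = (\<Prod>k\<in>{1..n}. 1 ^ r k)] (mod (int l))"
        proof (intro cong_prod cong_pow iv)
          fix k assume "k \<in> {1..n}"
          then have "coprime (v k) l" using v[of k] q by simp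
          then show "\<not> l dvd v k" using l by (metis coprime_absorb_right not_prime_unit)
        qed
        then have "[(\<Prod>k\<in>{1..n}. (int (v k) * iv (v k)) ^ r k) * S v = 1 * S v] (mod (int l))"
          by (intro cong_mult cong_refl) simp
        moreover have "P v r * H v = (\<Prod>k\<in>{1..n}. (int (v k) * iv (v k)) ^ r k) * S v"
          unfolding P_def H_def laurent_mod_sum_def S_def power_mult_distrib prod.distrib by (simp only: mult_ac)
        ultimately show ?thesis by simp
      qed
      have "[c * int m * (P w' r * (P w r * H w) - P w r * (P w' r * H w')) = 1 * (P w' r * S w - P w r * S w')] (mod (int l))"
        by (intro cong_mult c cong_diff cong_refl key w w')
      then have "int l dvd (P w' r * S w - P w r * S w') - c * int m * (P w' r * (P w r * H w) - P w r * (P w' r * H w'))"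
        by (simp add: cong_iff_dvd_diff dvd_diff_commute)
      also have "(P w' r * S w - P w r * S w') - c * int m * (P w' r * (P w r * H w) - P w r * (P w' r * H w')) = X - int m * U * (c * (H w - H w'))"
        unfolding X_def U_def by (simp add: algebra_simps)
      finally obtain x where x: "X - int m * U * (c * (H w - H w')) = int l * x" by (elim dvdE)
      have l0: "l > 0" using l prime_gt_0_nat by blast
      have X: "(of_int X :: complex) = of_nat l * of_int x + of_nat m * of_int U * of_int (c * (H w - H w'))"
      proof -
        have "X = int l * x + int m * U * (c * (H w - H w'))" using x by linarith
        then show ?thesis by (simp only: of_int_add of_int_mult of_int_of_nat_eq)
      qed
      have "L w / of_nat q - L w' / of_nat q - of_int (c * (H w - H w')) / of_nat l =
        (of_int X / of_int U) / of_nat q - of_int (c * (H w - H w')) / of_nat l"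
        by (simp add: LL[symmetric] diff_divide_distrib)
      also have "\<dots> = of_int x / of_int (int m * U)"
        unfolding X q using lm l0 U0 by (simp add: field_simps)
      finally have "L w / of_nat q - L w' / of_nat q - of_int (c * (H w - H w')) / of_nat l = \<dots>" .
      moreover have "\<not> t dvd int m" using lm True by simp
      then have "\<not> t dvd int m * U" using tU t by (simp add: prime_dvd_mult_iff)
      ultimately show ?thesis using localization_divide by metis
    qed
    from localization_add[OF t localization_diff[OF t A] this]
    show "?e \<in> localization t" by (simp add: A_def algebra_simps)
  qed
qed

end

subsection \<open>Prime divisors and reduced residues\<close>

text \<open>Lagrange's bound by splitting off roots; division by a monic linear factor keeps the top
  coefficient, so the hypothesis on it persists.\<close>

lemma card_roots_mod_prime_le:
  fixes p :: int and Q :: "int poly"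
  assumes p: "prime p" and "degree Q \<le> D" "\<not> p dvd coeff Q D"
  shows "card {z \<in> {0..<p}. p dvd poly Q z} \<le> D"
  using assms(2,3)
proof (induction D arbitrary: Q)
  case 0
  then have "Q = [:coeff Q 0:]" by (metis degree_eq_zeroE le_zero_eq coeff_pCons_0)
  then have "poly Q z = coeff Q 0" for z by (metis poly_const_conv poly_0_coeff_0 poly_pCons mult_zero_right poly_0 add.right_neutral)
  then show ?case using 0 by simp
next
  case (Suc D)
  show ?case
  proof (cases "\<exists>a\<in>{0..<p}. p dvd poly Q a")
    case False
    then have "{z \<in> {0..<p}. p dvd poly Q z} = {}" by auto
    then show ?thesis by (simp only: card.empty)
  next
    case True
    then obtain a where a: "a \<in> {0..<p}" "p dvd poly Q a" by auto
    define S where "S = synthetic_div Q a"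
    have QS: "Q = [:- a, 1:] * S + [:poly Q a:]" unfolding S_def by (rule synthetic_div_correct'[symmetric])
    have dS: "degree S \<le> D" using Suc.prems(1) by (simp add: S_def degree_synthetic_div)
    have "coeff Q (Suc D) = coeff ([:- a, 1:] * S + [:poly Q a:]) (Suc D)" using QS by simp
    also have "\<dots> = coeff S D" using dS by (simp add: coeff_eq_0)
    finally have "\<not> p dvd coeff S D" using Suc.prems(2) by simp
    then have IH: "card {z \<in> {0..<p}. p dvd poly S z} \<le> D" using dS Suc.IH by blast
    have "{z \<in> {0..<p}. p dvd poly Q z} \<subseteq> insert a {z \<in> {0..<p}. p dvd poly S z}"
    proof
      fix z assume "z \<in> {z \<in> {0..<p}. p dvd poly Q z}"
      then have z: "z \<in> {0..<p}" "p dvd poly Q z" by auto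
      have "poly Q z = poly ([:- a, 1:] * S + [:poly Q a:]) z" using QS by simp
      then have "poly Q z = (z - a) * poly S z + poly Q a" by (simp add: algebra_simps)
      then have "p dvd (z - a) * poly S z" using z(2) a(2) by (metis dvd_add_left_iff)
      then have "p dvd z - a \<or> p dvd poly S z" using p by (simp add: prime_dvd_mult_iff)
      moreover have "z = a" if "p dvd z - a"
        using that z(1) a(1) zdvd_imp_le[of p "z - a"] zdvd_imp_le[of p "a - z"] dvd_diff_commute[of p z a]
        by (cases "z > a"; cases "z < a") auto
      ultimately show "z \<in> insert a {z \<in> {0..<p}. p dvd poly S z}" using z(1) by auto
    qed
    moreover have "finite (insert a {z \<in> {0..<p}. p dvd poly S z})"
      by (intro finite.insertI, rule finite_subset[of _ "{0..<p}"]) auto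
    ultimately have "card {z \<in> {0..<p}. p dvd poly Q z} \<le> card (insert a {z \<in> {0..<p}. p dvd poly S z})"
      by (intro card_mono)
    also have "\<dots> \<le> Suc (card {z \<in> {0..<p}. p dvd poly S z})"
      by (rule card_insert_le_m1) auto
    also have "\<dots> \<le> Suc D" using IH by (simp only: Suc_le_mono)
    finally show ?thesis .
  qed
qed

section \<open>Divergence of the sum of prime reciprocals\<close>

lemma card_multiples: 
  fixes d :: nat assumes "d > 0"
  shows "card {q \<in> {1..X}. d dvd q} = X div d"
proof -
  have "{q \<in> {1..X}. d dvd q} = (\<lambda>j. d * j) ` {1..X div d}"
  proof (intro equalityI subsetI)
    fix q assume "q \<in> {q \<in> {1..X}. d dvd q}"
    then obtain j where "q = d * j" "d * j \<ge> 1" "d * j \<le> X" by (auto elim!: dvdE)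
    moreover then have "j \<ge> 1" by (cases j) auto
    moreover have "j \<le> X div d" using assms \<open>d * j \<le> X\<close> by (simp add: less_eq_div_iff_mult_less_eq mult.commute)
    ultimately show "q \<in> (\<lambda>j. d * j) ` {1..X div d}" by auto
  next
    fix q assume "q \<in> (\<lambda>j. d * j) ` {1..X div d}"
    then obtain j where j0: "q = d * j" "j \<in> {1..X div d}" by (rule imageE)
    then have j: "q = d * j" "1 \<le> j" "j \<le> X div d" by auto
    then have "d * j \<le> X" using assms by (simp add: less_eq_div_iff_mult_less_eq mult.commute)
    then show "q \<in> {q \<in> {1..X}. d dvd q}" using j assms by auto
  qed
  moreover have "inj_on (\<lambda>j. d * j) {1..X div d}" using assms by (auto simp: inj_on_def)
  ultimately show ?thesis by (simp add: card_image)
qed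

text \<open>
  Erdos' argument: if the tail of the sum over \<open>1 / p\<close> were below \<open>1/2\<close>, then at least half of the
  integers up to \<open>X\<close> would be of the form \<open>a b\<^sup>2\<close> with \<open>a\<close> a product of distinct small primes.
\<close>

lemma prime_reciprocals_tail:
  fixes y :: nat
  shows "\<exists>W. finite W \<and> (\<forall>l\<in>W. prime l \<and> l > y) \<and> (\<Sum>l\<in>W. 1 / real l) > 1/2"
proof (rule ccontr)
  assume no: "\<not> ?thesis"
  have H: "(\<Sum>l\<in>W. 1 / real l) \<le> 1/2" if "finite W" "\<forall>l\<in>W. prime l \<and> l > y" for W
    using no that not_le by blast
  \<comment> \<open>\<open>C\<close> counts the subsets of \<open>{..y}\<close>, hence bounds the
    number of squarefree parts. \<open>X\<close> is the square for which C (2 C + 2), the resulting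
    bound for the numbers a b^2, is just below X/2.\<close>
  define C where "C = (2::nat) ^ Suc y"
  define X where "X = (2 * C + 1) ^ 2"
  define A where "A = {m \<in> {1..X}. \<forall>p. prime p \<longrightarrow> p dvd m \<longrightarrow> p \<le> y}"
  define W where "W = {p \<in> {1..X}. prime p \<and> p > y}"
  have "{1..X} \<subseteq> A \<union> (\<Union>p\<in>W. {m \<in> {1..X}. p dvd m})"
  proof
    fix m assume m: "m \<in> {1..X}"
    show "m \<in> A \<union> (\<Union>p\<in>W. {m \<in> {1..X}. p dvd m})"
    proof (cases "m \<in> A")
      case False
      then obtain p where p: "prime p" "p dvd m" "p > y" using m by (auto simp: A_def not_le)
      then have "p \<le> X" using m dvd_imp_le[of p m] by auto
      then have "p \<in> W" using p prime_gt_0_nat[of p] by (auto simp: W_def)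
      then show ?thesis using m p by blast
    qed simp
  qed
  then have "card {1..X} \<le> card (A \<union> (\<Union>p\<in>W. {m \<in> {1..X}. p dvd m}))"
    by (rule card_mono[rotated]) (auto simp: A_def W_def)
  also have "\<dots> \<le> card A + card (\<Union>p\<in>W. {m \<in> {1..X}. p dvd m})" by (rule card_Un_le)
  also have "card (\<Union>p\<in>W. {m \<in> {1..X}. p dvd m}) \<le> (\<Sum>p\<in>W. card {m \<in> {1..X}. p dvd m})"
    by (rule card_UN_le) (simp add: W_def)
  also have "(\<Sum>p\<in>W. card {m \<in> {1..X}. p dvd m}) = (\<Sum>p\<in>W. X div p)"
    by (intro sum.cong refl card_multiples) (auto simp: W_def)
  finally have 1: "X \<le> card A + (\<Sum>p\<in>W. X div p)" by simp
  have "real (\<Sum>p\<in>W. X div p) \<le> (\<Sum>p\<in>W. real X * (1 / real p))"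
    unfolding of_nat_sum by (intro sum_mono) (simp add: of_nat_div_le_of_nat)
  also have "\<dots> = real X * (\<Sum>p\<in>W. 1 / real p)" by (simp only: sum_distrib_left)
  also have "\<dots> \<le> real X * (1/2)" by (intro mult_left_mono H) (auto simp: W_def)
  finally have 2: "real (\<Sum>p\<in>W. X div p) \<le> real X / 2" by simp
  have "card A \<le> card (Pow {..y} \<times> {..2 * C + 1})"
  proof (rule card_inj_on_le)
    let ?f = "\<lambda>m::nat. (prime_factors (squarefree_part m), square_part m)"
    show "inj_on ?f A"
    proof (rule inj_onI)
      fix a b assume ab: "a \<in> A" "b \<in> A" "?f a = ?f b"
      have sq: "squarefree_part m = \<Prod>(prime_factors (squarefree_part m))" if "m \<in> A" for m
      proof -
        have "squarefree (squarefree_part m)" by simp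
        then have "multiplicity p (squarefree_part m) = 1" if "p \<in> prime_factors (squarefree_part m)" for p
          using that by (subst (asm) squarefree_factorial_semiring'') (auto simp: prime_factors_multiplicity)
        then have "(\<Prod>p\<in>prime_factors (squarefree_part m). p ^ multiplicity p (squarefree_part m)) = \<Prod>(prime_factors (squarefree_part m))"
          by (intro prod.cong) auto
        moreover have "m \<noteq> 0" using that by (auto simp: A_def)
        then have "squarefree_part m \<noteq> 0" by simp
        ultimately show ?thesis by (metis prod_prime_factors normalize_nat_def id_apply)
      qed
      have "a = squarefree_part a * square_part a ^ 2" "b = squarefree_part b * square_part b ^ 2"
        by (rule squarefree_decompose)+
      moreover have "squarefree_part a = squarefree_part b"
        using sq[OF ab(1)] sq[OF ab(2)] ab(3) by simp
      ultimately show "a = b" using ab(3) by simp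
    qed
    show "?f ` A \<subseteq> Pow {..y} \<times> {..2 * C + 1}"
    proof
      fix z assume "z \<in> ?f ` A"
      then obtain m where m: "m \<in> A" "z = ?f m" by auto
      have dec: "m = squarefree_part m * square_part m ^ 2" by (rule squarefree_decompose)
      have pf: "prime_factors (squarefree_part m) \<subseteq> {..y}"
      proof
        fix p assume "p \<in> prime_factors (squarefree_part m)"
        then have "prime p" "p dvd squarefree_part m" by auto
        then have "p dvd m" using dvdI[OF dec] dvd_trans by blast
        then show "p \<in> {..y}" using m(1) \<open>prime p\<close> by (auto simp: A_def)
      qed
      have "square_part m ^ 2 \<le> m"
      proof (rule dvd_imp_le)
        show "square_part m ^ 2 dvd m" by (rule dvdI[OF dec[unfolded mult.commute[of "squarefree_part m"]]])
        show "m > 0" using m(1) by (simp add: A_def)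
      qed
      moreover have "m \<le> (2 * C + 1) ^ 2" using m(1) by (auto simp: A_def X_def)
      ultimately have "square_part m ^ 2 \<le> (2 * C + 1) ^ 2" by (rule order_trans)
      then have "square_part m \<le> 2 * C + 1" by (rule power2_le_imp_le) simp
      with pf show "z \<in> Pow {..y} \<times> {..2 * C + 1}" using m(2) by auto
    qed
  qed simp
  also have "\<dots> = C * (2 * C + 2)" by (simp add: card_cartesian_product card_Pow C_def)
  finally have "card A \<le> C * (2 * C + 2)" .
  then have "real (card A) \<le> real (C * (2 * C + 2))" by (simp only: of_nat_le_iff)
  then have 3: "real (card A) \<le> real C * (2 * real C + 2)" by (simp add: algebra_simps)
  have "real X \<le> real C * (2 * real C + 2) + real X / 2" using 1 2 3 by linarith
  moreover have "real X = (2 * real C + 1) ^ 2" by (simp add: X_def)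
  ultimately have "(2 * real C + 1) ^ 2 \<le> 2 * (real C * (2 * real C + 2))" by simp
  then show False by (simp add: power2_eq_square algebra_simps)
qed

lemma prime_reciprocals_unbounded:
  fixes y k :: nat
  shows "\<exists>W. finite W \<and> (\<forall>l\<in>W. prime l \<and> l > y) \<and> (\<Sum>l\<in>W. 1 / real l) \<ge> real k / 2"
proof (induction k)
  case 0
  show ?case by (rule exI[of _ "{}"]) simp
next
  case (Suc k)
  then obtain W where W: "finite W" "\<forall>l\<in>W. prime l \<and> l > y" "(\<Sum>l\<in>W. 1 / real l) \<ge> real k / 2" by blast
  obtain V where V: "finite V" "\<forall>l\<in>V. prime l \<and> l > max y (Max (insert 0 W))" "(\<Sum>l\<in>V. 1 / real l) > 1/2"
    using prime_reciprocals_tail by blast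
  have "W \<inter> V = {}"
  proof -
    have "l \<le> Max (insert 0 W)" if "l \<in> W" for l using W(1) that by simp
    moreover have "l > Max (insert 0 W)" if "l \<in> V" for l using V(2) that by simp
    ultimately show ?thesis by (meson disjoint_iff leD)
  qed
  then have "(\<Sum>l\<in>W \<union> V. 1 / real l) = (\<Sum>l\<in>W. 1 / real l) + (\<Sum>l\<in>V. 1 / real l)"
    using W V by (intro sum.union_disjoint)
  then show ?case using W V by (intro exI[of _ "W \<union> V"]) auto
qed

text \<open>Terms are at most 1, so adding them one by one cannot jump over an interval of length 1.
  The lower bound makes exceptional integers rare; the upper one controls the sum of
  l^(-3/2).\<close>

lemma prime_reciprocals_window:
  fixes y k :: nat
  shows "\<exists>W. finite W \<and> (\<forall>l\<in>W. prime l \<and> l > y) \<and> (\<Sum>l\<in>W. 1 / real l) \<ge> real k \<and> (\<Sum>l\<in>W. 1 / real l) \<le> real k + 1"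
proof -
  obtain W where W: "finite W" "\<forall>l\<in>W. prime l \<and> l > y" "(\<Sum>l\<in>W. 1 / real l) \<ge> real (2 * k) / 2"
    using prime_reciprocals_unbounded[where y = y and k = "2 * k"] by metis
  have "\<exists>V\<subseteq>W. (\<Sum>l\<in>V. 1 / real l) \<ge> real k \<and> (\<Sum>l\<in>V. 1 / real l) \<le> real k + 1"
    using W(1,3)
  proof (induction W)
    case empty
    then show ?case by (intro exI[of _ "{}"]) simp
  next
    case (insert a W)
    show ?case
    proof (cases "(\<Sum>l\<in>W. 1 / real l) \<ge> real k")
      case True
      then obtain V where "V \<subseteq> W" "(\<Sum>l\<in>V. 1 / real l) \<ge> real k" "(\<Sum>l\<in>V. 1 / real l) \<le> real k + 1"
        using insert.IH by auto
      then show ?thesis by blast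
    next
      case False
      have "1 / real a \<le> 1" by (cases "a = 0") auto
      then have "(\<Sum>l\<in>insert a W. 1 / real l) \<le> real k + 1" using False insert.hyps by simp
      then show ?thesis using insert.prems by (intro exI[of _ "insert a W"]) simp
    qed
  qed
  then obtain V where "V \<subseteq> W" "(\<Sum>l\<in>V. 1 / real l) \<ge> real k" "(\<Sum>l\<in>V. 1 / real l) \<le> real k + 1"
    by blast
  then show ?thesis using W(1,2) finite_subset[of V W] by (intro exI[of _ V]) blast
qed

section \<open>Density of integers without an exact divisor in a window\<close>

definition exactly_dvd :: "nat \<Rightarrow> nat \<Rightarrow> bool" where
  "exactly_dvd l q \<longleftrightarrow> l dvd q \<and> \<not> l ^ 2 dvd q"

lemma card_periodic_Int:
  fixes A B :: "nat set"
  assumes A: "\<And>x. x \<in> A \<longleftrightarrow> x mod a \<in> A" and B: "\<And>x. x \<in> B \<longleftrightarrow> x mod b \<in> B"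
    and ab: "coprime a b" "a > 0" "b > 0"
  shows "card (A \<inter> B \<inter> {..<a * b}) = card (A \<inter> {..<a}) * card (B \<inter> {..<b})"
proof -
  have "bij_betw (\<lambda>x. (x mod a, x mod b)) (A \<inter> B \<inter> {..<a * b}) ((A \<inter> {..<a}) \<times> (B \<inter> {..<b}))"
  proof (rule bij_betwI')
    fix x y assume "x \<in> A \<inter> B \<inter> {..<a * b}" "y \<in> A \<inter> B \<inter> {..<a * b}"
    moreover have "x = y" if "x < a * b" "y < a * b" "[x = y] (mod a)" "[x = y] (mod b)"
      using that binary_chinese_remainder_unique_nat[OF ab(1), of y y] ab by (metis cong_refl less_irrefl)
    ultimately show "((x mod a, x mod b) = (y mod a, y mod b)) = (x = y)" by (auto simp: cong_def)
  next
    fix x assume "x \<in> A \<inter> B \<inter> {..<a * b}"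
    then show "(x mod a, x mod b) \<in> (A \<inter> {..<a}) \<times> (B \<inter> {..<b})" using A B ab by auto
  next
    fix z assume "z \<in> (A \<inter> {..<a}) \<times> (B \<inter> {..<b})"
    then obtain u v where z: "z = (u, v)" "u \<in> A" "u < a" "v \<in> B" "v < b" by auto
    obtain x where x: "x < a * b" "[x = u] (mod a)" "[x = v] (mod b)"
      using binary_chinese_remainder_unique_nat[OF ab(1), of u v] ab by auto
    then have "x mod a = u" "x mod b = v" using z by (auto simp: cong_def)
    then show "\<exists>x\<in>A \<inter> B \<inter> {..<a * b}. z = (x mod a, x mod b)"
      using z x A[of x] B[of x] by (intro bexI[of _ x]) auto
  qed
  then show ?thesis using bij_betw_same_card by (fastforce simp: card_cartesian_product)
qed

lemma exactly_dvd_mod: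
  assumes "l ^ 2 dvd Q" shows "exactly_dvd l (x mod Q) \<longleftrightarrow> exactly_dvd l x"
proof -
  have "l dvd Q" using assms by (metis dvd_trans dvd_triv_left power2_eq_square)
  then show ?thesis using assms by (simp add: exactly_dvd_def dvd_mod_iff)
qed

lemma card_not_exactly_dvd:
  assumes "l > 1"
  shows "card ({q. \<not> exactly_dvd l q} \<inter> {..<l ^ 2}) = l ^ 2 - (l - 1)"
proof -
  have "{q. exactly_dvd l q} \<inter> {..<l ^ 2} = (\<lambda>j. l * j) ` {1..<l}"
  proof (intro equalityI subsetI)
    fix q assume "q \<in> {q. exactly_dvd l q} \<inter> {..<l ^ 2}"
    then obtain j where j: "q = l * j" "l * j < l * l" "\<not> l ^ 2 dvd l * j"
      by (auto simp: exactly_dvd_def power2_eq_square elim!: dvdE)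
    then have "j < l" "j \<noteq> 0" by (auto intro!: Nat.gr0I)
    then show "q \<in> (\<lambda>j. l * j) ` {1..<l}" using j by auto
  next
    fix q assume "q \<in> (\<lambda>j. l * j) ` {1..<l}"
    then obtain j where j: "q = l * j" "1 \<le> j" "j < l" by auto
    have "\<not> l * l dvd l * j" using j assms by (auto dest: dvd_imp_le)
    then show "q \<in> {q. exactly_dvd l q} \<inter> {..<l ^ 2}" using j assms
      by (auto simp: exactly_dvd_def power2_eq_square)
  qed
  then have "card ({q. exactly_dvd l q} \<inter> {..<l ^ 2}) = l - 1"
    using assms by (simp add: card_image inj_on_def)
  moreover have "{q. \<not> exactly_dvd l q} \<inter> {..<l ^ 2} = {..<l ^ 2} - ({q. exactly_dvd l q} \<inter> {..<l ^ 2})" by auto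
  ultimately show ?thesis by (simp add: card_Diff_subset)
qed

text \<open>By the Chinese remainder theorem the conditions for different l are independent modulo
  the product of the l^2. The local proportion 1 - (l - 1)/l^2 is at most 1 - 1/(2 l), because l
  \<ge> 2.\<close>

lemma density_not_exactly_dvd:
  fixes W :: "nat set"
  assumes "finite W" "\<And>l. l \<in> W \<Longrightarrow> prime l"
  shows "real (card ({q. \<forall>l\<in>W. \<not> exactly_dvd l q} \<inter> {..<(\<Prod>l\<in>W. l ^ 2)})) \<le> (\<Prod>l\<in>W. real l ^ 2 * (1 - 1 / (2 * real l)))"
  using assms
proof (induction W)
  case empty
  then show ?case by (simp add: lessThan_Suc)
next
  case (insert l W)
  define A where "A = {q. \<forall>l\<in>W. \<not> exactly_dvd l q}"
  define Q where "Q = (\<Prod>l\<in>W. l ^ 2)"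
  have l: "prime l" "l \<ge> 2" using insert.prems prime_ge_2_nat by auto
  have Q0: "Q > 0" unfolding Q_def using insert.prems prime_gt_0_nat by (intro prod_pos) auto
  have cop: "coprime (l ^ 2) Q"
    unfolding Q_def using insert.prems insert.hyps
  proof (intro prod_coprime_right)
    fix k assume "k \<in> W"
    then have "coprime l k" using insert.prems insert.hyps by (intro primes_coprime) auto
    then show "coprime (l ^ 2) (k ^ 2)" by simp
  qed
  have perA: "x \<in> A \<longleftrightarrow> x mod Q \<in> A" for x
  proof -
    have "k ^ 2 dvd Q" if "k \<in> W" for k unfolding Q_def using that insert.hyps by (intro dvd_prodI)
    then show ?thesis unfolding A_def using exactly_dvd_mod by auto
  qed
  have "{q. \<forall>k\<in>insert l W. \<not> exactly_dvd k q} \<inter> {..<(\<Prod>k\<in>insert l W. k ^ 2)} = {q. \<not> exactly_dvd l q} \<inter> A \<inter> {..<l ^ 2 * Q}"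
    using insert.hyps by (auto simp: A_def Q_def)
  then have "card ({q. \<forall>k\<in>insert l W. \<not> exactly_dvd k q} \<inter> {..<(\<Prod>k\<in>insert l W. k ^ 2)}) = (l ^ 2 - (l - 1)) * card (A \<inter> {..<Q})"
    using card_periodic_Int[of "{q. \<not> exactly_dvd l q}" "l ^ 2" A Q] perA cop Q0 l exactly_dvd_mod[of l "l ^ 2"]
    by (simp add: card_not_exactly_dvd)
  also have "real \<dots> \<le> (real l ^ 2 * (1 - 1 / (2 * real l))) * (\<Prod>l\<in>W. real l ^ 2 * (1 - 1 / (2 * real l)))"
    unfolding of_nat_mult
  proof (rule mult_mono)
    have "l \<le> l ^ 2" by (simp add: power2_eq_square)
    then have "real (l ^ 2 - (l - 1)) = real l ^ 2 - (real l - 1)" using l by (simp add: of_nat_diff)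
    also have "\<dots> \<le> real l ^ 2 * (1 - 1 / (2 * real l))" using l by (simp add: power2_eq_square field_simps)
    finally show "real (l ^ 2 - (l - 1)) \<le> real l ^ 2 * (1 - 1 / (2 * real l))" .
    show "0 \<le> real l ^ 2 * (1 - 1 / (2 * real l))" using l by (intro mult_nonneg_nonneg) (auto simp: field_simps)
    show "real (card (A \<inter> {..<Q})) \<le> (\<Prod>l\<in>W. real l ^ 2 * (1 - 1 / (2 * real l)))"
      unfolding A_def Q_def using insert by auto
  qed simp
  finally show ?case using insert.hyps by simp
qed

lemma card_periodic_le:
  fixes A :: "nat set"
  assumes A: "\<And>x. x \<in> A \<longleftrightarrow> x mod Q \<in> A" and Q: "Q > 0"
  shows "real (card (A \<inter> {..<M})) \<le> (real M / real Q + 1) * real (card (A \<inter> {..<Q}))"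
proof -
  have "A \<inter> {..<M} \<subseteq> (\<lambda>(j, s). j * Q + s) ` ({..M div Q} \<times> (A \<inter> {..<Q}))"
  proof
    fix x assume x: "x \<in> A \<inter> {..<M}"
    have "x = (x div Q) * Q + x mod Q" by simp
    moreover have "x div Q \<le> M div Q" using x by (intro div_le_mono) auto
    ultimately show "x \<in> (\<lambda>(j, s). j * Q + s) ` ({..M div Q} \<times> (A \<inter> {..<Q}))"
      using x A[of x] Q by (intro image_eqI[of _ _ "(x div Q, x mod Q)"]) auto
  qed
  then have "card (A \<inter> {..<M}) \<le> card ((\<lambda>(j, s). j * Q + s) ` ({..M div Q} \<times> (A \<inter> {..<Q})))"
    by (rule card_mono[rotated]) simp
  also have "\<dots> \<le> card ({..M div Q} \<times> (A \<inter> {..<Q}))" by (rule card_image_le) simp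
  also have "\<dots> = Suc (M div Q) * card (A \<inter> {..<Q})" by (simp add: card_cartesian_product)
  finally have "real (card (A \<inter> {..<M})) \<le> real (Suc (M div Q)) * real (card (A \<inter> {..<Q}))"
    by (simp only: of_nat_le_iff of_nat_mult[symmetric])
  also have "\<dots> \<le> (real M / real Q + 1) * real (card (A \<inter> {..<Q}))"
    by (intro mult_right_mono) (auto simp: of_nat_div_le_of_nat)
  finally show ?thesis .
qed

text \<open>The constant \<open>C\<close> absorbs an incomplete period; it depends on the window
  \<open>W\<close> but not on \<open>M\<close>.\<close>

lemma ex_prime_window:
  fixes y0 :: nat and \<epsilon> :: real
  assumes e: "\<epsilon> > 0"
  shows "\<exists>W C. finite W \<and> (\<forall>l\<in>W. prime l \<and> l > y0) \<and> (\<Sum>l\<in>W. 1 / (real l * sqrt (real l))) \<le> \<epsilon> \<and>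
    (\<forall>M. real (card {q \<in> {..<M}. \<forall>l\<in>W. \<not> exactly_dvd l q}) \<le> \<epsilon> * real M + C)"
proof -
  \<comment> \<open>With this choice e^(-k/2), which bounds the density of the exceptional integers,
    is below \<epsilon>.\<close>
  obtain k :: nat where k: "real k > - 2 * ln \<epsilon>" using reals_Archimedean2 by blast
  \<comment> \<open>This makes (k + 1) / sqrt y at most \<epsilon>; it bounds the sum of l^(-3/2)
    over the window.\<close>
  obtain y1 :: nat where y1: "real y1 > ((real k + 1) / \<epsilon>) ^ 2" using reals_Archimedean2 by blast
  define y where "y = max (Suc y0) (Suc y1)"
  obtain W where W: "finite W" "\<And>l. l \<in> W \<Longrightarrow> prime l \<and> l > y"
    "(\<Sum>l\<in>W. 1 / real l) \<ge> real k" "(\<Sum>l\<in>W. 1 / real l) \<le> real k + 1"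
    using prime_reciprocals_window[of y k] by blast
  have y0: "y > 0" by (simp add: y_def)
  define Q where "Q = (\<Prod>l\<in>W. l ^ 2)"
  define A where "A = {q. \<forall>l\<in>W. \<not> exactly_dvd l q}"
  have Q0: "Q > 0" unfolding Q_def using W(2) by (intro prod_pos) force
  have perA: "x \<in> A \<longleftrightarrow> x mod Q \<in> A" for x
  proof -
    have "k ^ 2 dvd Q" if "k \<in> W" for k unfolding Q_def using that W(1) by (intro dvd_prodI)
    then show ?thesis unfolding A_def using exactly_dvd_mod by auto
  qed
  have "real (card (A \<inter> {..<Q})) \<le> (\<Prod>l\<in>W. real l ^ 2 * (1 - 1 / (2 * real l)))"
    unfolding A_def Q_def using W by (intro density_not_exactly_dvd) auto
  also have "\<dots> = real Q * (\<Prod>l\<in>W. 1 - 1 / (2 * real l))" by (simp add: prod.distrib Q_def)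
  also have "(\<Prod>l\<in>W. 1 - 1 / (2 * real l)) \<le> (\<Prod>l\<in>W. exp (- (1 / (2 * real l))))"
  proof (rule prod_mono, intro conjI)
    fix l assume "l \<in> W"
    then have "l > 0" using W(2) by force
    then show "0 \<le> 1 - 1 / (2 * real l)" by (simp add: field_simps)
    show "1 - 1 / (2 * real l) \<le> exp (- (1 / (2 * real l)))" using exp_ge_add_one_self[of "- (1 / (2 * real l))"] by simp
  qed
  also have "\<dots> = exp (- (\<Sum>l\<in>W. 1 / real l) / 2)"
    using W(1) by (simp add: exp_sum[symmetric] sum_negf sum_divide_distrib mult.commute)
  also have "\<dots> \<le> exp (- real k / 2)" using W(3) by simp
  also have "\<dots> \<le> \<epsilon>"
    using k e by (subst ln_ge_iff[symmetric]) auto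
  finally have AQ: "real (card (A \<inter> {..<Q})) \<le> real Q * \<epsilon>" using Q0 by simp
  have "real (card {q \<in> {..<M}. \<forall>l\<in>W. \<not> exactly_dvd l q}) \<le> \<epsilon> * real M + real Q * \<epsilon>" for M
  proof -
    have "{q \<in> {..<M}. \<forall>l\<in>W. \<not> exactly_dvd l q} = A \<inter> {..<M}" by (auto simp: A_def)
    then have "real (card {q \<in> {..<M}. \<forall>l\<in>W. \<not> exactly_dvd l q}) \<le> (real M / real Q + 1) * real (card (A \<inter> {..<Q}))"
      using card_periodic_le[OF perA Q0] by simp
    also have "\<dots> \<le> (real M / real Q + 1) * (real Q * \<epsilon>)" by (intro mult_left_mono AQ) auto
    also have "\<dots> = \<epsilon> * real M + real Q * \<epsilon>" using Q0 by (simp add: field_simps)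
    finally show ?thesis .
  qed
  moreover have "(\<Sum>l\<in>W. 1 / (real l * sqrt (real l))) \<le> \<epsilon>"
  proof -
    have "(\<Sum>l\<in>W. 1 / (real l * sqrt (real l))) \<le> (\<Sum>l\<in>W. 1 / real l * (1 / sqrt (real y)))"
    proof (rule sum_mono)
      fix l assume "l \<in> W"
      then have "real y \<le> real l" "l > 0" using W(2) by force+
      then have "1 / sqrt (real l) \<le> 1 / sqrt (real y)" using y0 by (intro divide_left_mono) auto
      then have "1 / real l * (1 / sqrt (real l)) \<le> 1 / real l * (1 / sqrt (real y))" by (intro mult_left_mono) auto
      then show "1 / (real l * sqrt (real l)) \<le> 1 / real l * (1 / sqrt (real y))" by simp
    qed
    also have "\<dots> = (\<Sum>l\<in>W. 1 / real l) * (1 / sqrt (real y))" by (simp only: sum_distrib_right)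
    also have "\<dots> \<le> (real k + 1) * (1 / sqrt (real y))" using W(4) by (intro mult_right_mono) auto
    also have "\<dots> \<le> \<epsilon>"
    proof -
      have "((real k + 1) / \<epsilon>) ^ 2 \<le> real y" using y1 by (simp add: y_def)
      then have "(real k + 1) / \<epsilon> \<le> sqrt (real y)" by (rule real_le_rsqrt)
      then show ?thesis using e y0 by (simp add: field_simps)
    qed
    finally show ?thesis .
  qed
  ultimately show ?thesis using W(1,2)
    by (intro exI[of _ W] exI[of _ "real Q * \<epsilon>"]) (force simp: y_def)
qed

section \<open>Lower bounds for totient sums\<close>

definition reduced_residues :: "nat \<Rightarrow> nat set" where
  "reduced_residues q = {x \<in> {0<..<q}. coprime x q}"

lemma finite_reduced_residues [simp]: "finite (reduced_residues q)" by (simp add: reduced_residues_def)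

lemma card_reduced_residues_le: "card (reduced_residues q) \<le> q"
proof -
  have "card (reduced_residues q) \<le> card {0<..<q}" by (intro card_mono) (auto simp: reduced_residues_def)
  then show ?thesis by simp
qed

text \<open>Telescoping by 1/d^2 \<le> 1/(d - 1) - 1/d, starting from 1/4 = 3/4 - 1/2.\<close>

lemma sum_inverse_squares_le: "X \<ge> 2 \<Longrightarrow> (\<Sum>d=2..X. 1 / real d ^ 2) \<le> 3/4 - 1 / real X"
proof (induction X rule: dec_induct)
  case (step X)
  have "1 / real (Suc X) ^ 2 \<le> 1 / (real X * real (Suc X))"
    using step by (intro divide_left_mono) (auto simp: power2_eq_square)
  also have "\<dots> = 1 / real X - 1 / real (Suc X)" using step by (simp add: field_simps)
  finally show ?case using step by simp
qed simp

text \<open>Among the X^2 pairs, at most (X/d)^2 have the common divisor d, and over d \<ge> 2 this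
  amounts to at most 3/4 of all pairs. Apart from (1, 1), the coprime pairs are counted by the
  reduced residues, once for each order of the two entries.\<close>

lemma sum_card_reduced_residues_ge:
  assumes X: "X \<ge> 3"
  shows "(\<Sum>q\<in>{1..X}. real (card (reduced_residues q))) \<ge> real X ^ 2 / 16"
proof -
  define P where "P = {(a, b). a \<in> {1..X} \<and> b \<in> {1..X} \<and> coprime a (b::nat)}"
  define D where "D d = {a \<in> {1..X}. d dvd a} \<times> {a \<in> {1..X}. d dvd a}" for d
  have "{1..X} \<times> {1..X} \<subseteq> P \<union> (\<Union>d\<in>{2..X}. D d)"
  proof
    fix z assume "z \<in> {1..X} \<times> {1..X}"
    then obtain a b where z: "z = (a, b)" "a \<in> {1..X}" "b \<in> {1..X}" by auto
    show "z \<in> P \<union> (\<Union>d\<in>{2..X}. D d)"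
    proof (cases "coprime a b")
      case False
      define g where "g = gcd a b"
      have "g dvd a" "g dvd b" by (auto simp: g_def)
      moreover have "g \<noteq> 1" using False by (auto simp: g_def coprime_iff_gcd_eq_1)
      moreover have "g > 0" using z by (simp add: g_def)
      moreover have "g \<le> X" using z dvd_imp_le[OF \<open>g dvd a\<close>] by auto
      ultimately show ?thesis using z by (intro UnI2 UN_I[of g]) (auto simp: D_def)
    qed (use z P_def in auto)
  qed
  then have "card ({1..X} \<times> {1..X}) \<le> card (P \<union> (\<Union>d\<in>{2..X}. D d))"
  proof (rule card_mono[rotated])
    have "P \<subseteq> {1..X} \<times> {1..X}" by (auto simp: P_def)
    then show "finite (P \<union> (\<Union>d\<in>{2..X}. D d))" by (auto simp: D_def intro: finite_subset)
  qed
  also have "\<dots> \<le> card P + card (\<Union>d\<in>{2..X}. D d)" by (rule card_Un_le)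
  also have "card (\<Union>d\<in>{2..X}. D d) \<le> (\<Sum>d\<in>{2..X}. card (D d))" by (rule card_UN_le) simp
  also have "(\<Sum>d\<in>{2..X}. card (D d)) = (\<Sum>d\<in>{2..X}. (X div d) ^ 2)"
  proof (rule sum.cong[OF refl])
    fix d assume "d \<in> {2..X}"
    then have "d > 0" by simp
    then show "card (D d) = (X div d) ^ 2"
      unfolding D_def card_cartesian_product by (simp only: card_multiples power2_eq_square)
  qed
  finally have "X ^ 2 \<le> card P + (\<Sum>d\<in>{2..X}. (X div d) ^ 2)" by (simp add: card_cartesian_product power2_eq_square)
  then have "real (X ^ 2) \<le> real (card P + (\<Sum>d\<in>{2..X}. (X div d) ^ 2))" by (simp only: of_nat_le_iff)
  also have "\<dots> = real (card P) + (\<Sum>d\<in>{2..X}. real (X div d) ^ 2)" by simp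
  also have "(\<Sum>d\<in>{2..X}. real (X div d) ^ 2) \<le> (\<Sum>d\<in>{2..X}. real X ^ 2 * (1 / real d ^ 2))"
  proof (rule sum_mono)
    fix d
    have "real (X div d) ^ 2 \<le> (real X / real d) ^ 2" by (intro power_mono of_nat_div_le_of_nat) simp
    then show "real (X div d) ^ 2 \<le> real X ^ 2 * (1 / real d ^ 2)" by (simp add: power_divide)
  qed
  also have "\<dots> = real X ^ 2 * (\<Sum>d=2..X. 1 / real d ^ 2)" by (simp only: sum_distrib_left)
  also have "\<dots> \<le> real X ^ 2 * (3/4)"
  proof (rule mult_left_mono)
    have "0 \<le> 1 / real X" by simp
    then show "(\<Sum>d=2..X. 1 / real d ^ 2) \<le> 3/4" using sum_inverse_squares_le[of X] X by linarith
  qed simp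
  finally have 1: "real (card P) \<ge> real X ^ 2 / 4" by simp
  define T where "T = (SIGMA q:{1..X}. reduced_residues q)"
  have "P \<subseteq> insert (1,1) (T \<union> (\<lambda>(a, b). (b, a)) ` T)"
  proof
    fix z assume "z \<in> P"
    then obtain a b where z: "z = (a, b)" "a \<in> {1..X}" "b \<in> {1..X}" "coprime a b" by (auto simp: P_def)
    consider "a = b" | "a < b" | "a > b" by linarith
    then show "z \<in> insert (1,1) (T \<union> (\<lambda>(a, b). (b, a)) ` T)"
    proof cases
      case 1
      then show ?thesis using z by simp
    next
      case 2
      then have "(b, a) \<in> T" using z by (auto simp: T_def reduced_residues_def)
      then show ?thesis using z by force
    next
      case 3
      then have "(a, b) \<in> T" using z by (auto simp: T_def reduced_residues_def coprime_commute)
      then show ?thesis using z by force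
    qed
  qed
  then have "card P \<le> card (insert (1,1) (T \<union> (\<lambda>(a, b). (b, a)) ` T))"
    by (rule card_mono[rotated]) (simp add: T_def)
  also have "\<dots> \<le> Suc (card (T \<union> (\<lambda>(a, b). (b, a)) ` T))" by (rule card_insert_le_m1) auto
  also have "\<dots> \<le> Suc (card T + card ((\<lambda>(a, b). (b, a)) ` T))" using card_Un_le by simp
  also have "\<dots> \<le> Suc (card T + card T)" using card_image_le[of T] by (simp add: T_def)
  finally have "real (card P) \<le> 1 + 2 * real (card T)" by linarith
  moreover have "real (card T) = (\<Sum>q\<in>{1..X}. real (card (reduced_residues q)))" by (simp add: T_def)
  \<comment> \<open>Absorbs the pair (1, 1): X^2/8 - 1/2 is at least X^2/16.\<close>
  moreover have "real X ^ 2 \<ge> 9" using X power_mono[of 3 "real X" 2] by simp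
  ultimately show ?thesis using 1 by linarith
qed

text \<open>The q with fewer than X/32 reduced residues contribute at most X^2/32, half of the
  guaranteed total, so at least X/32 values of q remain. With k = n - 1 this bounds the size of the
  index set below by a multiple of x^n.\<close>

lemma sum_card_reduced_residues_power_ge:
  assumes X: "X \<ge> 3"
  shows "(\<Sum>q\<in>{1..X}. real (card (reduced_residues q)) ^ k) \<ge> (real X / 32) ^ Suc k"
proof -
  define B where "B = {q \<in> {1..X}. real (card (reduced_residues q)) \<ge> real X / 32}"
  have "real X ^ 2 / 16 \<le> (\<Sum>q\<in>{1..X}. real (card (reduced_residues q)))" by (rule sum_card_reduced_residues_ge[OF X])
  also have "\<dots> \<le> (\<Sum>q\<in>{1..X}. real X / 32 + (if q \<in> B then real X else 0))"
  proof (rule sum_mono)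
    fix q assume "q \<in> {1..X}"
    then show "real (card (reduced_residues q)) \<le> real X / 32 + (if q \<in> B then real X else 0)"
      using card_reduced_residues_le[of q] by (auto simp: B_def)
  qed
  also have "\<dots> = real X ^ 2 / 32 + real (card B) * real X"
  proof -
    have "(\<Sum>q\<in>{1..X}. if q \<in> B then real X else 0) = (\<Sum>q\<in>{q\<in>{1..X}. q \<in> B}. real X)"
      by (rule sum.inter_filter[symmetric]) simp
    also have "{q\<in>{1..X}. q \<in> B} = B" by (auto simp: B_def)
    finally show ?thesis by (simp add: sum.distrib power2_eq_square)
  qed
  finally have "real X * (real X / 32) \<le> real X * real (card B)" by (simp add: power2_eq_square mult.commute)
  then have cB: "real (card B) \<ge> real X / 32" using X by simp
  have "(real X / 32) ^ Suc k = real X / 32 * (real X / 32) ^ k" by simp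
  also have "\<dots> \<le> real (card B) * (real X / 32) ^ k" using cB by (intro mult_right_mono) auto
  also have "\<dots> = (\<Sum>q\<in>B. (real X / 32) ^ k)" by simp
  also have "\<dots> \<le> (\<Sum>q\<in>B. real (card (reduced_residues q)) ^ k)" by (intro sum_mono power_mono) (auto simp: B_def)
  also have "\<dots> \<le> (\<Sum>q\<in>{1..X}. real (card (reduced_residues q)) ^ k)" by (intro sum_mono2) (auto simp: B_def)
  finally show ?thesis .
qed

subsection \<open>Exponential sums modulo a prime\<close>

definition unit_exp :: "real \<Rightarrow> complex" where
  "unit_exp x = cis (2 * pi * x)"

lemma unit_exp_add: "unit_exp (x + y) = unit_exp x * unit_exp y"
  by (simp add: unit_exp_def cis_mult distrib_left)

lemma norm_unit_exp [simp]: "cmod (unit_exp x) = 1"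
  by (simp add: unit_exp_def)

lemma unit_exp_eq_1_iff: "unit_exp x = 1 \<longleftrightarrow> x \<in> \<int>"
proof
  assume "unit_exp x = 1"
  then have "cos (2 * pi * x) = 1" by (simp add: unit_exp_def complex_eq_iff)
  then obtain k :: int where "2 * pi * x = of_int k * 2 * pi" by (auto simp: cos_one_2pi_int)
  then have "x = of_int k" by simp
  then show "x \<in> \<int>" by simp
next
  assume "x \<in> \<int>"
  then show "unit_exp x = 1" by (auto simp: unit_exp_def complex_eq_iff sin_times_pi_eq_0 elim!: Ints_cases)
qed

lemma unit_exp_cong:
  assumes "x - y \<in> \<int>" shows "unit_exp x = unit_exp y"
  using unit_exp_add[of "x - y" y] assms unit_exp_eq_1_iff[of "x - y"] by simp

lemma unit_exp_0 [simp]: "unit_exp 0 = 1" by (simp add: unit_exp_def)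

lemma cnj_unit_exp: "cnj (unit_exp x) = unit_exp (- x)"
  by (simp add: unit_exp_def cis_cnj)

lemma unit_exp_power: "unit_exp x ^ k = unit_exp (real k * x)"
proof (induction k)
  case (Suc k)
  have "real (Suc k) * x = x + real k * x" by (simp add: algebra_simps)
  then show ?case using Suc by (simp only: unit_exp_add power_Suc)
qed simp

lemma sum_unit_exp:
  assumes l: "l > 0"
  shows "(\<Sum>a<l. unit_exp (real a * real_of_int h / real l)) = (if int l dvd h then of_nat l else 0)"
proof (cases "int l dvd h")
  case True
  then obtain j where j: "h = int l * j" by (elim dvdE)
  have "unit_exp (real a * real_of_int h / real l) = 1" for a
  proof -
    have "real a * real_of_int h / real l = of_int (int a * j)" using l by (simp add: j)
    then show ?thesis unfolding unit_exp_eq_1_iff by (metis Ints_of_int)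
  qed
  then show ?thesis using True by simp
next
  case False
  define z where "z = unit_exp (real_of_int h / real l)"
  have "z \<noteq> 1"
  proof
    assume "z = 1"
    then obtain j where "real_of_int h / real l = of_int j"
      unfolding z_def unit_exp_eq_1_iff by (elim Ints_cases)
    then have "real_of_int h = of_int (int l * j)" using l by (simp add: field_simps)
    then have "h = int l * j" by (simp only: of_int_eq_iff)
    then show False using False by simp
  qed
  moreover have "z ^ l = 1" unfolding z_def unit_exp_power unit_exp_eq_1_iff using l by simp
  moreover have "(\<Sum>a<l. unit_exp (real a * real_of_int h / real l)) = (\<Sum>a<l. z ^ a)"
    by (simp add: z_def unit_exp_power)
  ultimately show ?thesis using False by (simp add: sum_gp_strict)
qed

text \<open>The choice is made from the residue \<open>a mod l\<close>, so that congruent arguments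
  receive equal and not merely congruent inverses.\<close>

definition inv_mod :: "nat \<Rightarrow> nat \<Rightarrow> int" where
  "inv_mod l a = (SOME b. [int (a mod l) * b = 1] (mod int l))"

lemma inv_mod_cong: "[a = b] (mod l) \<Longrightarrow> inv_mod l a = inv_mod l b"
  by (simp add: inv_mod_def cong_def)

lemma inv_mod:
  assumes "prime l" "\<not> l dvd a"
  shows "[int a * inv_mod l a = 1] (mod int l)"
proof -
  have "\<not> l dvd a mod l" using assms(2) by (simp add: dvd_mod_iff)
  with assms(1) have "coprime l (a mod l)" by (rule prime_imp_coprime)
  then have "coprime (int (a mod l)) (int l)" by (simp only: coprime_int_iff coprime_commute)
  then have "\<exists>b. [int (a mod l) * b = 1] (mod int l)" by (rule cong_solve_coprime_int)
  then have "[int (a mod l) * inv_mod l a = 1] (mod int l)" unfolding inv_mod_def by (rule someI_ex)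
  moreover have "[int a = int (a mod l)] (mod int l)" by (simp add: cong_def zmod_int)
  then have "[int a * inv_mod l a = int (a mod l) * inv_mod l a] (mod int l)"
    by (intro cong_mult cong_refl)
  ultimately show ?thesis using cong_trans by blast
qed

section \<open>Dedekind sums in the setting of the theorem\<close>

locale dedekind_setup =
  fixes n N :: nat and r :: "nat \<Rightarrow> nat"
  assumes n2: "n \<ge> 2" and rpos: "\<And>i. i \<in> {1..n} \<Longrightarrow> r i > 0"
    and N_eq: "N = (\<Sum>i\<in>{1..n}. r i)" and evenN: "even N"
begin

abbreviation "d \<equiv> todd_denom N n"

definition dedekind_value :: "nat \<Rightarrow> (nat \<Rightarrow> nat) \<Rightarrow> real" where
  "dedekind_value q p = real_of_int d * real q ^ (N - n) / (\<Prod>i\<in>{1..n}. fact (r i)) * dedekind_sum n r q p"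

lemma N_ge: "N \<ge> n"
proof -
  have "(\<Sum>i\<in>{1..n}. 1) \<le> (\<Sum>i\<in>{1..n}. r i)" using rpos by (intro sum_mono) (simp add: Suc_leI)
  then show ?thesis by (simp add: N_eq)
qed

text \<open>A second index exists and its entry is positive. This keeps a monomial of degree r_1
  below the top degree N.\<close>

lemma r_less: "r 1 < N"
proof -
  have "(\<Sum>i\<in>{1..n}. r i) = r 1 + (\<Sum>i\<in>{1..n}-{1}. r i)" using n2 by (intro sum.remove) auto
  moreover have "r 2 \<le> (\<Sum>i\<in>{1..n}-{1}. r i)" using n2 by (intro member_le_sum) auto
  moreover have "r 2 > 0" using rpos[of 2] n2 by simp
  ultimately show ?thesis by (simp add: N_eq)
qed

sublocale todd_data n N d
proof
  show "N > 0" using N_ge n2 by simp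
  fix m assume "m \<in> compositions N n"
  then have "of_int d * (\<Prod>i\<in>{1..n}. bernoulli (m i) / fact (m i)) \<in> (\<int> :: rat set)"
    by (rule todd_denom_mult_Ints)
  then obtain z where "of_int d * (\<Prod>i\<in>{1..n}. bernoulli (m i) / fact (m i)) = (of_int z :: rat)"
    by (elim Ints_cases)
  then have "of_rat (of_int d * (\<Prod>i\<in>{1..n}. bernoulli (m i) / fact (m i))) = (of_rat (of_int z) :: complex)"
    by simp
  moreover have "of_rat (fact k) = (fact k :: complex)" for k by (metis of_nat_fact of_rat_of_nat_eq)
  then have "of_rat (of_int d * (\<Prod>i\<in>{1..n}. bernoulli (m i) / fact (m i))) =
      (of_int d * (\<Prod>i\<in>{1..n}. bernoulli (m i) / fact (m i)) :: complex)"
    by (simp add: of_rat_mult of_rat_prod of_rat_divide of_rat_bernoulli)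
  ultimately have "of_int d * (\<Prod>i\<in>{1..n}. bernoulli (m i) / fact (m i)) = (of_int z :: complex)" by simp
  then show "of_int d * (\<Prod>i\<in>{1..n}. bernoulli (m i) / fact (m i)) \<in> (\<int> :: complex set)" by simp
qed

definition r_tuple :: "nat \<Rightarrow> nat" where "r_tuple = restrict r {1..n}"

lemma r_tuple_comp: "r_tuple \<in> compositions N n"
  by (simp add: r_tuple_def compositions_def N_eq)

lemma scaled_bernoulli_periodic:
  assumes "k < q"
  shows "scaled_bernoulli q m k = of_nat q powi (int m - 1) * of_real (periodic_bernoulli m (real k / real q)) / (fact m :: complex)"
proof (cases "k = 0")
  case True
  then show ?thesis by (auto simp: scaled_bernoulli_def periodic_bernoulli_def bern0_coeff_def of_real_bernoulli)
next
  case False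
  have "0 < real k / real q" "real k / real q < 1" using False assms by auto
  then have "real k / real q \<notin> \<int>" "frac (real k / real q) = real k / real q"
    by (auto simp: frac_eq elim!: Ints_cases)
  then show ?thesis using False
    by (simp add: scaled_bernoulli_def periodic_bernoulli_def of_real_bernpoly)
qed

lemma periodic_bernoulli_mod:
  assumes "q > 0"
  shows "periodic_bernoulli m (real (S mod q) / real q) = periodic_bernoulli m (real S / real q)"
proof -
  have "S = q * (S div q) + S mod q" by simp
  then have "real S = real q * real (S div q) + real (S mod q)" by (metis of_nat_add of_nat_mult)
  then have e: "real S / real q = real (S mod q) / real q + of_int (int (S div q))"
    using assms by (simp add: field_simps)
  have "real S / real q \<in> \<int> \<longleftrightarrow> real (S mod q) / real q \<in> \<int>"
    unfolding e by (metis Ints_add Ints_diff Ints_of_int add_diff_cancel_right')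
  moreover have "frac (real S / real q) = frac (real (S mod q) / real q)"
    unfolding e by (simp add: frac_def)
  ultimately show ?thesis by (simp add: periodic_bernoulli_def)
qed

text \<open>With w_n = q - 1 the divisibility condition forces k_n to be the residue of the sum of
  the p_i k_i, which gives the last factor; the powers q^(r_i - 1) multiply to q^(N - n).\<close>

lemma dedekind_value_eq:
  assumes q: "q > 0"
  shows "complex_of_real (dedekind_value q p) = of_int d * dedekind_coeff n q (p(n := q - 1)) r_tuple"
proof -
  define w where "w = p(n := q - 1)"
  define Bt where "Bt = (\<lambda>m x. complex_of_real (periodic_bernoulli m x))"
  define F where "F = (\<Prod>i\<in>{1..n}. fact (r i) :: complex)"
  have n1: "{1..n} = insert n {1..n-1}" "n \<notin> {1..n-1}" using n2 by auto
  let ?S = "\<lambda>k. \<Sum>i\<in>{1..n-1}. p i * k i"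
  have wS: "(\<Sum>i\<in>{1..n}. w i * k i) = ?S k + (q - 1) * k n" for k
  proof -
    have "(\<Sum>i\<in>{1..n}. w i * k i) = w n * k n + (\<Sum>i\<in>{1..n-1}. w i * k i)"
      unfolding n1(1) using n1(2) by (subst sum.insert) auto
    also have "(\<Sum>i\<in>{1..n-1}. w i * k i) = ?S k" using n1(2) by (intro sum.cong) (auto simp: w_def)
    finally show ?thesis by (simp add: w_def)
  qed
  have dv: "q dvd ?S k + (q - 1) * k n \<longleftrightarrow> ?S k mod q = k n mod q" for k
  proof -
    have "q dvd ?S k + (q - 1) * k n \<longleftrightarrow> [?S k + (q - 1) * k n = 0] (mod q)" by (simp add: cong_0_iff)
    also have "\<dots> \<longleftrightarrow> [?S k + (q - 1) * k n + k n = 0 + k n] (mod q)" by (simp only: cong_add_rcancel_nat)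
    also have "?S k + (q - 1) * k n + k n = ?S k + q * k n" using q by (cases q) auto
    also have "[?S k + q * k n = 0 + k n] (mod q) \<longleftrightarrow> ?S k mod q = k n mod q" by (simp add: cong_def)
    finally show ?thesis .
  qed
  have "dedekind_coeff n q w r_tuple = (\<Sum>k' \<in> {1..n-1} \<rightarrow>\<^sub>E {0..<q}. \<Prod>i\<in>{1..n}. scaled_bernoulli q (r_tuple i) ((k'(n := ?S k' mod q)) i))"
    unfolding dedekind_coeff_def
  proof (rule sum.reindex_bij_witness[where i = "\<lambda>k'. k'(n := ?S k' mod q)" and j = "\<lambda>k. restrict k {1..n-1}"])
    fix k assume "k \<in> {k. k \<in> {1..n} \<rightarrow>\<^sub>E {..<q} \<and> q dvd (\<Sum>i\<in>{1..n}. w i * k i)}"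
    then have k: "k \<in> {1..n} \<rightarrow>\<^sub>E {..<q}" and "q dvd (\<Sum>i\<in>{1..n}. w i * k i)" by blast+
    then have k2: "?S k mod q = k n mod q" by (simp only: wS dv)
    have "k n < q" using k n2 by auto
    then have kn: "?S k mod q = k n" using k2 by simp
    have weyl_sum: "?S (restrict k {1..n-1}) = ?S k" by (intro sum.cong) auto
    show A: "(restrict k {1..n-1})(n := ?S (restrict k {1..n-1}) mod q) = k"
      unfolding weyl_sum kn
    proof
      fix i show "((restrict k {1..n-1})(n := k n)) i = k i"
        using k n1 by (cases "i \<in> {1..n}") (auto simp: PiE_def extensional_def)
    qed
    show "restrict k {1..n-1} \<in> {1..n-1} \<rightarrow>\<^sub>E {0..<q}" using k by auto
    show "(\<Prod>i\<in>{1..n}. scaled_bernoulli q (r_tuple i) (((restrict k {1..n-1})(n := ?S (restrict k {1..n-1}) mod q)) i)) = (\<Prod>i\<in>{1..n}. scaled_bernoulli q (r_tuple i) (k i))"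
      unfolding A ..
  next
    fix k' assume k': "k' \<in> {1..n-1} \<rightarrow>\<^sub>E {0..<q}"
    show "restrict (k'(n := ?S k' mod q)) {1..n-1} = k'"
      using k' n1(2) by (auto simp: PiE_def extensional_def restrict_def fun_eq_iff)
    have weyl_sum: "?S (k'(n := ?S k' mod q)) = ?S k'" using n1(2) by (intro sum.cong) auto
    have "k'(n := ?S k' mod q) \<in> {1..n} \<rightarrow>\<^sub>E {..<q}"
      using k' q unfolding n1(1) by (intro PiE_fun_upd) auto
    then show "k'(n := ?S k' mod q) \<in> {k. k \<in> {1..n} \<rightarrow>\<^sub>E {..<q} \<and> q dvd (\<Sum>i\<in>{1..n}. w i * k i)}"
      unfolding mem_Collect_eq wS dv weyl_sum by simp
  qed
  also have "\<dots> = (\<Sum>k' \<in> {1..n-1} \<rightarrow>\<^sub>E {0..<q}. of_nat q ^ (N - n) / F *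
     ((\<Prod>i\<in>{1..n-1}. Bt (r i) (real (k' i) / real q)) * Bt (r n) (real (?S k') / real q)))"
  proof (rule sum.cong[OF refl])
    fix k' assume k': "k' \<in> {1..n-1} \<rightarrow>\<^sub>E {0..<q}"
    define k where "k = k'(n := ?S k' mod q)"
    have kq: "k i < q" if "i \<in> {1..n}" for i
      using that k' q by (cases "i = n") (auto simp: k_def PiE_def Pi_def)
    have "(\<Prod>i\<in>{1..n}. scaled_bernoulli q (r_tuple i) (k i)) = (\<Prod>i\<in>{1..n}. of_nat q ^ (r i - 1) * Bt (r i) (real (k i) / real q) / fact (r i))"
    proof (rule prod.cong[OF refl])
      fix i assume i: "i \<in> {1..n}"
      have e: "int (r i) - 1 = int (r i - 1)" using rpos[OF i] by simp
      have "r_tuple i = r i" using i by (simp add: r_tuple_def)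
      then show "scaled_bernoulli q (r_tuple i) (k i) = of_nat q ^ (r i - 1) * Bt (r i) (real (k i) / real q) / fact (r i)"
        using scaled_bernoulli_periodic[OF kq[OF i], of "r i"] unfolding e power_int_of_nat Bt_def by (simp only:)
    qed
    also have "\<dots> = of_nat q ^ (\<Sum>i\<in>{1..n}. r i - 1) * (\<Prod>i\<in>{1..n}. Bt (r i) (real (k i) / real q)) / F"
      by (simp add: prod.distrib prod_dividef power_sum F_def)
    also have "(\<Sum>i\<in>{1..n}. r i - 1) = N - n"
      using rpos by (subst sum_subtractf_nat) (auto simp: N_eq Suc_leI)
    also have "(\<Prod>i\<in>{1..n}. Bt (r i) (real (k i) / real q)) =
        Bt (r n) (real (k n) / real q) * (\<Prod>i\<in>{1..n-1}. Bt (r i) (real (k i) / real q))"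
      unfolding n1(1) using n1(2) by (subst prod.insert) auto
    also have "(\<Prod>i\<in>{1..n-1}. Bt (r i) (real (k i) / real q)) = (\<Prod>i\<in>{1..n-1}. Bt (r i) (real (k' i) / real q))"
      using n1(2) by (intro prod.cong) (auto simp: k_def)
    also have "Bt (r n) (real (k n) / real q) = Bt (r n) (real (?S k') / real q)"
      using periodic_bernoulli_mod[OF q] by (simp add: Bt_def k_def)
    finally show "(\<Prod>i\<in>{1..n}. scaled_bernoulli q (r_tuple i) ((k'(n := ?S k' mod q)) i)) = of_nat q ^ (N - n) / F *
     ((\<Prod>i\<in>{1..n-1}. Bt (r i) (real (k' i) / real q)) * Bt (r n) (real (?S k') / real q))"
      by (simp add: k_def mult_ac)
  qed
  also have "\<dots> = of_nat q ^ (N - n) / F * of_real (dedekind_sum n r q p)"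
    unfolding dedekind_sum_def sum_distrib_left[symmetric] by (simp add: Bt_def)
  finally show ?thesis by (simp add: dedekind_value_def F_def w_def)
qed

section \<open>Level sets of the Laurent polynomial modulo a prime\<close>

definition top_comp :: "nat \<Rightarrow> nat" where
  "top_comp = restrict (\<lambda>i. if i = 1 then N else 0) {1..n}"

lemma top_comp_comp: "top_comp \<in> compositions N n"
proof -
  have "(\<Sum>i\<in>{1..n}. top_comp i) = (\<Sum>i\<in>{1..n}. if i = 1 then N else 0)"
    by (rule sum.cong) (auto simp: top_comp_def)
  also have "\<dots> = N" using n2 by (simp add: sum.delta)
  finally show ?thesis by (simp add: compositions_def top_comp_def)
qed

lemma top_compI:
  assumes m: "m \<in> compositions N n" and m1: "m 1 = N"
  shows "m = top_comp"
proof (rule PiE_ext[of _ "{1..n}" "\<lambda>_. UNIV"])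
  show "m \<in> {1..n} \<rightarrow>\<^sub>E UNIV" "top_comp \<in> {1..n} \<rightarrow>\<^sub>E UNIV"
    using m top_comp_comp by (auto simp: compositions_def)
  fix i assume i: "i \<in> {1..n}"
  have "(\<Sum>i\<in>{1..n}. m i) = m 1 + (\<Sum>i\<in>{1..n}-{1}. m i)" using n2 by (intro sum.remove) auto
  then have "(\<Sum>i\<in>{1..n}-{1}. m i) = 0" using m m1 by (simp add: compositions_def)
  then show "m i = top_comp i" using i m1 by (auto simp: top_comp_def)
qed

text \<open>Up to sign the coefficient is d times B_N / N! times (N - 1 choose r_1 - 1). The
  evenness of N enters here, through B_N.\<close>

lemma laurent_int_coeff_top_nonzero: "laurent_int_coeff r_tuple top_comp \<noteq> 0"
proof
  assume "laurent_int_coeff r_tuple top_comp = 0"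
  then have "of_int d * (\<Prod>k\<in>{1..n}. bern0_coeff (top_comp k)) * (\<Prod>k\<in>{1..n}. laurent_binom (top_comp k) (r_tuple k)) = (0::complex)"
    using of_int_laurent_int_coeff[OF top_comp_comp, of r_tuple] by simp
  then obtain k where k: "k \<in> {1..n}" "bern0_coeff (top_comp k) = (0::complex) \<or> laurent_binom (top_comp k) (r_tuple k) = 0"
    using todd_denom_nonzero[of N n] by (auto simp: prod_zero_iff)
  have rk: "r_tuple k = r k" "r k > 0" using k(1) rpos by (auto simp: r_tuple_def)
  show False
  proof (cases "k = 1")
    case True
    then have "top_comp k = N" using k(1) by (simp add: top_comp_def)
    moreover have "bern0_coeff N \<noteq> (0::complex)"
      using bernoulli_even_nonzero[OF evenN N_pos, where ?'a=complex] evenN by (auto simp: bern0_coeff_def)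
    moreover have "laurent_binom N (r k) \<noteq> 0"
    proof -
      have "of_int (int N - 1) = (of_nat (N - 1) :: complex)" using N_pos by simp
      then have "laurent_binom N (r k) = of_nat (N - 1 choose (r k - 1))"
        using rk by (simp only: laurent_binom_def binomial_gbinomial[symmetric] if_False) simp
      moreover have "r k - 1 \<le> N - 1" using r_less True by simp
      ultimately show ?thesis by (simp add: binomial_eq_0_iff)
    qed
    ultimately show False using k rk by simp
  next
    case False
    then have t0: "top_comp k = 0" using k(1) by (simp add: top_comp_def)
    have "1 + of_nat (r k - 1) - 1 = (of_nat (r k - 1) :: complex)" by simp
    then have "(- 1 gchoose (r k - 1)) = (-1 :: complex) ^ (r k - 1)"
      using gbinomial_minus[of "1::complex" "r k - 1"] by (simp only: binomial_gbinomial[symmetric]) simp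
    then have "laurent_binom 0 (r k) \<noteq> 0" using rk by (simp add: laurent_binom_def)
    then show False using k rk t0 by simp
  qed
qed

lemma laurent_mod_sum_cong:
  assumes "\<And>k. k \<in> {1..n} \<Longrightarrow> [w k = w' k] (mod l)"
  shows "[laurent_mod_sum (inv_mod l) r_tuple w = laurent_mod_sum (inv_mod l) r_tuple w'] (mod int l)"
proof -
  have "[int (w k) = int (w' k)] (mod int l)" "inv_mod l (w k) = inv_mod l (w' k)" if "k \<in> {1..n}" for k
    using assms[OF that] inv_mod_cong by (auto simp: cong_int_iff)
  then show ?thesis unfolding laurent_mod_sum_def
    by (intro cong_mult cong_sum cong_refl cong_prod cong_pow) auto
qed

text \<open>The last entry represents -1 modulo l, in agreement with w_n = q - 1 when l divides
  q.\<close>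

definition laurent_value :: "nat \<Rightarrow> (nat \<Rightarrow> nat) \<Rightarrow> int" where
  "laurent_value l x = laurent_mod_sum (inv_mod l) r_tuple (x(n := l - 1))"

text \<open>Clearing the denominator gives a polynomial congruence of degree N in z. Its top
  coefficient stems from \<open>top_comp\<close> alone and is nonzero modulo l, so Lagrange's bound
  applies.\<close>

lemma card_laurent_value_fiber_le:
  assumes l: "prime l" "\<not> int l dvd laurent_int_coeff r_tuple top_comp"
    and x: "\<And>i. i \<in> {2..n-1} \<Longrightarrow> x i \<in> {0<..<l}"
  shows "card {z \<in> {0<..<l}. [laurent_value l (x(1 := z)) = h] (mod int l)} \<le> N"
proof -
  define w where "w z = (x(1 := z))(n := l - 1)" for z
  define c where "c m = (\<Prod>k\<in>{1..n}-{1}. int (w 0 k) ^ m k)" for m :: "nat \<Rightarrow> nat"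
  define Q where "Q = (\<Sum>m\<in>compositions N n. monom (laurent_int_coeff r_tuple m * c m) (m 1)) - monom (h * c r_tuple) (r 1)"
  have l2: "l \<ge> 2" using l prime_ge_2_nat by blast
  have w1: "w z 1 = z" for z using n2 by (simp add: w_def)
  have wk: "w z k = w 0 k" if "k \<in> {1..n} - {1}" for z k using that by (simp add: w_def)
  have pw: "(\<Prod>k\<in>{1..n}. int (w z k) ^ m k) = int z ^ m 1 * c m" for z m
  proof -
    have "(\<Prod>k\<in>{1..n}. int (w z k) ^ m k) = int (w z 1) ^ m 1 * (\<Prod>k\<in>{1..n}-{1}. int (w z k) ^ m k)"
      using n2 by (intro prod.remove) auto
    moreover have "(\<Prod>k\<in>{1..n}-{1}. int (w z k) ^ m k) = c m"
      unfolding c_def by (intro prod.cong refl arg_cong[where f = int] arg_cong2[where f = power] wk)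
    ultimately show ?thesis by (simp only: w1)
  qed
  have m1N: "m 1 \<le> N" if "m \<in> compositions N n" for m
    using that member_le_sum[of 1 "{1..n}" m] n2 by (simp add: compositions_def)
  have degQ: "degree Q \<le> N"
    unfolding Q_def using m1N r_less
    by (intro degree_diff_le degree_sum_le finite_compositions) (auto intro: order_trans[OF degree_monom_le])
  have "coeff Q N = (\<Sum>m\<in>compositions N n. if m = top_comp then laurent_int_coeff r_tuple top_comp * c top_comp else 0)"
  proof -
    have "m 1 = N \<longleftrightarrow> m = top_comp" if "m \<in> compositions N n" for m
      using top_compI[OF that] n2 by (auto simp: top_comp_def)
    then have "(\<Sum>m\<in>compositions N n. if m 1 = N then laurent_int_coeff r_tuple m * c m else 0) =
       (\<Sum>m\<in>compositions N n. if m = top_comp then laurent_int_coeff r_tuple top_comp * c top_comp else 0)"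
      by (intro sum.cong) auto
    then show ?thesis
      unfolding Q_def coeff_diff coeff_sum coeff_monom using r_less by simp
  qed
  also have "\<dots> = laurent_int_coeff r_tuple top_comp * c top_comp"
    using finite_compositions top_comp_comp by (simp add: sum.delta)
  also have "c top_comp = 1" unfolding c_def by (intro prod.neutral) (auto simp: top_comp_def)
  finally have cQ: "\<not> int l dvd coeff Q N" using l by simp
  have "int ` {z \<in> {0<..<l}. [laurent_value l (x(1 := z)) = h] (mod int l)} \<subseteq> {z \<in> {0..<int l}. int l dvd poly Q z}"
  proof
    fix y assume "y \<in> int ` {z \<in> {0<..<l}. [laurent_value l (x(1 := z)) = h] (mod int l)}"
    then obtain z where z: "y = int z" "0 < z" "z < l" "[laurent_value l (x(1 := z)) = h] (mod int l)" by auto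
    define S where "S = (\<Sum>m\<in>compositions N n. laurent_int_coeff r_tuple m * (\<Prod>k\<in>{1..n}. int (w z k) ^ m k))"
    define P where "P = (\<Prod>k\<in>{1..n}. int (w z k) ^ r_tuple k)"
    have nd: "\<not> l dvd w z k" if "k \<in> {1..n}" for k
    proof -
      have "0 < w z k \<and> w z k < l"
      proof (cases "k = n")
        case False
        then show ?thesis using that z x[of k] by (cases "k = 1") (auto simp: w_def)
      qed (use l2 in \<open>simp add: w_def\<close>)
      then show ?thesis by (auto dest: dvd_imp_le)
    qed
    have "[(\<Prod>k\<in>{1..n}. (int (w z k) * inv_mod l (w z k)) ^ r_tuple k) = (\<Prod>k\<in>{1..n}. 1 ^ r_tuple k)] (mod int l)"
      by (intro cong_prod cong_pow inv_mod l(1) nd)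
    then have "[(\<Prod>k\<in>{1..n}. (int (w z k) * inv_mod l (w z k)) ^ r_tuple k) * S = 1 * S] (mod int l)"
      by (intro cong_mult cong_refl) simp
    moreover have "P * laurent_value l (x(1 := z)) = (\<Prod>k\<in>{1..n}. (int (w z k) * inv_mod l (w z k)) ^ r_tuple k) * S"
      unfolding P_def laurent_value_def laurent_mod_sum_def w_def[symmetric] S_def power_mult_distrib prod.distrib by (simp only: mult_ac)
    ultimately have "[P * laurent_value l (x(1 := z)) = S] (mod int l)" by simp
    moreover have "[P * laurent_value l (x(1 := z)) = P * h] (mod int l)" by (intro cong_mult cong_refl z(4))
    ultimately have "[S = P * h] (mod int l)" using cong_trans cong_sym by blast
    then have "int l dvd S - P * h" by (simp add: cong_iff_dvd_diff)
    also have "S - P * h = poly Q y"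
    proof -
      have "r_tuple 1 = r 1" using n2 by (simp add: r_tuple_def)
      then have "P = int z ^ r 1 * c r_tuple" unfolding P_def pw by (simp only:)
      then show ?thesis unfolding S_def pw Q_def by (simp add: poly_sum poly_monom z(1) mult_ac)
    qed
    finally show "y \<in> {z \<in> {0..<int l}. int l dvd poly Q z}" using z by simp
  qed
  then have "card (int ` {z \<in> {0<..<l}. [laurent_value l (x(1 := z)) = h] (mod int l)}) \<le> card {z \<in> {0..<int l}. int l dvd poly Q z}"
    by (rule card_mono[rotated]) (rule finite_subset[of _ "{0..<int l}"], auto)
  also have "\<dots> \<le> N" using card_roots_mod_prime_le[OF _ degQ cQ] l(1) by simp
  finally show ?thesis by (simp add: card_image)
qed

definition unit_tuples :: "nat \<Rightarrow> (nat \<Rightarrow> nat) set" where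
  "unit_tuples l = {1..n-1} \<rightarrow>\<^sub>E {0<..<l}"

lemma finite_unit_tuples [simp]: "finite (unit_tuples l)" unfolding unit_tuples_def by (intro finite_PiE) auto

lemma card_unit_tuples_le: "card (unit_tuples l) \<le> l ^ (n - 1)"
proof -
  have "card (unit_tuples l) = (l - 1) ^ (n - 1)" by (simp add: unit_tuples_def card_PiE)
  then show ?thesis by (simp add: power_mono)
qed

lemma card_laurent_value_level_le:
  assumes l: "prime l" "\<not> int l dvd laurent_int_coeff r_tuple top_comp"
  shows "card {x \<in> unit_tuples l. [laurent_value l x = h] (mod int l)} \<le> N * l ^ (n - 2)"
proof -
  define YY where "YY = {2..n-1} \<rightarrow>\<^sub>E {0<..<l}"
  define Z where "Z x = {z \<in> {0<..<l}. [laurent_value l (x(1 := z)) = h] (mod int l)}" for x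
  have finY: "finite YY" unfolding YY_def by (intro finite_PiE) auto
  have "card {x \<in> unit_tuples l. [laurent_value l x = h] (mod int l)} \<le> card (SIGMA y:YY. Z y)"
  proof (rule card_inj_on_le)
    let ?f = "\<lambda>x. (restrict x {2..n-1}, x 1)"
    have rec: "(restrict x {2..n-1})(1 := x 1) = x" if "x \<in> unit_tuples l" for x
    proof
      fix i show "((restrict x {2..n-1})(1 := x 1)) i = x i"
        using that n2 by (cases "i \<in> {1..n-1}") (auto simp: unit_tuples_def PiE_def extensional_def)
    qed
    show "inj_on ?f {x \<in> unit_tuples l. [laurent_value l x = h] (mod int l)}"
      by (rule inj_onI) (metis (no_types, lifting) mem_Collect_eq prod.inject rec)
    show "?f ` {x \<in> unit_tuples l. [laurent_value l x = h] (mod int l)} \<subseteq> (SIGMA y:YY. Z y)"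
    proof
      fix v assume "v \<in> ?f ` {x \<in> unit_tuples l. [laurent_value l x = h] (mod int l)}"
      then obtain x where x: "v = ?f x" "x \<in> unit_tuples l" "[laurent_value l x = h] (mod int l)" by auto
      have "restrict x {2..n-1} \<in> YY" using x(2) by (auto simp: YY_def unit_tuples_def)
      moreover have "x 1 \<in> {0<..<l}" using x(2) n2 unfolding unit_tuples_def by (intro PiE_mem[of x "{1..n-1}"]) auto
      then have "x 1 \<in> Z (restrict x {2..n-1})" using x(3) rec[OF x(2)] by (simp add: Z_def)
      ultimately show "v \<in> (SIGMA y:YY. Z y)" using x(1) by simp
    qed
    show "finite (SIGMA y:YY. Z y)" using finY by (intro finite_SigmaI) (auto simp: Z_def)
  qed
  also have "\<dots> = (\<Sum>y\<in>YY. card (Z y))" using finY by (intro card_SigmaI) (auto simp: Z_def)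
  also have "\<dots> \<le> (\<Sum>y\<in>YY. N)"
  proof (rule sum_mono)
    fix y assume "y \<in> YY"
    then show "card (Z y) \<le> N" unfolding Z_def
      by (intro card_laurent_value_fiber_le l) (auto simp: YY_def)
  qed
  also have "\<dots> = N * (l - 1) ^ (n - 2)"
  proof -
    have "card {2..n-1} = n - 2" using n2 by simp
    then show ?thesis by (simp add: YY_def card_PiE mult.commute)
  qed
  also have "\<dots> \<le> N * l ^ (n - 2)" by (intro mult_left_mono power_mono) auto
  finally show ?thesis .
qed

section \<open>Moments of complete exponential sums\<close>

definition exp_sum_mod :: "nat \<Rightarrow> int \<Rightarrow> complex" where
  "exp_sum_mod l a = (\<Sum>x\<in>unit_tuples l. unit_exp (real_of_int (a * laurent_value l x) / real l))"

lemma exp_sum_mod_cong: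
  assumes "[a = b] (mod int l)" "l > 0"
  shows "exp_sum_mod l a = exp_sum_mod l b"
  unfolding exp_sum_mod_def
proof (intro sum.cong refl unit_exp_cong)
  fix x
  obtain j where "a - b = int l * j" using assms(1) by (auto simp: cong_iff_dvd_diff)
  then have "a * laurent_value l x - b * laurent_value l x = int l * (j * laurent_value l x)" by (simp add: left_diff_distrib[symmetric])
  then have "real_of_int (a * laurent_value l x - b * laurent_value l x) = real l * of_int (j * laurent_value l x)" by simp
  then have "real_of_int (a * laurent_value l x) / real l - real_of_int (b * laurent_value l x) / real l = of_int (j * laurent_value l x)"
    using assms(2) by (simp add: field_simps)
  then show "real_of_int (a * laurent_value l x) / real l - real_of_int (b * laurent_value l x) / real l \<in> \<int>" by (metis Ints_of_int)
qed

text \<open>Expanding the square and summing over a leaves the pairs with equal values modulo l,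
  each with weight l; the level set bound counts them.\<close>

lemma sum_exp_sum_mod_square_le:
  assumes l: "prime l" "\<not> int l dvd laurent_int_coeff r_tuple top_comp"
  shows "(\<Sum>a<l. cmod (exp_sum_mod l (int a)) ^ 2) \<le> real l * (real N * real l ^ (2 * n - 3))"
proof -
  have l0: "l > 0" using l prime_gt_0_nat by blast
  have "complex_of_real (\<Sum>a<l. cmod (exp_sum_mod l (int a)) ^ 2) = (\<Sum>a<l. exp_sum_mod l (int a) * cnj (exp_sum_mod l (int a)))"
    by (simp only: of_real_sum complex_norm_square)
  also have "\<dots> = (\<Sum>a<l. \<Sum>x\<in>unit_tuples l. \<Sum>x'\<in>unit_tuples l. unit_exp (real a * real_of_int (laurent_value l x - laurent_value l x') / real l))"
    unfolding exp_sum_mod_def cnj_sum sum_product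
  proof (intro sum.cong refl)
    fix a x x'
    have "real a * real_of_int (laurent_value l x - laurent_value l x') / real l = real_of_int (int a * laurent_value l x) / real l + - (real_of_int (int a * laurent_value l x') / real l)"
      by (simp add: right_diff_distrib diff_divide_distrib)
    then show "unit_exp (real_of_int (int a * laurent_value l x) / real l) * cnj (unit_exp (real_of_int (int a * laurent_value l x') / real l)) =
       unit_exp (real a * real_of_int (laurent_value l x - laurent_value l x') / real l)"
      by (simp only: cnj_unit_exp unit_exp_add)
  qed
  also have "\<dots> = (\<Sum>x\<in>unit_tuples l. \<Sum>x'\<in>unit_tuples l. \<Sum>a<l. unit_exp (real a * real_of_int (laurent_value l x - laurent_value l x') / real l))"
    by (subst sum.swap, intro sum.cong refl, subst sum.swap) simp
  also have "\<dots> = (\<Sum>x\<in>unit_tuples l. \<Sum>x'\<in>unit_tuples l. if int l dvd laurent_value l x - laurent_value l x' then of_nat l else 0)"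
    by (simp only: sum_unit_exp[OF l0])
  also have "\<dots> = (\<Sum>x\<in>unit_tuples l. of_nat l * of_nat (card {x' \<in> unit_tuples l. [laurent_value l x' = laurent_value l x] (mod int l)}))"
  proof (rule sum.cong[OF refl])
    fix x
    have "(\<Sum>x'\<in>unit_tuples l. if int l dvd laurent_value l x - laurent_value l x' then of_nat l else 0) = (\<Sum>x'\<in>{x' \<in> unit_tuples l. int l dvd laurent_value l x - laurent_value l x'}. (of_nat l :: complex))"
      by (rule sum.inter_filter[symmetric]) simp
    also have "{x' \<in> unit_tuples l. int l dvd laurent_value l x - laurent_value l x'} = {x' \<in> unit_tuples l. [laurent_value l x' = laurent_value l x] (mod int l)}"
      by (auto simp: cong_iff_dvd_diff dvd_diff_commute)
    finally show "(\<Sum>x'\<in>unit_tuples l. if int l dvd laurent_value l x - laurent_value l x' then of_nat l else 0) = (of_nat l * of_nat (card {x' \<in> unit_tuples l. [laurent_value l x' = laurent_value l x] (mod int l)}) :: complex)"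
      by (simp add: mult.commute)
  qed
  also have "\<dots> = complex_of_real (\<Sum>x\<in>unit_tuples l. real l * real (card {x' \<in> unit_tuples l. [laurent_value l x' = laurent_value l x] (mod int l)}))" by simp
  finally have "(\<Sum>a<l. cmod (exp_sum_mod l (int a)) ^ 2) = (\<Sum>x\<in>unit_tuples l. real l * real (card {x' \<in> unit_tuples l. [laurent_value l x' = laurent_value l x] (mod int l)}))"
    by (simp only: of_real_eq_iff)
  also have "\<dots> \<le> (\<Sum>x\<in>unit_tuples l. real l * real (N * l ^ (n - 2)))"
    by (intro sum_mono mult_left_mono) (use card_laurent_value_level_le[OF l] in \<open>simp_all only: of_nat_le_iff of_nat_0_le_iff\<close>)
  also have "\<dots> = real (card (unit_tuples l)) * (real l * real (N * l ^ (n - 2)))" by simp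
  also have "\<dots> \<le> real (l ^ (n - 1)) * (real l * real (N * l ^ (n - 2)))"
    using card_unit_tuples_le[of l] by (intro mult_right_mono) (simp_all only: of_nat_le_iff, simp)
  also have "\<dots> = real l * (real N * (real l ^ (n - 1) * real l ^ (n - 2)))" by simp
  also have "real l ^ (n - 1) * real l ^ (n - 2) = real l ^ (2 * n - 3)"
    using n2 by (simp add: power_add[symmetric]) (rule arg_cong[where f = "power (real l)"], simp)
  finally show ?thesis .
qed

text \<open>Cauchy-Schwarz. The trivial bound is l^n, so on average over a the saving is sqrt l, up
  to a constant.\<close>

lemma sum_exp_sum_mod_le:
  assumes l: "prime l" "\<not> int l dvd laurent_int_coeff r_tuple top_comp"
  shows "(\<Sum>a<l. cmod (exp_sum_mod l (int a))) \<le> real l ^ n * sqrt (real N) / sqrt (real l)"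
proof (rule power2_le_imp_le)
  have l0: "l > 0" using l prime_gt_0_nat by blast
  have "(\<Sum>a<l. cmod (exp_sum_mod l (int a))) ^ 2 \<le> (\<Sum>a<l. cmod (exp_sum_mod l (int a)) ^ 2) * real (card {..<l})"
    by (rule sum_squared_le_sum_of_squares)
  also have "\<dots> \<le> real l * (real N * real l ^ (2 * n - 3)) * real l"
    using sum_exp_sum_mod_square_le[OF l] by (simp add: mult_right_mono)
  also have "\<dots> = real N * (real l ^ (2 * n - 3) * real l ^ 2)" by (simp add: power2_eq_square)
  also have "real l ^ (2 * n - 3) * real l ^ 2 = real l ^ (2 * n) / real l"
  proof -
    have "2 * n = (2 * n - 3) + 2 + 1" using n2 by simp
    then have "real l ^ (2 * n) = real l ^ (2 * n - 3) * real l ^ 2 * real l" by (metis power_add power_one_right)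
    then show ?thesis using l0 by simp
  qed
  also have "real N * (real l ^ (2 * n) / real l) = (real l ^ n * sqrt (real N) / sqrt (real l)) ^ 2"
    by (simp add: power_divide power_mult_distrib power_mult[symmetric] mult.commute)
  finally show "(\<Sum>a<l. cmod (exp_sum_mod l (int a))) ^ 2 \<le> (real l ^ n * sqrt (real N) / sqrt (real l)) ^ 2" .
qed simp

end

subsection \<open>Equidistribution\<close>

lemma sum_UN_le:
  fixes f :: "'a \<Rightarrow> real"
  assumes "finite I" "\<And>i. i \<in> I \<Longrightarrow> finite (A i)" "\<And>x. f x \<ge> 0"
  shows "sum f (\<Union>i\<in>I. A i) \<le> (\<Sum>i\<in>I. sum f (A i))"
  using assms(1,2)
proof (induction I)
  case (insert i I)
  have "sum f (A i \<union> (\<Union>i\<in>I. A i)) \<le> sum f (A i) + sum f (\<Union>i\<in>I. A i)"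
    using insert assms(3) by (subst sum_Un) (auto intro!: sum_nonneg)
  then show ?case using insert by (simp add: order_trans)
qed simp

context dedekind_setup
begin

section \<open>Weyl sums and their reduction modulo a prime\<close>

definition reduced_tuples :: "nat \<Rightarrow> (nat \<Rightarrow> nat) set" where
  "reduced_tuples q = {1..n-1} \<rightarrow>\<^sub>E reduced_residues q"

lemma finite_reduced_tuples [simp]: "finite (reduced_tuples q)" unfolding reduced_tuples_def by (intro finite_PiE) auto

lemma card_reduced_tuples: "card (reduced_tuples q) = card (reduced_residues q) ^ (n - 1)"
  by (simp add: reduced_tuples_def card_PiE)

lemma card_reduced_tuples_le: "card (reduced_tuples q) \<le> q ^ (n - 1)"
  unfolding card_reduced_tuples by (intro power_mono card_reduced_residues_le) simp

definition weyl_sum :: "int \<Rightarrow> nat \<Rightarrow> complex" where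
  "weyl_sum k q = (\<Sum>p\<in>reduced_tuples q. unit_exp (real_of_int k * dedekind_value q p))"

lemma cmod_weyl_sum_le: "cmod (weyl_sum k q) \<le> real q ^ (n - 1)"
proof -
  have "cmod (weyl_sum k q) \<le> (\<Sum>p\<in>reduced_tuples q. cmod (unit_exp (real_of_int k * dedekind_value q p)))" unfolding weyl_sum_def by (rule norm_sum)
  also have "\<dots> = real (card (reduced_tuples q))" by simp
  also have "\<dots> \<le> real q ^ (n - 1)" using card_reduced_tuples_le[of q] by (metis of_nat_le_iff of_nat_power)
  finally show ?thesis .
qed

lemma dedekind_value_diff:
  assumes l: "prime l" and lm: "\<not> l dvd m" "m > 0" and q: "q = l * m"
    and c: "[c * int m = 1] (mod int l)"
    and p: "p \<in> reduced_tuples q" "p' \<in> reduced_tuples q" "\<And>i. i \<in> {1..n-1} \<Longrightarrow> [p i = p' i] (mod m)"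
  shows "dedekind_value q p - dedekind_value q p' - real_of_int (c * (laurent_value l p - laurent_value l p')) / real l \<in> \<int>"
proof -
  have l2: "l \<ge> 2" using l prime_ge_2_nat by blast
  have q2: "q \<ge> 2" using mult_le_mono[of 2 l 1 m] l2 lm by (simp add: q)
  define w where "w = p(n := q - 1)"
  define w' where "w' = p'(n := q - 1)"
  have pi: "p i \<in> reduced_residues q" "p' i \<in> reduced_residues q" if "i \<in> {1..n-1}" for i
    using PiE_mem[of p "{1..n-1}"] PiE_mem[of p' "{1..n-1}"] p(1,2) that unfolding reduced_tuples_def by blast+
  have n1: "i \<in> {1..n-1}" if "i \<in> {1..n}" "i \<noteq> n" for i using that by auto
  have cq: "coprime (q - 1) q" by (rule coprime_diff_one_left_nat) (use q2 in simp)
  have w: "w i > 0" "coprime (w i) q" "w' i > 0" "coprime (w' i) q" "[w i = w' i] (mod m)" if "i \<in> {1..n}" for i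
    using pi[of i] p(3)[of i] n1[OF that] q2 cq
    by (cases "i = n"; simp add: w_def w'_def reduced_residues_def)+
  \<comment> \<open>As l divides q, both last entries represent -1.\<close>
  have "[q - 1 = l - 1] (mod l)"
  proof -
    have "q - 1 + 1 = q" "l - 1 + 1 = l" using q2 l2 by auto
    moreover have "[q = l] (mod l)" by (simp add: q cong_def)
    ultimately have "[q - 1 + 1 = l - 1 + 1] (mod l)" by (simp only:)
    then show ?thesis by (simp only: cong_add_rcancel_nat)
  qed
  then have hw: "[laurent_mod_sum (inv_mod l) r_tuple w = laurent_value l p] (mod int l)" "[laurent_mod_sum (inv_mod l) r_tuple w' = laurent_value l p'] (mod int l)"
    unfolding laurent_value_def w_def w'_def by (intro laurent_mod_sum_cong; simp)+
  then have "[c * (laurent_mod_sum (inv_mod l) r_tuple w - laurent_mod_sum (inv_mod l) r_tuple w') = c * (laurent_value l p - laurent_value l p')] (mod int l)"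
    by (intro cong_mult cong_diff cong_refl)
  then obtain j where j: "c * (laurent_mod_sum (inv_mod l) r_tuple w - laurent_mod_sum (inv_mod l) r_tuple w') - c * (laurent_value l p - laurent_value l p') = int l * j"
    by (auto simp: cong_iff_dvd_diff)
  have "of_int d * dedekind_coeff n q w r_tuple - of_int d * dedekind_coeff n q w' r_tuple
     - of_int (c * (laurent_mod_sum (inv_mod l) r_tuple w - laurent_mod_sum (inv_mod l) r_tuple w')) / of_nat l \<in> \<int>"
    by (rule dedekind_coeff_diff_Ints[OF l lm q _ _ _ _ _ _ c r_tuple_comp]) (use w inv_mod[OF l] in blast)+
  then obtain z where z: "of_int d * dedekind_coeff n q w r_tuple - of_int d * dedekind_coeff n q w' r_tuple
     - of_int (c * (laurent_mod_sum (inv_mod l) r_tuple w - laurent_mod_sum (inv_mod l) r_tuple w')) / of_nat l = (of_int z :: complex)"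
    by (elim Ints_cases)
  have q0: "q > 0" using q2 by simp
  have l0: "real l \<noteq> 0" using l2 by simp
  have "complex_of_real (dedekind_value q p - dedekind_value q p' - real_of_int (c * (laurent_mod_sum (inv_mod l) r_tuple w - laurent_mod_sum (inv_mod l) r_tuple w')) / real l) = of_int z"
    unfolding z[symmetric] w_def w'_def dedekind_value_eq[OF q0, symmetric] by simp
  then have "dedekind_value q p - dedekind_value q p' - real_of_int (c * (laurent_mod_sum (inv_mod l) r_tuple w - laurent_mod_sum (inv_mod l) r_tuple w')) / real l = of_int z"
    by (metis of_real_eq_iff of_real_of_int_eq)
  moreover have "real_of_int (c * (laurent_mod_sum (inv_mod l) r_tuple w - laurent_mod_sum (inv_mod l) r_tuple w')) = real_of_int (c * (laurent_value l p - laurent_value l p')) + real l * of_int j"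
  proof -
    have "c * (laurent_mod_sum (inv_mod l) r_tuple w - laurent_mod_sum (inv_mod l) r_tuple w') = c * (laurent_value l p - laurent_value l p') + int l * j" using j by linarith
    then show ?thesis by (simp only: of_int_add of_int_mult of_int_of_nat_eq)
  qed
  ultimately have "dedekind_value q p - dedekind_value q p' - real_of_int (c * (laurent_value l p - laurent_value l p')) / real l = of_int (z + j)"
    using l0 by (simp add: add_divide_distrib)
  then show ?thesis by (metis Ints_of_int)
qed

text \<open>Chinese remainder theorem: once the classes modulo m are fixed, the residues modulo l
  run freely over the units.\<close>

lemma reduction_bij:
  assumes l: "prime l" and lm: "\<not> l dvd m" "m > 0" and q: "q = l * m" and p0: "p0 \<in> reduced_tuples q"
  shows "bij_betw (\<lambda>p. \<lambda>i\<in>{1..n-1}. p i mod l)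
    {p \<in> reduced_tuples q. (\<lambda>i\<in>{1..n-1}. p i mod m) = (\<lambda>i\<in>{1..n-1}. p0 i mod m)} (unit_tuples l)"
    (is "bij_betw ?\<pi> ?A _")
proof (rule bij_betwI')
  have l1: "l > 1" using l prime_gt_1_nat by blast
  have cop: "coprime l m" using l lm prime_imp_coprime by blast
  have red: "p i < q" "coprime (p i) q" if "p \<in> reduced_tuples q" "i \<in> {1..n-1}" for p i
    using PiE_mem[of p "{1..n-1}" "\<lambda>_. reduced_residues q" i] that
    by (simp_all add: reduced_tuples_def reduced_residues_def)
  {
    fix p p' assume p: "p \<in> ?A" "p' \<in> ?A"
    show "?\<pi> p = ?\<pi> p' \<longleftrightarrow> p = p'"
    proof
      assume e: "?\<pi> p = ?\<pi> p'"
      show "p = p'"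
      proof (rule PiE_ext)
        show "p \<in> {1..n-1} \<rightarrow>\<^sub>E reduced_residues q" "p' \<in> {1..n-1} \<rightarrow>\<^sub>E reduced_residues q"
          using p by (auto simp: reduced_tuples_def)
        fix i assume i: "i \<in> {1..n-1}"
        have "[p i = p' i] (mod l)" using fun_cong[OF e, of i] i by (simp add: cong_def)
        moreover have "(\<lambda>i\<in>{1..n-1}. p i mod m) i = (\<lambda>i\<in>{1..n-1}. p' i mod m) i" using p by simp
        then have "[p i = p' i] (mod m)" using i by (simp add: cong_def)
        ultimately have "[p i = p' i] (mod l * m)" using cop by (rule coprime_cong_mult_nat)
        then show "p i = p' i" using red(1)[of p i] red(1)[of p' i] p i q by (simp add: cong_def)
      qed
    qed simp
  next
    fix p assume p: "p \<in> ?A"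
    show "?\<pi> p \<in> unit_tuples l"
      unfolding unit_tuples_def
    proof (rule restrict_PiE_iff[THEN iffD2], rule ballI)
      fix i assume i: "i \<in> {1..n-1}"
      have "coprime (p i) l" using red(2)[of p i] p i q by simp
      then have "\<not> l dvd p i" using l by (metis coprime_absorb_right not_prime_unit)
      then show "p i mod l \<in> {0<..<l}" using l1 by (simp add: dvd_eq_mod_eq_0)
    qed
  next
    fix x assume x: "x \<in> unit_tuples l"
    have "\<exists>y. y < l * m \<and> [y = x i] (mod l) \<and> [y = p0 i] (mod m)" for i
      using binary_chinese_remainder_unique_nat[OF cop, of "x i" "p0 i"] l1 lm by (metis gr_implies_not0)
    then obtain g where g: "\<And>i. g i < l * m" "\<And>i. [g i = x i] (mod l)" "\<And>i. [g i = p0 i] (mod m)" by metis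
    define p where "p = restrict g {1..n-1}"
    have xi: "x i \<in> {0<..<l}" if "i \<in> {1..n-1}" for i using x that unfolding unit_tuples_def by (rule PiE_mem)
    have "g i \<in> reduced_residues q" if i: "i \<in> {1..n-1}" for i
    proof -
      have "\<not> l dvd x i" using xi[OF i] by (auto dest: dvd_imp_le)
      then have nd: "\<not> l dvd g i" using g(2)[of i] by (simp add: cong_def dvd_eq_mod_eq_0)
      then have "coprime (g i) l" using prime_imp_coprime[OF l nd] by (simp only: coprime_commute)
      moreover have "coprime (p0 i) m" using red(2)[OF p0 i] q by simp
      then have "coprime (g i) m" using cong_imp_coprime[OF cong_sym[OF g(3)[of i]]] by blast
      moreover have "g i > 0" using nd by (cases "g i") auto
      ultimately show ?thesis using g(1)[of i] by (simp add: reduced_residues_def q)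
    qed
    then have "p \<in> reduced_tuples q" by (simp add: reduced_tuples_def p_def)
    moreover have "(\<lambda>i\<in>{1..n-1}. p i mod m) = (\<lambda>i\<in>{1..n-1}. p0 i mod m)"
      using g(3) by (intro restrict_ext) (simp add: p_def cong_def)
    moreover have "x = ?\<pi> p"
    proof (rule PiE_ext)
      show "x \<in> {1..n-1} \<rightarrow>\<^sub>E UNIV" "?\<pi> p \<in> {1..n-1} \<rightarrow>\<^sub>E UNIV" using x by (auto simp: unit_tuples_def)
      fix i assume i: "i \<in> {1..n-1}"
      then show "x i = ?\<pi> p i" using g(2)[of i] xi[OF i] by (simp add: p_def cong_def)
    qed
    ultimately show "\<exists>p\<in>?A. x = ?\<pi> p" by blast
  }
qed

text \<open>Within a class modulo m the phase is, modulo integers, a constant plus k c / l times the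
  Laurent polynomial. All inner sums thus have the same absolute value, and there are at most
  m^(n-1) of them.\<close>

lemma cmod_weyl_sum_le_exp_sum_mod:
  assumes l: "prime l" and lm: "\<not> l dvd m" "m > 0" and c: "[c * int m = 1] (mod int l)"
  shows "cmod (weyl_sum k (l * m)) \<le> real m ^ (n - 1) * cmod (exp_sum_mod l (k * c))"
proof -
  define q where "q = l * m"
  define \<rho> where "\<rho> p = (\<lambda>i\<in>{1..n-1}. p i mod m)" for p :: "nat \<Rightarrow> nat"
  have l0: "l > 0" using l prime_gt_0_nat by blast
  have inner: "cmod (\<Sum>p\<in>{p \<in> reduced_tuples q. \<rho> p = y}. unit_exp (real_of_int k * dedekind_value q p)) = cmod (exp_sum_mod l (k * c))" if y: "y \<in> \<rho> ` reduced_tuples q" for y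
  proof -
    obtain p0 where p0: "p0 \<in> reduced_tuples q" "y = \<rho> p0" using y by auto
    define A where "A = {p \<in> reduced_tuples q. \<rho> p = y}"
    define u where "u = unit_exp (real_of_int k * dedekind_value q p0 - real_of_int (k * c * laurent_value l p0) / real l)"
    have "(\<Sum>p\<in>A. unit_exp (real_of_int k * dedekind_value q p)) = (\<Sum>p\<in>A. u * unit_exp (real_of_int (k * c * laurent_value l (\<lambda>i\<in>{1..n-1}. p i mod l)) / real l))"
    proof (rule sum.cong[OF refl])
      fix p assume "p \<in> A"
      then have p: "p \<in> reduced_tuples q" "\<rho> p = \<rho> p0" by (auto simp: A_def p0)
      have "[p i = p0 i] (mod m)" if "i \<in> {1..n-1}" for i
        using fun_cong[OF p(2), of i] that by (simp add: \<rho>_def cong_def)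
      then have "dedekind_value q p - dedekind_value q p0 - real_of_int (c * (laurent_value l p - laurent_value l p0)) / real l \<in> \<int>"
        using p p0 by (intro dedekind_value_diff[OF l lm q_def c]) auto
      then obtain z1 where z1: "dedekind_value q p - dedekind_value q p0 - real_of_int (c * (laurent_value l p - laurent_value l p0)) / real l = of_int z1" by (elim Ints_cases)
      have "[laurent_value l p = laurent_value l (\<lambda>i\<in>{1..n-1}. p i mod l)] (mod int l)"
        unfolding laurent_value_def by (rule laurent_mod_sum_cong) (auto simp: cong_def)
      then obtain j where "laurent_value l p - laurent_value l (\<lambda>i\<in>{1..n-1}. p i mod l) = int l * j" by (auto simp: cong_iff_dvd_diff)
      then have j: "laurent_value l p = laurent_value l (\<lambda>i\<in>{1..n-1}. p i mod l) + int l * j" by linarith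
      have "real_of_int k * dedekind_value q p = real_of_int k * dedekind_value q p0 + real_of_int (k * (c * (laurent_value l p - laurent_value l p0))) / real l + of_int (k * z1)"
      proof -
        have "dedekind_value q p = dedekind_value q p0 + real_of_int (c * (laurent_value l p - laurent_value l p0)) / real l + of_int z1" using z1 by linarith
        then show ?thesis by (simp add: distrib_left)
      qed
      also have "\<dots> = (real_of_int k * dedekind_value q p0 - real_of_int (k * c * laurent_value l p0) / real l) +
          real_of_int (k * c * laurent_value l (\<lambda>i\<in>{1..n-1}. p i mod l)) / real l + of_int (k * c * j + k * z1)"
        unfolding j using l0 by (simp add: field_simps)
      finally have "real_of_int k * dedekind_value q p - ((real_of_int k * dedekind_value q p0 - real_of_int (k * c * laurent_value l p0) / real l) +
          real_of_int (k * c * laurent_value l (\<lambda>i\<in>{1..n-1}. p i mod l)) / real l) = of_int (k * c * j + k * z1)" by simp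
      then have "real_of_int k * dedekind_value q p - ((real_of_int k * dedekind_value q p0 - real_of_int (k * c * laurent_value l p0) / real l) +
          real_of_int (k * c * laurent_value l (\<lambda>i\<in>{1..n-1}. p i mod l)) / real l) \<in> \<int>" by (metis Ints_of_int)
      then show "unit_exp (real_of_int k * dedekind_value q p) = u * unit_exp (real_of_int (k * c * laurent_value l (\<lambda>i\<in>{1..n-1}. p i mod l)) / real l)"
        unfolding u_def unit_exp_add[symmetric] by (rule unit_exp_cong)
    qed
    also have "\<dots> = (\<Sum>x\<in>unit_tuples l. u * unit_exp (real_of_int (k * c * laurent_value l x) / real l))"
      using sum.reindex_bij_betw[OF reduction_bij[OF l lm q_def p0(1)], of "\<lambda>x. u * unit_exp (real_of_int (k * c * laurent_value l x) / real l)"]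
      by (simp add: A_def p0(2) \<rho>_def)
    also have "\<dots> = u * exp_sum_mod l (k * c)" by (simp add: exp_sum_mod_def sum_distrib_left)
    finally show ?thesis by (simp add: A_def norm_mult u_def)
  qed
  have eq: "weyl_sum k q = (\<Sum>y\<in>\<rho> ` reduced_tuples q. \<Sum>p\<in>{p \<in> reduced_tuples q. \<rho> p = y}. unit_exp (real_of_int k * dedekind_value q p))"
    unfolding weyl_sum_def by (rule sum.image_gen) simp
  have "cmod (weyl_sum k q) \<le> (\<Sum>y\<in>\<rho> ` reduced_tuples q. cmod (\<Sum>p\<in>{p \<in> reduced_tuples q. \<rho> p = y}. unit_exp (real_of_int k * dedekind_value q p)))"
    unfolding eq by (rule norm_sum)
  also have "\<dots> = real (card (\<rho> ` reduced_tuples q)) * cmod (exp_sum_mod l (k * c))" using inner by simp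
  also have "\<dots> \<le> real m ^ (n - 1) * cmod (exp_sum_mod l (k * c))"
  proof (rule mult_right_mono)
    have "\<rho> ` reduced_tuples q \<subseteq> {1..n-1} \<rightarrow>\<^sub>E {..<m}" using lm by (auto simp: \<rho>_def)
    then have "card (\<rho> ` reduced_tuples q) \<le> card ({1..n-1} \<rightarrow>\<^sub>E {..<m})" by (intro card_mono finite_PiE) auto
    also have "\<dots> = m ^ (n - 1)" by (simp add: card_PiE)
    finally show "real (card (\<rho> ` reduced_tuples q)) \<le> real m ^ (n - 1)" by (metis of_nat_le_iff of_nat_power)
  qed simp
  finally show ?thesis by (simp add: q_def)
qed

text \<open>The map taking m to k/m permutes the nonzero residues modulo l, so in each block of l
  consecutive integers every nonzero twist of the exponential sum occurs once. There are at most M /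
  l^2 + 1 blocks.\<close>

lemma sum_weyl_sum_multiples_le:
  assumes l: "prime l" "\<not> int l dvd laurent_int_coeff r_tuple top_comp" "\<not> int l dvd k"
  shows "(\<Sum>m | m \<in> {1..M div l} \<and> \<not> l dvd m. cmod (weyl_sum k (l * m))) \<le>
    sqrt (real N) * real M ^ (n - 1) * (real M / (real l * sqrt (real l)) + real l)"
proof -
  define \<tau> where "\<tau> j = cmod (exp_sum_mod l (k * inv_mod l j))" for j
  define M' where "M' = M div l"
  have l0: "l > 0" "l \<ge> 1" using l prime_gt_0_nat[of l] by auto
  have rM: "real M' \<le> real M / real l" unfolding M'_def by (rule of_nat_div_le_of_nat)
  let ?B = "{m \<in> {1..M'}. \<not> l dvd m}"
  have "(\<Sum>m\<in>?B. cmod (weyl_sum k (l * m))) \<le> (\<Sum>m\<in>?B. real M' ^ (n - 1) * \<tau> (m mod l))"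
  proof (rule sum_mono)
    fix m assume m: "m \<in> ?B"
    then have "[inv_mod l m * int m = 1] (mod int l)" using inv_mod[OF l(1), of m] by (simp add: mult.commute)
    then have "cmod (weyl_sum k (l * m)) \<le> real m ^ (n - 1) * cmod (exp_sum_mod l (k * inv_mod l m))"
      using m by (intro cmod_weyl_sum_le_exp_sum_mod l) auto
    also have "inv_mod l m = inv_mod l (m mod l)" by (rule inv_mod_cong) (simp add: cong_def)
    also have "real m ^ (n - 1) * cmod (exp_sum_mod l (k * inv_mod l (m mod l))) \<le> real M' ^ (n - 1) * \<tau> (m mod l)"
      unfolding \<tau>_def using m by (intro mult_right_mono power_mono) auto
    finally show "cmod (weyl_sum k (l * m)) \<le> real M' ^ (n - 1) * \<tau> (m mod l)" .
  qed
  also have "\<dots> = real M' ^ (n - 1) * (\<Sum>m\<in>?B. \<tau> (m mod l))" by (simp add: sum_distrib_left)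
  also have "(\<Sum>m\<in>?B. \<tau> (m mod l)) \<le> (\<Sum>m\<in>(\<lambda>(a, j). a * l + j) ` ({..M' div l} \<times> {0<..<l}). \<tau> (m mod l))"
  proof (rule sum_mono2)
    show "?B \<subseteq> (\<lambda>(a, j). a * l + j) ` ({..M' div l} \<times> {0<..<l})"
    proof
      fix m assume m: "m \<in> ?B"
      have "m = (m div l) * l + m mod l" by simp
      moreover have "m div l \<le> M' div l" using m by (intro div_le_mono) auto
      moreover have "m mod l \<in> {0<..<l}" using m l0 by (auto simp: dvd_eq_mod_eq_0)
      ultimately show "m \<in> (\<lambda>(a, j). a * l + j) ` ({..M' div l} \<times> {0<..<l})"
        by (intro image_eqI[of _ _ "(m div l, m mod l)"]) auto
    qed
  qed (auto simp: \<tau>_def)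
  also have "\<dots> = (\<Sum>(a, j)\<in>{..M' div l} \<times> {0<..<l}. \<tau> j)"
  proof -
    have "inj_on (\<lambda>(a, j). a * l + j) ({..M' div l} \<times> {0<..<l})"
    proof (rule inj_onI, clarify)
      fix a j a' j' assume j: "j \<in> {0<..<l}" "j' \<in> {0<..<l}" and e: "a * l + j = a' * l + j'"
      have "(a * l + j) mod l = j" "(a' * l + j') mod l = j'" "(a * l + j) div l = a" "(a' * l + j') div l = a'"
        using j by auto
      then show "a = a' \<and> j = j'" using e by metis
    qed
    then show ?thesis by (simp add: sum.reindex case_prod_unfold) (intro sum.cong refl, auto)
  qed
  also have "\<dots> = real (M' div l + 1) * (\<Sum>j\<in>{0<..<l}. \<tau> j)" by (simp add: sum.cartesian_product[symmetric])
  also have "\<dots> \<le> (real M' / real l + 1) * (\<Sum>j\<in>{0<..<l}. \<tau> j)"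
    by (intro mult_right_mono sum_nonneg) (auto simp: \<tau>_def of_nat_div_le_of_nat)
  also have "\<dots> \<le> (real M' / real l + 1) * (\<Sum>a<l. cmod (exp_sum_mod l (int a)))"
  proof (rule mult_left_mono)
    \<comment> \<open>\<open>g\<close> is this permutation, with representatives in
      \<open>{..<l}\<close>; its injectivity uses that l does not divide k.\<close>
    define g where "g j = nat ((k * inv_mod l j) mod int l)" for j
    have gi: "int (g j) = (k * inv_mod l j) mod int l" for j using l0 by (simp add: g_def)
    have tg: "\<tau> j = cmod (exp_sum_mod l (int (g j)))" for j
      unfolding \<tau>_def gi using l0 by (intro arg_cong[where f = cmod] exp_sum_mod_cong) (auto simp: cong_def)
    have nd: "\<not> l dvd j" if "j \<in> {0<..<l}" for j using that by (auto dest: dvd_imp_le)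
    have "inj_on g {0<..<l}"
    proof (rule inj_onI)
      fix i j assume ij: "i \<in> {0<..<l}" "j \<in> {0<..<l}" "g i = g j"
      then have "[k * inv_mod l i = k * inv_mod l j] (mod int l)" using gi[of i] gi[of j] by (simp add: cong_def)
      moreover have "coprime (int l) k" using l(1,3) by (intro prime_imp_coprime) auto
      then have "coprime k (int l)" by (simp only: coprime_commute)
      ultimately have e: "[inv_mod l i = inv_mod l j] (mod int l)" by (simp add: cong_mult_lcancel)
      have "[int j * (int i * inv_mod l i) = int j * 1] (mod int l)"
        by (intro cong_mult cong_refl inv_mod l nd ij)
      moreover have "[int i * (int j * inv_mod l j) = int i * 1] (mod int l)"
        by (intro cong_mult cong_refl inv_mod l nd ij)
      moreover have "[int j * (int i * inv_mod l i) = int i * (int j * inv_mod l j)] (mod int l)"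
        using cong_mult[OF cong_refl[of "int i * int j"] e] by (simp add: mult_ac)
      ultimately have "[int j = int i] (mod int l)" by (metis cong_sym cong_trans mult.right_neutral)
      then show "i = j" using ij by (simp add: cong_int_iff cong_def)
    qed
    then have "(\<Sum>j\<in>{0<..<l}. \<tau> j) = (\<Sum>a\<in>g ` {0<..<l}. cmod (exp_sum_mod l (int a)))"
      by (simp add: sum.reindex tg)
    also have "\<dots> \<le> (\<Sum>a<l. cmod (exp_sum_mod l (int a)))"
      using l0 by (intro sum_mono2) (auto simp: g_def nat_less_iff)
    finally show "(\<Sum>j\<in>{0<..<l}. \<tau> j) \<le> (\<Sum>a<l. cmod (exp_sum_mod l (int a)))" .
  qed simp
  also have "\<dots> \<le> (real M' / real l + 1) * (real l ^ n * sqrt (real N) / sqrt (real l))"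
    by (intro mult_left_mono sum_exp_sum_mod_le l) simp
  also have "\<dots> \<le> (real M / real l ^ 2 + 1) * (real l ^ n * sqrt (real N) / sqrt (real l))"
  proof (rule mult_right_mono)
    have "real M' / real l \<le> real M / real l / real l" using rM by (intro divide_right_mono) auto
    then show "real M' / real l + 1 \<le> real M / real l ^ 2 + 1" by (simp add: power2_eq_square)
  qed simp
  finally have "(\<Sum>m\<in>?B. cmod (weyl_sum k (l * m))) \<le>
      real M' ^ (n - 1) * ((real M / real l ^ 2 + 1) * (real l ^ n * sqrt (real N) / sqrt (real l)))"
    by (simp add: mult_left_mono)
  also have "\<dots> \<le> (real M / real l) ^ (n - 1) * ((real M / real l ^ 2 + 1) * (real l ^ n * sqrt (real N) / sqrt (real l)))"
    by (intro mult_right_mono power_mono rM) auto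
  also have "\<dots> = sqrt (real N) * real M ^ (n - 1) * ((real M / real l ^ 2 + 1) * (real l / sqrt (real l)))"
  proof -
    have "real l ^ n = real l ^ (n - 1) * real l" using n2 by (metis Suc_diff_1 less_le_trans pos2 power_Suc2)
    then show ?thesis using l0 by (simp add: power_divide)
  qed
  also have "(real M / real l ^ 2 + 1) * (real l / sqrt (real l)) = real M / (real l * sqrt (real l)) + real l / sqrt (real l)"
    using l0 by (simp add: field_simps power2_eq_square)
  also have "sqrt (real N) * real M ^ (n - 1) * (real M / (real l * sqrt (real l)) + real l / sqrt (real l)) \<le>
     sqrt (real N) * real M ^ (n - 1) * (real M / (real l * sqrt (real l)) + real l)"
  proof (intro mult_left_mono add_left_mono)
    show "real l / sqrt (real l) \<le> real l" using l0 by (simp add: field_simps)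
  qed auto
  finally show ?thesis by (simp add: M'_def)
qed

text \<open>The q without an exact divisor in the window are few and are bounded trivially. Every
  other q is l m with l in the window and not dividing m; counting it for several l only enlarges
  the bound.\<close>

lemma sum_cmod_weyl_sum_le:
  assumes k: "k \<noteq> 0" and e: "\<epsilon> > 0"
  shows "\<exists>C. \<forall>M. (\<Sum>q\<in>{1..<M}. cmod (weyl_sum k q)) \<le> real M ^ (n - 1) * (\<epsilon> * real M + C)"
proof -
  \<comment> \<open>Exceptional q contribute \<delta> M^n and the window contributes sqrt N times as
    much, up to terms of order M^(n-1).\<close>
  define \<delta> where "\<delta> = \<epsilon> / (1 + sqrt (real N))"
  have d0: "\<delta> > 0" unfolding \<delta>_def using e by (intro divide_pos_pos add_pos_nonneg) auto
  \<comment> \<open>Primes above \<open>y\<close> divide neither the top coefficient nor k.\<close>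
  define y where "y = nat (max \<bar>laurent_int_coeff r_tuple top_comp\<bar> \<bar>k\<bar>)"
  obtain W C where W: "finite W" "\<forall>l\<in>W. prime l \<and> l > y" "(\<Sum>l\<in>W. 1 / (real l * sqrt (real l))) \<le> \<delta>"
    "\<And>M. real (card {q \<in> {..<M}. \<forall>l\<in>W. \<not> exactly_dvd l q}) \<le> \<delta> * real M + C"
    using ex_prime_window[OF d0, of y] by blast
  have Wl: "prime l" "\<not> int l dvd laurent_int_coeff r_tuple top_comp" "\<not> int l dvd k" if "l \<in> W" for l
  proof -
    have "l > y" and pl: "prime l" using W(2) that by auto
    then have "int l > \<bar>laurent_int_coeff r_tuple top_comp\<bar>" "int l > \<bar>k\<bar>" by (auto simp: y_def)
    then show "prime l" "\<not> int l dvd laurent_int_coeff r_tuple top_comp" "\<not> int l dvd k"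
      using pl k laurent_int_coeff_top_nonzero zdvd_imp_le[of "int l" "\<bar>laurent_int_coeff r_tuple top_comp\<bar>"] zdvd_imp_le[of "int l" "\<bar>k\<bar>"]
      by (auto simp: not_less)
  qed
  have "(\<Sum>q\<in>{1..<M}. cmod (weyl_sum k q)) \<le> real M ^ (n - 1) * (\<epsilon> * real M + (C + sqrt (real N) * (\<Sum>l\<in>W. real l)))" for M
  proof -
    define A where "A = {q \<in> {..<M}. \<forall>l\<in>W. \<not> exactly_dvd l q}"
    define B where "B l = {m \<in> {1..M div l}. \<not> l dvd m}" for l
    have "{1..<M} \<subseteq> A \<union> (\<Union>l\<in>W. (\<lambda>m. l * m) ` B l)"
    proof
      fix q assume q: "q \<in> {1..<M}"
      show "q \<in> A \<union> (\<Union>l\<in>W. (\<lambda>m. l * m) ` B l)"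
      proof (cases "q \<in> A")
        case False
        then obtain l where l: "l \<in> W" "exactly_dvd l q" using q by (auto simp: A_def)
        then obtain m where m: "q = l * m" by (auto simp: exactly_dvd_def)
        have "l > 0" using Wl(1)[OF l(1)] prime_gt_0_nat by blast
        have "\<not> l dvd m" using l(2) m by (auto simp: exactly_dvd_def power2_eq_square)
        moreover have "m \<ge> 1" using q m by (cases m) auto
        moreover have "m \<le> M div l" using q m \<open>l > 0\<close> by (simp add: less_eq_div_iff_mult_less_eq mult.commute)
        ultimately show ?thesis using l(1) m by (auto simp: B_def)
      qed simp
    qed
    then have "(\<Sum>q\<in>{1..<M}. cmod (weyl_sum k q)) \<le> (\<Sum>q\<in>A \<union> (\<Union>l\<in>W. (\<lambda>m. l * m) ` B l). cmod (weyl_sum k q))"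
      by (intro sum_mono2) (auto simp: A_def B_def W(1))
    also have "\<dots> \<le> (\<Sum>q\<in>A. cmod (weyl_sum k q)) + (\<Sum>q\<in>(\<Union>l\<in>W. (\<lambda>m. l * m) ` B l). cmod (weyl_sum k q))"
      by (intro order_trans[OF eq_refl[OF sum_Un]]) (auto simp: A_def B_def W(1) intro!: sum_nonneg)
    also have "(\<Sum>q\<in>(\<Union>l\<in>W. (\<lambda>m. l * m) ` B l). cmod (weyl_sum k q)) \<le> (\<Sum>l\<in>W. \<Sum>q\<in>(\<lambda>m. l * m) ` B l. cmod (weyl_sum k q))"
      by (rule sum_UN_le) (auto simp: B_def W(1))
    also have "\<dots> = (\<Sum>l\<in>W. \<Sum>m\<in>B l. cmod (weyl_sum k (l * m)))"
    proof (rule sum.cong[OF refl])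
      fix l assume "l \<in> W"
      then have "l > 0" using Wl(1) prime_gt_0_nat by blast
      then have "inj_on (\<lambda>m. l * m) (B l)" by (auto simp: inj_on_def)
      then show "(\<Sum>q\<in>(\<lambda>m. l * m) ` B l. cmod (weyl_sum k q)) = (\<Sum>m\<in>B l. cmod (weyl_sum k (l * m)))" by (simp add: sum.reindex)
    qed
    also have "\<dots> \<le> (\<Sum>l\<in>W. sqrt (real N) * real M ^ (n - 1) * (real M * (1 / (real l * sqrt (real l))) + real l))"
    proof (rule sum_mono)
      fix l assume "l \<in> W"
      then show "(\<Sum>m\<in>B l. cmod (weyl_sum k (l * m))) \<le> sqrt (real N) * real M ^ (n - 1) * (real M * (1 / (real l * sqrt (real l))) + real l)"
        using sum_weyl_sum_multiples_le[OF Wl, of l M] by (simp add: B_def)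
    qed
    also have "\<dots> = sqrt (real N) * real M ^ (n - 1) * (real M * (\<Sum>l\<in>W. 1 / (real l * sqrt (real l))) + (\<Sum>l\<in>W. real l))"
      by (simp only: sum_distrib_left[symmetric] sum.distrib)
    also have "\<dots> \<le> sqrt (real N) * real M ^ (n - 1) * (real M * \<delta> + (\<Sum>l\<in>W. real l))"
      by (intro mult_left_mono add_right_mono W(3)) auto
    also have "(\<Sum>q\<in>A. cmod (weyl_sum k q)) \<le> real M ^ (n - 1) * (\<delta> * real M + C)"
    proof -
      have "(\<Sum>q\<in>A. cmod (weyl_sum k q)) \<le> (\<Sum>q\<in>A. real M ^ (n - 1))"
      proof (rule sum_mono)
        fix q assume "q \<in> A"
        then have "real q ^ (n - 1) \<le> real M ^ (n - 1)" by (intro power_mono) (auto simp: A_def)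
        then show "cmod (weyl_sum k q) \<le> real M ^ (n - 1)" using cmod_weyl_sum_le[of k q] by linarith
      qed
      also have "\<dots> = real M ^ (n - 1) * real (card A)" by simp
      also have "\<dots> \<le> real M ^ (n - 1) * (\<delta> * real M + C)"
        unfolding A_def by (intro mult_left_mono W(4)) auto
      finally show ?thesis .
    qed
    finally have "(\<Sum>q\<in>{1..<M}. cmod (weyl_sum k q)) \<le> real M ^ (n - 1) * (\<delta> * real M + C) +
       sqrt (real N) * real M ^ (n - 1) * (real M * \<delta> + (\<Sum>l\<in>W. real l))" by simp
    also have "\<dots> = real M ^ (n - 1) * ((\<delta> * (1 + sqrt (real N))) * real M + (C + sqrt (real N) * (\<Sum>l\<in>W. real l)))"
      by (simp add: algebra_simps)
    also have "\<delta> * (1 + sqrt (real N)) = \<epsilon>"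
    proof -
      have "1 + sqrt (real N) > 0" by (intro add_pos_nonneg) auto
      then show ?thesis by (simp add: \<delta>_def)
    qed
    finally show ?thesis .
  qed
  then show ?thesis by blast
qed

lemma sum_card_reduced_tuples_ge:
  assumes M: "M \<ge> 4"
  shows "(\<Sum>q\<in>{1..<M}. real (card (reduced_tuples q))) \<ge> (real M / 64) ^ n"
proof -
  have n1: "Suc (n - 1) = n" using n2 by simp
  \<comment> \<open>Halving the constant accounts for the range of q ending at M - 1.\<close>
  have "(real M / 64) ^ n \<le> (real (M - 1) / 32) ^ n" using M by (intro power_mono) (auto simp: of_nat_diff)
  also have "\<dots> \<le> (\<Sum>q\<in>{1..M-1}. real (card (reduced_residues q)) ^ (n - 1))"
    using sum_card_reduced_residues_power_ge[of "M - 1" "n - 1"] M n1 by simp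
  also have "{1..M-1} = {1..<M}" using M by auto
  finally show ?thesis by (simp add: card_reduced_tuples)
qed

lemma ratio_tendsto_0:
  assumes k: "k \<noteq> 0"
  shows "(\<lambda>M. (\<Sum>q\<in>{1..<M}. weyl_sum k q) / of_nat (\<Sum>q\<in>{1..<M}. card (reduced_tuples q))) \<longlonglongrightarrow> 0"
proof (rule LIMSEQ_I)
  fix e :: real assume e: "e > 0"
  \<comment> \<open>The power of 64 comes from the lower bound for the number of tuples; the factor
    2 makes room for \<open>C\<close>, which is below \<epsilon> M once M > C / \<epsilon>.\<close>
  define \<epsilon> where "\<epsilon> = e / (2 * 64 ^ n)"
  have e': "\<epsilon> > 0" using e by (simp add: \<epsilon>_def)
  obtain C where C: "\<And>M. (\<Sum>q\<in>{1..<M}. cmod (weyl_sum k q)) \<le> real M ^ (n - 1) * (\<epsilon> * real M + C)"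
    using sum_cmod_weyl_sum_le[OF k e'] by blast
  obtain M0 :: nat where M0: "real M0 > C / \<epsilon>" using reals_Archimedean2 by blast
  show "\<exists>no. \<forall>M\<ge>no. norm ((\<Sum>q\<in>{1..<M}. weyl_sum k q) / of_nat (\<Sum>q\<in>{1..<M}. card (reduced_tuples q)) - 0) < e"
  proof (intro exI[of _ "max 4 M0"] allI impI)
    fix M assume M: "M \<ge> max 4 M0"
    define D where "D = (\<Sum>q\<in>{1..<M}. real (card (reduced_tuples q)))"
    have Mpos: "real M > 0" using M by simp
    have D: "D \<ge> (real M / 64) ^ n" unfolding D_def using M by (intro sum_card_reduced_tuples_ge) simp
    have Dpos: "D > 0" using D Mpos by (meson less_le_trans divide_pos_pos zero_less_numeral zero_less_power)
    have "real M > C / \<epsilon>" using M M0 by (meson le_less_trans less_le_trans max.boundedE of_nat_le_iff)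
    then have "C < \<epsilon> * real M" using e' by (simp add: field_simps)
    then have "real M ^ (n - 1) * (\<epsilon> * real M + C) < real M ^ (n - 1) * (\<epsilon> * real M + \<epsilon> * real M)"
      using Mpos by (intro mult_strict_left_mono) auto
    also have "\<dots> = 2 * \<epsilon> * (real M ^ (n - 1) * real M)" by simp
    also have "real M ^ (n - 1) * real M = real M ^ n" using n2 by (metis Suc_diff_1 less_le_trans pos2 power_Suc2)
    also have "2 * \<epsilon> * real M ^ n = e * (real M / 64) ^ n" by (simp add: \<epsilon>_def power_divide)
    also have "\<dots> \<le> e * D" using D e by (intro mult_left_mono) auto
    finally have num: "(\<Sum>q\<in>{1..<M}. cmod (weyl_sum k q)) < e * D" using C[of M] by linarith
    have "norm (\<Sum>q\<in>{1..<M}. weyl_sum k q) \<le> (\<Sum>q\<in>{1..<M}. cmod (weyl_sum k q))" by (rule norm_sum)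
    then have "norm (\<Sum>q\<in>{1..<M}. weyl_sum k q) < e * D" using num by linarith
    then have "norm (\<Sum>q\<in>{1..<M}. weyl_sum k q) / D < e" using Dpos by (simp add: field_simps)
    moreover have "norm (of_nat (\<Sum>q\<in>{1..<M}. card (reduced_tuples q)) :: complex) = D"
      unfolding norm_of_nat by (simp add: D_def)
    ultimately show "norm ((\<Sum>q\<in>{1..<M}. weyl_sum k q) / of_nat (\<Sum>q\<in>{1..<M}. card (reduced_tuples q)) - 0) < e"
      by (simp only: diff_zero norm_divide)
  qed
qed

text \<open>The ceiling renders the strict inequality q < x exactly, also at integers x.\<close>

lemma I_set_below_eq: "I_set_below n x = (SIGMA q:{1..<nat \<lceil>x\<rceil>}. reduced_tuples q)"
proof -
  have "real q < x \<longleftrightarrow> q < nat \<lceil>x\<rceil>" for q by linarith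
  moreover have "p \<in> {1..n-1} \<rightarrow>\<^sub>E {0<..<q} \<and> (\<forall>i\<in>{1..n-1}. coprime (p i) q) \<longleftrightarrow> p \<in> reduced_tuples q" for p q
    unfolding reduced_tuples_def reduced_residues_def by (auto simp: PiE_def Pi_def)
  ultimately show ?thesis
    unfolding I_set_below_def I_set_def by (auto simp: Suc_le_eq)
qed

lemma equidistributed: "equidistributed_frac n dedekind_value"
  unfolding equidistributed_frac_def
proof (intro allI impI)
  fix k :: int assume k: "k \<noteq> 0"
  have lim: "filterlim (\<lambda>x::real. nat \<lceil>x\<rceil>) sequentially at_top"
    unfolding filterlim_at_top
  proof
    fix Z
    show "\<forall>\<^sub>F x::real in at_top. Z \<le> nat \<lceil>x\<rceil>"
      using eventually_ge_at_top[of "real Z"] by eventually_elim linarith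
  qed
  have "((\<lambda>x::real. (\<Sum>q\<in>{1..<nat \<lceil>x\<rceil>}. weyl_sum k q) / of_nat (\<Sum>q\<in>{1..<nat \<lceil>x\<rceil>}. card (reduced_tuples q))) \<longlongrightarrow> 0) at_top"
    by (rule filterlim_compose[OF ratio_tendsto_0[OF k] lim])
  also have "(\<lambda>x::real. (\<Sum>q\<in>{1..<nat \<lceil>x\<rceil>}. weyl_sum k q) / of_nat (\<Sum>q\<in>{1..<nat \<lceil>x\<rceil>}. card (reduced_tuples q))) =
    (\<lambda>x. (\<Sum>(q, p)\<in>I_set_below n x. exp (2 * of_real pi * \<i> * of_int k * of_real (dedekind_value q p))) / of_nat (card (I_set_below n x)))"
  proof
    fix x :: real
    have e: "exp (2 * of_real pi * \<i> * of_int k * of_real (dedekind_value q p)) = unit_exp (real_of_int k * dedekind_value q p)" for q p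
      unfolding unit_exp_def cis_conv_exp by (simp add: mult_ac)
    show "(\<Sum>q\<in>{1..<nat \<lceil>x\<rceil>}. weyl_sum k q) / of_nat (\<Sum>q\<in>{1..<nat \<lceil>x\<rceil>}. card (reduced_tuples q)) =
      (\<Sum>(q, p)\<in>I_set_below n x. exp (2 * of_real pi * \<i> * of_int k * of_real (dedekind_value q p))) / of_nat (card (I_set_below n x))"
      unfolding I_set_below_eq e weyl_sum_def by (simp add: sum.Sigma)
  qed
  finally show "((\<lambda>x. (\<Sum>(q, p)\<in>I_set_below n x. exp (2 * of_real pi * \<i> * of_int k * of_real (dedekind_value q p))) / of_nat (card (I_set_below n x))) \<longlongrightarrow> 0) at_top" .
qed

end

theorem theorem6p3:
  fixes n N :: nat and r :: "nat \<Rightarrow> nat"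
  assumes "n \<ge> 2"
    and "\<And>i. i \<in> {1..n} \<Longrightarrow> r i > 0"
    and "N = (\<Sum>i\<in>{1..n}. r i)"
    and "even N"
  shows "equidistributed_frac n (\<lambda>q p.
           real_of_int (todd_denom N n) * real q ^ (N - n) / (\<Prod>i\<in>{1..n}. fact (r i))
             * dedekind_sum n r q p)"
proof -
  interpret dedekind_setup n N r
    using assms by unfold_locales
  show ?thesis using equidistributed unfolding dedekind_value_def .
qed

end
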